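(* Let $n\in\mathbb{N}$ (including $0$) and $\hbar>0$ with $2=\hbar(n+1)$, and let $\mathcal{H}$ be the $(n+1)$-dimensional Hilbert space quantizing $S^2$. The unbounded operators $$\hat J=\mathrm{Id}\otimes\Big(-\frac{\hbar^2}{2}\frac{\mathrm{d}^2}{\mathrm{d}u^2}+\frac{u^2}{2}\Big)+\hat z\otimes\mathrm{Id},\qquad \hat H=\frac12\Big(\hat x\otimes u+\hat y\otimes\Big(\frac{\hbar}{\mathrm{i}}\frac{\partial}{\partial u}\Big)\Big)$$ on the Hilbert space $\mathcal{H}\otimes L^2(\mathbb{R})\subset L^2(\mathbb{R}^2)\otimes L^2(\mathbb{R})$ are self-adjoint and commute. The spectrum of $\hat J$ is discrete and consists of eigenvalues in $\hbar\big(\frac{1-n}{2}+\mathbb{N}\big)$. For a fixed eigenvalue $\lambda$ of $\hat J$, let $\mathcal{E}_\lambda=\ker(\hat J-\lambda\,\mathrm{Id})$ and put $\ell_0=\frac{\lambda}{\hbar}+\frac{n-1}{2}$, $\mu=\min(\ell_0,n)$ and $\beta_k=\sqrt{(\ell_0+1-k)\,k\,(n-k+1)}$ for $1\le k\le\mu$. Then $\dim\mathcal{E}_\lambda=\mu+1$, and there exists a basis $\mathcal{B}_\lambda$ of $\mathcal{E}_\lambda$ in which the restriction of $\hat H$ to $\mathcal{E}_\lambda$ is given by the $(\mu+1)\times(\mu+1)$ symmetric tridiagonal matrix $$\Big(\frac{\hbar}{2}\Big)^{3/2}\begin{pmatrix}0&\beta_1&0&\cdots&0\\ \beta_1&0&\beta_2&&\vdots\\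 0&\beta_2&0&\ddots&0\\ \vdots&&\ddots&\ddots&\beta_\mu\\ 0&\cdots&0&\beta_\mu&0\end{pmatrix}.$$
   Context: On $L^2(\mathbb{R}^2)$ with variables $(x_1,x_2)$, let $a_j=\frac{1}{\sqrt{2\hbar}}\big(\hbar\frac{\partial}{\partial x_j}+x_j\big)$ for $j=1,2$, with adjoints $a_j^*=\frac{1}{\sqrt{2\hbar}}\big(-\hbar\frac{\partial}{\partial x_j}+x_j\big)$, and let $$\hat L=-\frac{\hbar^2}{2}\Big(\frac{\partial^2}{\partial x_1^2}+\frac{\partial^2}{\partial x_2^2}\Big)+\frac{x_1^2+x_2^2}{2}=\hbar(a_1a_1^*+a_2a_2^*-1).$$ The Hilbert space quantizing the unit sphere $S^2$ is $\mathcal{H}=\ker(\hat L-2)$ (recall $2=\hbar(n+1)$), which has dimension $n+1$. The operators $\hat x,\hat y,\hat z$ on $\mathcal{H}$ are the restrictions to $\mathcal{H}$ of $$\hat x=\frac{\hbar}{2}(a_1a_2^*+a_2a_1^* ),\quad \hat y=\frac{\hbar}{2\mathrm{i}}(a_1a_2^*-a_2a_1^* ),\quad \hat z=\frac{\hbar}{2}(a_1a_1^*-a_2a_2^* ),$$ which leave $\mathcal{H}$ invariant. The operators $\hat J,\hat H$ are initially defined on $\mathcal{H}\otimes\mathcal{S}(\mathbb{R})$, with $\mathcal{S}(\mathbb{R})$ the Schwartz space in the variable $u$, and are then extended by closure. $\mathbb{N}=\{0,1,2,\dots\}$. *)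

theory Defs
  imports "HOL-Analysis.Analysis"
begin

section \<open>Complex vector spaces\<close>

class complex_vector = real_vector +
  fixes scaleC :: "complex \<Rightarrow> 'a \<Rightarrow> 'a"  (infixr \<open>*\<^sub>C\<close> 75)
  assumes scaleC_add_right: "a *\<^sub>C (x + y) = a *\<^sub>C x + a *\<^sub>C y"
    and scaleC_add_left: "(a + b) *\<^sub>C x = a *\<^sub>C x + b *\<^sub>C x"
    and scaleC_scaleC: "a *\<^sub>C b *\<^sub>C x = (a * b) *\<^sub>C x"
    and scaleC_one: "1 *\<^sub>C x = x"
    and scaleR_scaleC: "r *\<^sub>R x = complex_of_real r *\<^sub>C x"

global_interpretation complex_vector: vector_space "scaleC :: complex \<Rightarrow> 'a \<Rightarrow> 'a::complex_vector"
  defines cdependent = complex_vector.dependent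
    and csubspace = complex_vector.subspace
    and cspan = complex_vector.span
    and cdim = complex_vector.dim
  by unfold_locales (simp_all add: scaleC_add_right scaleC_add_left scaleC_scaleC scaleC_one)

instantiation prod :: (complex_vector, complex_vector) complex_vector
begin

definition scaleC_prod :: "complex \<Rightarrow> 'a \<times> 'b \<Rightarrow> 'a \<times> 'b"
  where "scaleC_prod c p = (c *\<^sub>C fst p, c *\<^sub>C snd p)"

instance
  by standard
    (auto simp: scaleC_prod_def scaleC_add_right scaleC_add_left scaleC_scaleC scaleC_one
      scaleR_prod_def scaleR_scaleC)

end


section \<open>The Hilbert space of square-integrable functions\<close>

definition square_integrable :: "('a::euclidean_space \<Rightarrow> complex) \<Rightarrow> bool"
  where "square_integrable f \<longleftrightarrow>
    f \<in> borel_measurable lborel \<and> integrable lborel (\<lambda>x. (cmod (f x))\<^sup>2)"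

definition L2_rel :: "('a::euclidean_space \<Rightarrow> complex) \<Rightarrow> ('a \<Rightarrow> complex) \<Rightarrow> bool"
  where "L2_rel f g \<longleftrightarrow>
    square_integrable f \<and> square_integrable g \<and> (AE x in lborel. f x = g x)"

lemma square_integrable_zero: "square_integrable (\<lambda>x. 0)"
  by (simp add: square_integrable_def)

quotient_type (overloaded) 'a L2 = "'a::euclidean_space \<Rightarrow> complex" / partial: L2_rel
proof (rule part_equivpI)
  show "\<exists>f. L2_rel f f"
    by (rule exI[of _ "\<lambda>x. 0"]) (simp add: L2_rel_def square_integrable_zero)
  show "symp L2_rel"
    by (rule sympI) (auto simp: L2_rel_def elim: AE_mp)
  show "transp L2_rel"
    by (rule transpI) (auto simp: L2_rel_def)
qed

lemma square_integrable_scale: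
  assumes "square_integrable f" shows "square_integrable (\<lambda>x. c * f x)"
  using assms by (auto simp: square_integrable_def norm_mult power_mult_distrib)

lemma square_integrable_mult_cnj:
  assumes "square_integrable f" "square_integrable g"
  shows "integrable lborel (\<lambda>x. f x * cnj (g x))"
proof (rule Bochner_Integration.integrable_bound)
  show "integrable lborel (\<lambda>x. (cmod (f x))\<^sup>2 + (cmod (g x))\<^sup>2)"
    using assms by (auto simp: square_integrable_def)
  show "(\<lambda>x. f x * cnj (g x)) \<in> borel_measurable lborel"
    using assms by (auto simp: square_integrable_def intro!: borel_measurable_times
      borel_measurable_continuous_on[of cnj] continuous_on_cnj continuous_on_id)
  show "AE x in lborel. norm (f x * cnj (g x)) \<le> norm ((cmod (f x))\<^sup>2 + (cmod (g x))\<^sup>2)"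
  proof (rule AE_I2)
    fix x
    have "0 \<le> (cmod (f x) - cmod (g x))\<^sup>2" "0 \<le> cmod (f x) * cmod (g x)"
      by simp_all
    hence "cmod (f x) * cmod (g x) \<le> (cmod (f x))\<^sup>2 + (cmod (g x))\<^sup>2"
      unfolding power2_diff by linarith
    thus "norm (f x * cnj (g x)) \<le> norm ((cmod (f x))\<^sup>2 + (cmod (g x))\<^sup>2)"
      by (simp add: norm_mult)
  qed
qed

lemma square_integrable_add:
  assumes "square_integrable f" "square_integrable g"
  shows "square_integrable (\<lambda>x. f x + g x)"
proof -
  have meas: "(\<lambda>x. f x + g x) \<in> borel_measurable lborel"
    using assms by (auto simp: square_integrable_def)
  have "integrable lborel (\<lambda>x. (cmod (f x + g x))\<^sup>2)"
  proof (rule Bochner_Integration.integrable_bound)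
    show "integrable lborel (\<lambda>x. 2 * (cmod (f x))\<^sup>2 + 2 * (cmod (g x))\<^sup>2)"
      using assms by (auto simp: square_integrable_def)
    show "(\<lambda>x. (cmod (f x + g x))\<^sup>2) \<in> borel_measurable lborel"
      using meas by auto
    show "AE x in lborel. norm ((cmod (f x + g x))\<^sup>2)
        \<le> norm (2 * (cmod (f x))\<^sup>2 + 2 * (cmod (g x))\<^sup>2)"
    proof (rule AE_I2)
      fix x
      have "(cmod (f x + g x))\<^sup>2 \<le> (cmod (f x) + cmod (g x))\<^sup>2"
        by (intro power_mono norm_triangle_ineq) simp
      moreover have "0 \<le> (cmod (f x) - cmod (g x))\<^sup>2" by simp
      ultimately have "(cmod (f x + g x))\<^sup>2 \<le> 2 * (cmod (f x))\<^sup>2 + 2 * (cmod (g x))\<^sup>2"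
        unfolding power2_diff power2_sum by linarith
      thus "norm ((cmod (f x + g x))\<^sup>2) \<le> norm (2 * (cmod (f x))\<^sup>2 + 2 * (cmod (g x))\<^sup>2)"
        by simp
    qed
  qed
  with meas show ?thesis by (simp add: square_integrable_def)
qed

instantiation L2 :: (euclidean_space) complex_vector
begin

lift_definition zero_L2 :: "'a L2" is "\<lambda>x. 0"
  by (simp add: L2_rel_def square_integrable_zero)

lift_definition plus_L2 :: "'a L2 \<Rightarrow> 'a L2 \<Rightarrow> 'a L2" is "\<lambda>f g x. f x + g x"
  by (auto simp: L2_rel_def intro: square_integrable_add)

lift_definition scaleC_L2 :: "complex \<Rightarrow> 'a L2 \<Rightarrow> 'a L2" is "\<lambda>c f x. c * f x"
  by (auto simp: L2_rel_def intro: square_integrable_scale)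

definition scaleR_L2 :: "real \<Rightarrow> 'a L2 \<Rightarrow> 'a L2"
  where "scaleR_L2 r v = complex_of_real r *\<^sub>C v"

definition uminus_L2 :: "'a L2 \<Rightarrow> 'a L2"
  where "uminus_L2 v = (- 1) *\<^sub>C v"

definition minus_L2 :: "'a L2 \<Rightarrow> 'a L2 \<Rightarrow> 'a L2"
  where "minus_L2 v w = v + (- 1) *\<^sub>C w"

lemmas L2_closure_rules =
  square_integrable_add square_integrable_scale square_integrable_zero

lemma L2_vector_laws:
  fixes u v w :: "'a L2"
  shows "u + v + w = u + (v + w)" "u + v = v + u" "0 + u = u" "(- 1) *\<^sub>C u + u = 0"
    "a *\<^sub>C (u + v) = a *\<^sub>C u + a *\<^sub>C v" "(a + b) *\<^sub>C u = a *\<^sub>C u + b *\<^sub>C u"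
    "a *\<^sub>C b *\<^sub>C u = (a * b) *\<^sub>C u" "1 *\<^sub>C u = u"
  by (transfer; auto simp: L2_rel_def algebra_simps intro!: L2_closure_rules;
      (intro L2_closure_rules; assumption)?)+

instance
proof
  fix u v w :: "'a L2" and a b :: complex and r s :: real
  note L2_defs = scaleR_L2_def uminus_L2_def minus_L2_def
  show "u + v + w = u + (v + w)" "u + v = v + u" "0 + u = u"
    by (rule L2_vector_laws)+
  show "- u + u = 0" "u - v = u + - v"
    by (simp_all only: L2_defs L2_vector_laws(4))
  show "a *\<^sub>C (u + v) = a *\<^sub>C u + a *\<^sub>C v" "(a + b) *\<^sub>C u = a *\<^sub>C u + b *\<^sub>C u"
    "a *\<^sub>C b *\<^sub>C u = (a * b) *\<^sub>C u" "1 *\<^sub>C u = u"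
    by (rule L2_vector_laws)+
  show "r *\<^sub>R u = complex_of_real r *\<^sub>C u"
    by (simp only: L2_defs)
  show "r *\<^sub>R (u + v) = r *\<^sub>R u + r *\<^sub>R v" "(r + s) *\<^sub>R u = r *\<^sub>R u + s *\<^sub>R u"
    "r *\<^sub>R s *\<^sub>R u = (r * s) *\<^sub>R u" "1 *\<^sub>R u = u"
    by (simp_all only: L2_defs L2_vector_laws(5-8) of_real_add of_real_mult of_real_1)
qed

end

lift_definition cinner :: "'a::euclidean_space L2 \<Rightarrow> 'a L2 \<Rightarrow> complex"
  is "\<lambda>f g. LINT x|lborel. f x * cnj (g x)"
proof -
  fix f f' g g' :: "'a \<Rightarrow> complex"
  assume *: "L2_rel f f'" "L2_rel g g'"
  hence "square_integrable f" "square_integrable f'" "square_integrable g" "square_integrable g'"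
    by (auto simp: L2_rel_def)
  hence "integrable lborel (\<lambda>x. f x * cnj (g x))" "integrable lborel (\<lambda>x. f' x * cnj (g' x))"
    by (auto intro: square_integrable_mult_cnj)
  moreover have "AE x in lborel. f x * cnj (g x) = f' x * cnj (g' x)"
    using * by (auto simp: L2_rel_def)
  ultimately show "(LINT x|lborel. f x * cnj (g x)) = (LINT x|lborel. f' x * cnj (g' x))"
    by (intro integral_cong_AE) auto
qed

lemma cinner_add_left: "cinner (u + v) w = cinner u w + cinner v w"
  by transfer (simp add: L2_rel_def distrib_right square_integrable_mult_cnj)

lemma cinner_scaleC_left: "cinner (c *\<^sub>C u) w = c * cinner u w"
  by transfer (simp add: mult.assoc)

lemma cinner_commute: "cinner u v = cnj (cinner v u)"
proof (transfer, goal_cases)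
  case (1 u v)
  have "(LINT x|lborel. u x * cnj (v x)) = (LINT x|lborel. cnj (v x * cnj (u x)))"
    by (simp add: mult.commute)
  also have "\<dots> = cnj (LINT x|lborel. v x * cnj (u x))"
    by (rule Bochner_Integration.integral_cnj)
  finally show ?case .
qed

lemma cinner_self: "Re (cinner u u) \<ge> 0 \<and> (Re (cinner u u) = 0 \<longleftrightarrow> u = 0)"
proof (transfer, goal_cases)
  case (1 u)
  hence u: "square_integrable u" by (simp add: L2_rel_def)
  have "(LINT x|lborel. u x * cnj (u x)) = (LINT x|lborel. complex_of_real ((cmod (u x))\<^sup>2))"
    by (intro Bochner_Integration.integral_cong refl) (simp only: complex_norm_square)
  also have "\<dots> = complex_of_real (LINT x|lborel. (cmod (u x))\<^sup>2)"
    by (rule integral_complex_of_real)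
  finally have eq: "Re (LINT x|lborel. u x * cnj (u x)) = (LINT x|lborel. (cmod (u x))\<^sup>2)"
    by simp
  show ?case unfolding eq
    using u by (subst integral_nonneg_eq_0_iff_AE)
      (auto simp: square_integrable_def L2_rel_def square_integrable_zero)
qed

instantiation L2 :: (euclidean_space) real_inner
begin

definition inner_L2 :: "'a L2 \<Rightarrow> 'a L2 \<Rightarrow> real"
  where "inner_L2 u v = Re (cinner u v)"

definition norm_L2 :: "'a L2 \<Rightarrow> real"
  where "norm_L2 u = sqrt (inner u u)"

definition sgn_L2 :: "'a L2 \<Rightarrow> 'a L2"
  where "sgn_L2 u = inverse (norm u) *\<^sub>R u"

definition dist_L2 :: "'a L2 \<Rightarrow> 'a L2 \<Rightarrow> real"
  where "dist_L2 u v = norm (u - v)"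

definition uniformity_L2 :: "('a L2 \<times> 'a L2) filter"
  where "uniformity_L2 = (INF e\<in>{0<..}. principal {(u, v). dist u v < e})"

definition open_L2 :: "'a L2 set \<Rightarrow> bool"
  where "open_L2 U \<longleftrightarrow> (\<forall>u\<in>U. eventually (\<lambda>(u', v). u' = u \<longrightarrow> v \<in> U) uniformity)"

instance
proof
  fix u v w :: "'a L2" and r :: real
  show "inner u v = inner v u"
    unfolding inner_L2_def by (subst cinner_commute) simp
  show "inner (u + v) w = inner u w + inner v w"
    by (simp add: inner_L2_def cinner_add_left)
  show "inner (r *\<^sub>R u) v = r * inner u v"
    by (simp add: inner_L2_def scaleR_scaleC cinner_scaleC_left)
  show "0 \<le> inner u u" "inner u u = 0 \<longleftrightarrow> u = 0"
    using cinner_self[of u] by (simp_all add: inner_L2_def)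
qed (simp_all add: norm_L2_def sgn_L2_def dist_L2_def uniformity_L2_def open_L2_def)

end

text \<open>
  The Hilbert tensor product \<open>L\<^sup>2(\<real>\<^sup>a) \<otimes> L\<^sup>2(\<real>\<^sup>b)\<close> is realised as \<open>L\<^sup>2(\<real>\<^sup>a \<times> \<real>\<^sup>b)\<close>,
  where \<open>f \<otimes> g\<close> is the class of \<open>(x, u) \<mapsto> f(x) g(u)\<close>.
\<close>

lift_definition tensor ::
  "'a::euclidean_space L2 \<Rightarrow> 'b::euclidean_space L2 \<Rightarrow> ('a \<times> 'b) L2"  (infixr \<open>\<otimes>\<^sub>2\<close> 70)
  is "\<lambda>f g p. f (fst p) * g (snd p)"
proof -
  fix f f' :: "'a \<Rightarrow> complex" and g g' :: "'b \<Rightarrow> complex"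
  assume f: "L2_rel f f'" and g: "L2_rel g g'"
  have sq: "square_integrable (\<lambda>p. h (fst p) * k (snd p))"
    if "square_integrable h" "square_integrable k" for h :: "'a \<Rightarrow> complex" and k :: "'b \<Rightarrow> complex"
  proof -
    have [measurable]: "h \<in> borel_measurable borel" "k \<in> borel_measurable borel"
      using that by (auto simp: square_integrable_def)
    have "integrable (lborel \<Otimes>\<^sub>M lborel) (\<lambda>p. (cmod (h (fst p) * k (snd p)))\<^sup>2)"
    proof (rule lborel_pair.Fubini_integrable)
      show "(\<lambda>p. (cmod (h (fst p) * k (snd p)))\<^sup>2) \<in> borel_measurable (lborel \<Otimes>\<^sub>M lborel)"
        by measurable
    qed (use that in \<open>auto simp: square_integrable_def norm_mult power_mult_distrib\<close>)
    hence "integrable lborel (\<lambda>p. (cmod (h (fst p) * k (snd p)))\<^sup>2)"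
      by (simp add: lborel_prod)
    moreover have "(\<lambda>p. h (fst p) * k (snd p)) \<in> borel_measurable (borel \<Otimes>\<^sub>M borel)"
      by measurable
    ultimately show ?thesis
      by (simp add: square_integrable_def borel_prod)
  qed
  have [measurable]: "f \<in> borel_measurable borel" "f' \<in> borel_measurable borel"
    "g \<in> borel_measurable borel" "g' \<in> borel_measurable borel"
    using f g by (auto simp: L2_rel_def square_integrable_def)
  have "AE p in lborel \<Otimes>\<^sub>M lborel. f (fst p) * g (snd p) = f' (fst p) * g' (snd p)"
  proof (rule lborel_pair.AE_pair_measure)
    show "{p \<in> space (lborel \<Otimes>\<^sub>M lborel). f (fst p) * g (snd p) = f' (fst p) * g' (snd p)}
        \<in> sets (lborel \<Otimes>\<^sub>M lborel)"
      by measurable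
    have "AE x in lborel. f x = f' x" "AE y in lborel. g y = g' y"
      using f g by (auto simp: L2_rel_def)
    thus "AE x in lborel. AE y in lborel.
        f (fst (x, y)) * g (snd (x, y)) = f' (fst (x, y)) * g' (snd (x, y))"
      by auto
  qed
  hence "AE p in lborel. f (fst p) * g (snd p) = f' (fst p) * g' (snd p)"
    unfolding lborel_prod .
  with f g show "L2_rel (\<lambda>p. f (fst p) * g (snd p)) (\<lambda>p. f' (fst p) * g' (snd p))"
    by (auto simp: L2_rel_def intro: sq)
qed


section \<open>Unbounded operators\<close>

text \<open>
  An operator is represented by its graph, so that closing an operator means taking the
  closure of the graph.  \<open>K\<close> is the Hilbert space on which the operator acts, given
  as a closed complex subspace of an ambient \<open>L\<^sup>2\<close> space.
\<close>

type_synonym 'a operator = "('a L2 \<times> 'a L2) set"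

definition op_add :: "'a::euclidean_space operator \<Rightarrow> 'a operator \<Rightarrow> 'a operator"
  where "op_add A B = {(v, w + w') |v w w'. (v, w) \<in> A \<and> (v, w') \<in> B}"

definition op_scale :: "complex \<Rightarrow> 'a::euclidean_space operator \<Rightarrow> 'a operator"
  where "op_scale c A = {(v, c *\<^sub>C w) |v w. (v, w) \<in> A}"

definition op_restrict :: "'a::euclidean_space L2 set \<Rightarrow> 'a operator \<Rightarrow> 'a operator"
  where "op_restrict K A = {(v, w) \<in> A. v \<in> K}"

text \<open>The operator on the algebraic tensor product of the domains.\<close>

definition op_tensor ::
  "'a::euclidean_space operator \<Rightarrow> 'b::euclidean_space operator \<Rightarrow> ('a \<times> 'b) operator"
  where "op_tensor A B =
    cspan {(v \<otimes>\<^sub>2 u, w \<otimes>\<^sub>2 y) |v w u y. (v, w) \<in> A \<and> (u, y) \<in> B}"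

definition densely_defined_operator :: "'a::euclidean_space L2 set \<Rightarrow> 'a operator \<Rightarrow> bool"
  where "densely_defined_operator K A \<longleftrightarrow>
    A \<subseteq> K \<times> K \<and> single_valued A \<and> csubspace A \<and> K \<subseteq> closure (Domain A)"

definition adjoint_operator :: "'a::euclidean_space L2 set \<Rightarrow> 'a operator \<Rightarrow> 'a operator"
  where "adjoint_operator K A =
    {(v, w). v \<in> K \<and> w \<in> K \<and> (\<forall>(x, y)\<in>A. cinner y v = cinner x w)}"

definition self_adjoint :: "'a::euclidean_space L2 set \<Rightarrow> 'a operator \<Rightarrow> bool"
  where "self_adjoint K A \<longleftrightarrow> densely_defined_operator K A \<and> adjoint_operator K A = A"

definition eigenspace :: "'a::euclidean_space operator \<Rightarrow> complex \<Rightarrow> 'a L2 set"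
  where "eigenspace A z = {v. (v, z *\<^sub>C v) \<in> A}"

definition eigenvalue :: "'a::euclidean_space operator \<Rightarrow> complex \<Rightarrow> bool"
  where "eigenvalue A z \<longleftrightarrow> (\<exists>v\<in>eigenspace A z. v \<noteq> 0)"

definition resolvent_set :: "'a::euclidean_space L2 set \<Rightarrow> 'a operator \<Rightarrow> complex set"
  where "resolvent_set K A = {z.
    (\<forall>w\<in>K. \<exists>!v. (v, w + z *\<^sub>C v) \<in> A) \<and>
    (\<exists>C. \<forall>(v, y)\<in>A. norm v \<le> C * norm (y - z *\<^sub>C v))}"

definition spectrum :: "'a::euclidean_space L2 set \<Rightarrow> 'a operator \<Rightarrow> complex set"
  where "spectrum K A = - resolvent_set K A"


subsection \<open>Spectral measures and commuting self-adjoint operators\<close>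

definition orthogonal_projection ::
  "'a::euclidean_space L2 set \<Rightarrow> ('a L2 \<Rightarrow> 'a L2) \<Rightarrow> bool"
  where "orthogonal_projection K P \<longleftrightarrow>
    (\<forall>v\<in>K. P v \<in> K \<and> P (P v) = P v) \<and>
    (\<forall>v\<in>K. \<forall>w\<in>K. \<forall>c. P (v + w) = P v + P w \<and> P (c *\<^sub>C v) = c *\<^sub>C P v) \<and>
    (\<forall>v\<in>K. \<forall>w\<in>K. cinner (P v) w = cinner v (P w))"

definition projection_valued_measure ::
  "'a::euclidean_space L2 set \<Rightarrow> (real set \<Rightarrow> 'a L2 \<Rightarrow> 'a L2) \<Rightarrow> bool"
  where "projection_valued_measure K E \<longleftrightarrow>
    (\<forall>S\<in>sets borel. orthogonal_projection K (E S)) \<and>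
    (\<forall>v\<in>K. E UNIV v = v) \<and>
    (\<forall>S :: nat \<Rightarrow> real set. range S \<subseteq> sets borel \<and> disjoint_family S \<longrightarrow>
      (\<forall>v\<in>K. (\<lambda>i. E (S i) v) sums E (\<Union>i. S i) v))"

text \<open>The scalar measure \<open>S \<mapsto> \<langle>E(S) v, v\<rangle>\<close>.\<close>

definition scalar_spectral_measure ::
  "(real set \<Rightarrow> 'a::euclidean_space L2 \<Rightarrow> 'a L2) \<Rightarrow> 'a L2 \<Rightarrow> real measure"
  where "scalar_spectral_measure E v =
    measure_of UNIV (sets borel) (\<lambda>S. ennreal (Re (cinner (E S v) v)))"

text \<open>
  \<open>E\<close> is the spectral measure of \<open>A\<close>, that is \<open>A = \<integral> t dE(t)\<close>; by polarisation the
  quadratic form determines \<open>A\<close>.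
\<close>

definition spectral_measure_of ::
  "'a::euclidean_space L2 set \<Rightarrow> 'a operator \<Rightarrow> (real set \<Rightarrow> 'a L2 \<Rightarrow> 'a L2) \<Rightarrow> bool"
  where "spectral_measure_of K A E \<longleftrightarrow>
    projection_valued_measure K E \<and>
    Domain A = {v \<in> K. integrable (scalar_spectral_measure E v) (\<lambda>t. t\<^sup>2)} \<and>
    (\<forall>(v, w)\<in>A. cinner w v = complex_of_real (LINT t|scalar_spectral_measure E v. t))"

text \<open>Commutation of (unbounded) self-adjoint operators: all spectral projections commute.\<close>

definition operators_commute ::
  "'a::euclidean_space L2 set \<Rightarrow> 'a operator \<Rightarrow> 'a operator \<Rightarrow> bool"
  where "operators_commute K A B \<longleftrightarrow>
    (\<exists>E F. spectral_measure_of K A E \<and> spectral_measure_of K B F \<and>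
      (\<forall>S\<in>sets borel. \<forall>T\<in>sets borel. \<forall>v\<in>K. E S (F T v) = F T (E S v)))"


section \<open>Differential operators on Schwartz functions\<close>

definition partial :: "'a::euclidean_space \<Rightarrow> ('a \<Rightarrow> complex) \<Rightarrow> 'a \<Rightarrow> complex"
  where "partial b f x = frechet_derivative f (at x) b"

definition schwartz :: "('a::euclidean_space \<Rightarrow> complex) \<Rightarrow> bool"
  where "schwartz f \<longleftrightarrow>
    (\<forall>bs\<in>lists Basis.
      (\<forall>x. foldr partial bs f differentiable at x) \<and>
      (\<forall>k::nat. bounded (range (\<lambda>x. norm x ^ k * cmod (foldr partial bs f x)))))"

text \<open>\<open>abs_L2 f\<close> is the class of \<open>f\<close> modulo equality almost everywhere.\<close>

definition schwartz_op ::
  "(('a::euclidean_space \<Rightarrow> complex) \<Rightarrow> ('a \<Rightarrow> complex)) \<Rightarrow> 'a operator"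
  where "schwartz_op D = {(abs_L2 f, abs_L2 (D f)) |f. schwartz f}"


section \<open>The quantum spin-oscillator\<close>

type_synonym plane = "real \<times> real"

abbreviation e1 :: plane where "e1 \<equiv> (1, 0)"
abbreviation e2 :: plane where "e2 \<equiv> (0, 1)"

text \<open>\<open>a_op h e\<^sub>j\<close> and \<open>a_adj h e\<^sub>j\<close> are \<open>a\<^sub>j\<close> and \<open>a\<^sub>j\<^sup>*\<close>.\<close>

definition a_op :: "real \<Rightarrow> plane \<Rightarrow> (plane \<Rightarrow> complex) \<Rightarrow> plane \<Rightarrow> complex"
  where "a_op h e f x =
    (complex_of_real h * partial e f x + complex_of_real (inner x e) * f x)
      / complex_of_real (sqrt (2 * h))"

definition a_adj :: "real \<Rightarrow> plane \<Rightarrow> (plane \<Rightarrow> complex) \<Rightarrow> plane \<Rightarrow> complex"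
  where "a_adj h e f x =
    (- complex_of_real h * partial e f x + complex_of_real (inner x e) * f x)
      / complex_of_real (sqrt (2 * h))"

definition L_diff :: "real \<Rightarrow> (plane \<Rightarrow> complex) \<Rightarrow> plane \<Rightarrow> complex"
  where "L_diff h f x =
    - complex_of_real (h\<^sup>2 / 2) * (partial e1 (partial e1 f) x + partial e2 (partial e2 f) x)
    + complex_of_real (((fst x)\<^sup>2 + (snd x)\<^sup>2) / 2) * f x"

definition x_diff :: "real \<Rightarrow> (plane \<Rightarrow> complex) \<Rightarrow> plane \<Rightarrow> complex"
  where "x_diff h f x =
    complex_of_real (h / 2) * (a_op h e1 (a_adj h e2 f) x + a_op h e2 (a_adj h e1 f) x)"

definition y_diff :: "real \<Rightarrow> (plane \<Rightarrow> complex) \<Rightarrow> plane \<Rightarrow> complex"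
  where "y_diff h f x =
    complex_of_real h / (2 * \<i>) * (a_op h e1 (a_adj h e2 f) x - a_op h e2 (a_adj h e1 f) x)"

definition z_diff :: "real \<Rightarrow> (plane \<Rightarrow> complex) \<Rightarrow> plane \<Rightarrow> complex"
  where "z_diff h f x =
    complex_of_real (h / 2) * (a_op h e1 (a_adj h e1 f) x - a_op h e2 (a_adj h e2 f) x)"

text \<open>\<open>\<H> = ker (L - 2)\<close>, where \<open>L\<close> is the closure of the differential operator on Schwartz functions.\<close>

definition sphere_space :: "real \<Rightarrow> plane L2 set"
  where "sphere_space h = eigenspace (closure (schwartz_op (L_diff h))) 2"

text \<open>
  The restrictions to \<open>\<H>\<close>; since \<open>\<H>\<close> consists of (classes of) Schwartz functions,
  they are defined on all of \<open>\<H>\<close>.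
\<close>

definition x_hat :: "real \<Rightarrow> plane operator"
  where "x_hat h = op_restrict (sphere_space h) (schwartz_op (x_diff h))"

definition y_hat :: "real \<Rightarrow> plane operator"
  where "y_hat h = op_restrict (sphere_space h) (schwartz_op (y_diff h))"

definition z_hat :: "real \<Rightarrow> plane operator"
  where "z_hat h = op_restrict (sphere_space h) (schwartz_op (z_diff h))"

text \<open>\<open>-h\<^sup>2/2 d\<^sup>2/du\<^sup>2 + u\<^sup>2/2\<close>, multiplication by \<open>u\<close>, and \<open>(h/i) d/du\<close>.\<close>

definition oscillator_diff :: "real \<Rightarrow> (real \<Rightarrow> complex) \<Rightarrow> real \<Rightarrow> complex"
  where "oscillator_diff h f u =
    - complex_of_real (h\<^sup>2 / 2) * partial 1 (partial 1 f) u + complex_of_real (u\<^sup>2 / 2) * f u"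

definition position_diff :: "(real \<Rightarrow> complex) \<Rightarrow> real \<Rightarrow> complex"
  where "position_diff f u = complex_of_real u * f u"

definition momentum_diff :: "real \<Rightarrow> (real \<Rightarrow> complex) \<Rightarrow> real \<Rightarrow> complex"
  where "momentum_diff h f u = complex_of_real h / \<i> * partial 1 f u"

text \<open>The Hilbert space \<open>\<H> \<otimes> L\<^sup>2(\<real>)\<close> inside \<open>L\<^sup>2(\<real>\<^sup>2 \<times> \<real>)\<close>.\<close>

definition spin_oscillator_space :: "real \<Rightarrow> (plane \<times> real) L2 set"
  where "spin_oscillator_space h = closure (cspan {v \<otimes>\<^sub>2 u |v u. v \<in> sphere_space h})"

definition J_hat :: "real \<Rightarrow> (plane \<times> real) operator"
  where "J_hat h = closure (op_add
    (op_tensor (Id_on (sphere_space h)) (schwartz_op (oscillator_diff h)))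
    (op_tensor (z_hat h) (schwartz_op id)))"

definition H_hat :: "real \<Rightarrow> (plane \<times> real) operator"
  where "H_hat h = closure (op_scale (1 / 2) (op_add
    (op_tensor (x_hat h) (schwartz_op position_diff))
    (op_tensor (y_hat h) (schwartz_op (momentum_diff h)))))"


section \<open>Bases and matrices\<close>

text \<open>\<open>b 0, \<dots>, b m\<close> is a basis of the complex vector space \<open>V\<close>.\<close>

definition is_basis :: "'a::complex_vector set \<Rightarrow> nat \<Rightarrow> (nat \<Rightarrow> 'a) \<Rightarrow> bool"
  where "is_basis V m b \<longleftrightarrow>
    inj_on b {..m} \<and> \<not> cdependent (b ` {..m}) \<and> cspan (b ` {..m}) = V"

text \<open>In the basis \<open>b\<close>, \<open>A\<close> has the matrix \<open>M\<close> with rows and columns indexed by \<open>0, \<dots>, m\<close>.\<close>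

definition has_matrix ::
  "'a::euclidean_space operator \<Rightarrow> nat \<Rightarrow> (nat \<Rightarrow> 'a L2) \<Rightarrow> (nat \<Rightarrow> nat \<Rightarrow> complex) \<Rightarrow> bool"
  where "has_matrix A m b M \<longleftrightarrow>
    (\<forall>k\<le>m. (b k, \<Sum>j\<le>m. M j k *\<^sub>C b j) \<in> A)"

definition beta :: "nat \<Rightarrow> nat \<Rightarrow> nat \<Rightarrow> real"
  where "beta n l k = sqrt ((real l + 1 - real k) * real k * (real n - real k + 1))"

definition tridiagonal :: "(nat \<Rightarrow> real) \<Rightarrow> nat \<Rightarrow> nat \<Rightarrow> real"
  where "tridiagonal b i j =
    (if j = i + 1 then b j else if i = j + 1 then b i else 0)"

end

theory Submission
  imports Defs
    "HOL-Computational_Algebra.Fundamental_Theorem_Algebra"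
    "HOL-Probability.Levy"
    "HOL-Real_Asymp.Real_Asymp"
begin

text \<open>
  Both operators conserve the total number of excitations, and everything follows from writing them in
  one explicit orthonormal basis.

  Let \<open>\<phi>\<^sub>j\<close> be the normalized Hermite functions for the parameter \<open>h\<close>.  The closure of \<open>L\<close> is diagonal
  in the products \<open>\<phi>\<^sub>j \<otimes> \<phi>\<^sub>k\<close> with eigenvalues \<open>h (j + k + 1)\<close>, so the space of the sphere is spanned by
  the \<open>\<phi>\<^sub>j \<otimes> \<phi>\<^sub>n\<^sub>-\<^sub>j\<close> for \<open>j \<le> n\<close> (lemma \<open>sphere_space_hvec2\<close>).  Hence the
  vectors \<open>evec (j, m) = \<phi>\<^sub>j \<otimes> \<phi>\<^sub>n\<^sub>-\<^sub>j \<otimes> \<phi>\<^sub>m\<close> form an orthonormal basis of the Hilbert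
  space of the spin-oscillator.  Each is an eigenvector of \<open>J\<close> with eigenvalue
  \<open>h ((1 - n) / 2 + j + m)\<close>.  In terms of the ladder operators of the three oscillators, with \<open>b\<close>
  acting in the variable \<open>u\<close>,
  \<open>H = (h/2) powr (3/2) (a\<^sub>1 a\<^sub>2\<^sup>* b\<^sup>* + a\<^sub>2 a\<^sub>1\<^sup>* b)\<close>,
  so \<open>H\<close> moves \<open>(j, m)\<close> to \<open>(j - 1, m + 1)\<close> and \<open>(j + 1, m - 1)\<close> and preserves \<open>l = j + m\<close>.  On the
  eigenspace of \<open>J\<close> belonging to \<open>l\<close>, with basis \<open>evec (k, l - k)\<close> for \<open>k \<le> min l n\<close>, its matrix is
  the tridiagonal one (lemma \<open>eigenspace_J\<close>).

  For the statements about unbounded operators, the finite-dimensional spectral theorem is applied to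
  \<open>H\<close> in each of these blocks.  The result is an orthonormal basis of common eigenvectors that lie in
  the algebraic domain of both operators.  A symmetric operator whose domain contains an orthonormal
  basis of eigenvectors has a closure that is the maximal diagonal operator in this basis
  (\<open>closure_eq_diag_op\<close>).  Diagonal operators with real eigenvalues are self-adjoint, their
  spectral projections are coordinate projections, which commute with each other, and their spectrum is
  the set of eigenvalues when this set is closed (\<open>simultaneous_diagonalization\<close>,
  \<open>spectral_measure_diag_op\<close>, \<open>spectrum_diag_op\<close>).

  The analytic input is the completeness of the space of square-integrable functions, integration by
  parts for Schwartz functions, which makes all the differential operators symmetric, and the
  completeness of the Hermite functions.  The last holds because a function orthogonal to all of them,
  multiplied by a Gaussian, has vanishing moments and therefore vanishing Fourier transform
  (\<open>hvec_complete\<close>); it passes to products by Fubini (\<open>tensor_complete\<close>).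
\<close>

section \<open>The Hilbert space structure of L2\<close>

lemma scaleC_minus1: "(- 1) *\<^sub>C (v :: 'a::complex_vector) = - v"
  using scaleR_scaleC[of "-1" v] by simp

lemma cinner_add_right: "cinner u (v + w) = cinner u v + cinner u w"
  by (metis cinner_add_left cinner_commute complex_cnj_add)

lemma cinner_scaleC_right: "cinner u (c *\<^sub>C v) = cnj c * cinner u v"
  by (metis cinner_commute cinner_scaleC_left complex_cnj_mult)

lemma cinner_zero_left [simp]: "cinner 0 v = 0"
  using cinner_scaleC_left[of 0 0 v] by simp

lemma cinner_zero_right [simp]: "cinner v 0 = 0"
  using cinner_commute[of v 0] by simp

lemma cinner_minus_left: "cinner (- u) v = - cinner u v"
  using cinner_scaleC_left[of "-1" u v] by (simp add: scaleC_minus1)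

lemma cinner_diff_left: "cinner (u - v) w = cinner u w - cinner v w"
  using cinner_add_left[of u "- v" w] by (simp add: cinner_minus_left)

lemma cinner_diff_right: "cinner w (u - v) = cinner w u - cinner w v"
  by (metis cinner_diff_left cinner_commute complex_cnj_diff)

lemma cinner_minus_right: "cinner u (- v) = - cinner u v"
  using cinner_diff_right[of u 0 v] by simp

lemmas cinner_simps = cinner_add_left cinner_add_right cinner_diff_left cinner_diff_right
  cinner_minus_left cinner_minus_right cinner_scaleC_left cinner_scaleC_right

lemma cinner_sum_left: "cinner (\<Sum>i\<in>A. f i) v = (\<Sum>i\<in>A. cinner (f i) v)"
  by (induction A rule: infinite_finite_induct) (auto simp: cinner_add_left)

lemma cinner_sum_right: "cinner v (\<Sum>i\<in>A. f i) = (\<Sum>i\<in>A. cinner v (f i))"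
  by (induction A rule: infinite_finite_induct) (auto simp: cinner_add_right)

lemma cinner_self_norm: "cinner u u = complex_of_real ((norm u)\<^sup>2)"
proof -
  have "Im (cinner u u) = 0"
    using cinner_commute[of u u] by (metis Reals_cnj_iff complex_is_Real_iff)
  moreover have "Re (cinner u u) = (norm u)\<^sup>2"
    by (metis inner_L2_def power2_norm_eq_inner)
  ultimately show ?thesis
    by (simp add: complex_eq_iff)
qed

lemma norm_scaleC: "norm (c *\<^sub>C u) = cmod c * norm (u :: 'a::euclidean_space L2)"
proof -
  have "complex_of_real ((norm (c *\<^sub>C u))\<^sup>2) = (c * cnj c) * cinner u u"
    unfolding cinner_self_norm[symmetric] by (simp add: cinner_scaleC_left cinner_scaleC_right)
  also have "\<dots> = complex_of_real ((cmod c * norm u)\<^sup>2)"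
    by (simp add: cinner_self_norm complex_norm_square[symmetric] power_mult_distrib)
  finally have "(norm (c *\<^sub>C u))\<^sup>2 = (cmod c * norm u)\<^sup>2"
    by (simp only: of_real_eq_iff)
  thus ?thesis
    by (simp add: power2_eq_iff_nonneg)
qed

lemma cinner_cauchy_schwarz: "cmod (cinner u v) \<le> norm u * norm v"
proof -
  obtain c where c: "cmod c = 1" "c * cinner u v = complex_of_real (cmod (cinner u v))"
  proof (cases "cinner u v = 0")
    case False
    show ?thesis
      by (rule that[of "cnj (cinner u v) / complex_of_real (cmod (cinner u v))"])
        (use False in \<open>simp_all add: norm_divide complex_norm_square[symmetric]
          mult.commute power2_eq_square field_simps\<close>)
  qed (auto intro: that[of 1])
  have "cmod (cinner u v) = inner (c *\<^sub>C u) v"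
    by (simp add: inner_L2_def cinner_scaleC_left c)
  also have "\<dots> \<le> norm (c *\<^sub>C u) * norm v"
    by (rule norm_cauchy_schwarz)
  finally show ?thesis
    by (simp add: norm_scaleC c)
qed

lemma bounded_bilinear_cinner: "bounded_bilinear cinner"
proof
  fix r :: real and u v :: "'a L2"
  show "cinner (r *\<^sub>R u) v = r *\<^sub>R cinner u v"
    by (simp add: scaleR_scaleC cinner_scaleC_left scaleR_conv_of_real)
  show "cinner u (r *\<^sub>R v) = r *\<^sub>R cinner u v"
    by (simp add: scaleR_scaleC cinner_scaleC_right scaleR_conv_of_real)
  show "\<exists>K. \<forall>u v :: 'a L2. cmod (cinner u v) \<le> norm u * norm v * K"
    by (rule exI[of _ 1]) (simp add: cinner_cauchy_schwarz)
qed (simp_all add: cinner_add_left cinner_add_right)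

lemmas tendsto_cinner = bounded_bilinear.tendsto[OF bounded_bilinear_cinner]
lemmas continuous_on_cinner = bounded_bilinear.continuous_on[OF bounded_bilinear_cinner]

lemma bounded_bilinear_scaleC:
  "bounded_bilinear (scaleC :: complex \<Rightarrow> 'a::euclidean_space L2 \<Rightarrow> 'a L2)"
proof
  show "\<exists>K. \<forall>c (u :: 'a L2). norm (c *\<^sub>C u) \<le> norm c * norm u * K"
    by (rule exI[of _ 1]) (simp add: norm_scaleC)
qed (simp_all add: scaleC_add_left scaleC_add_right scaleR_scaleC scaleC_scaleC
    scaleR_conv_of_real mult.commute)

lemmas tendsto_scaleC = bounded_bilinear.tendsto[OF bounded_bilinear_scaleC]

lemma csubspace_closure:
  fixes S :: "'a::euclidean_space L2 set"
  assumes "csubspace S" shows "csubspace (closure S)"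
proof (rule complex_vector.subspaceI)
  show "0 \<in> closure S"
    using assms closure_subset complex_vector.subspace_0 by blast
next
  fix x y assume "x \<in> closure S" "y \<in> closure S"
  then obtain f g where fg: "\<And>n. f n \<in> S" "f \<longlonglongrightarrow> x" "\<And>n. g n \<in> S" "g \<longlonglongrightarrow> y"
    unfolding closure_sequential by metis
  have "(\<lambda>n. f n + g n) \<longlonglongrightarrow> x + y" by (intro tendsto_add fg)
  moreover have "f n + g n \<in> S" for n
    using fg assms complex_vector.subspace_add by blast
  ultimately show "x + y \<in> closure S"
    unfolding closure_sequential by (intro exI[of _ "\<lambda>n. f n + g n"]) auto
next
  fix x and c :: complex assume "x \<in> closure S"
  then obtain f where f: "\<And>n. f n \<in> S" "f \<longlonglongrightarrow> x"
    unfolding closure_sequential by metis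
  have "(\<lambda>n. c *\<^sub>C f n) \<longlonglongrightarrow> c *\<^sub>C x" by (intro tendsto_scaleC f tendsto_const)
  moreover have "c *\<^sub>C f n \<in> S" for n
    using f assms complex_vector.subspace_scale by blast
  ultimately show "c *\<^sub>C x \<in> closure S"
    unfolding closure_sequential by (intro exI[of _ "\<lambda>n. c *\<^sub>C f n"]) auto
qed

lemma L2_rel_refl: "square_integrable f \<Longrightarrow> L2_rel f f"
  by (simp add: L2_rel_def)

lemma L2_cases:
  obtains f where "square_integrable f" "u = abs_L2 f"
proof
  show "square_integrable (rep_L2 u)"
    using Quotient3_rep_reflp[OF Quotient3_L2, of u] by (simp add: L2_rel_def)
  show "u = abs_L2 (rep_L2 u)"
    by (simp add: Quotient3_abs_rep[OF Quotient3_L2])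
qed

lemma abs_L2_eq_iff:
  assumes "square_integrable f" "square_integrable g"
  shows "abs_L2 f = abs_L2 g \<longleftrightarrow> (AE x in lborel. f x = g x)"
  using Quotient3_rel[OF Quotient3_L2, of f g] assms by (auto simp: L2_rel_def)

lemma cinner_abs_L2:
  assumes "square_integrable f" "square_integrable g"
  shows "cinner (abs_L2 f) (abs_L2 g) = (LINT x|lborel. f x * cnj (g x))"
  by (intro cinner.abs_eq L2_rel_refl assms)

lemma abs_L2_add:
  assumes "square_integrable f" "square_integrable g"
  shows "abs_L2 f + abs_L2 g = abs_L2 (\<lambda>x. f x + g x)"
  by (intro plus_L2.abs_eq L2_rel_refl assms)

lemma abs_L2_scaleC:
  assumes "square_integrable f"
  shows "c *\<^sub>C abs_L2 f = abs_L2 (\<lambda>x. c * f x)"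
  by (intro scaleC_L2.abs_eq L2_rel_refl assms)

lemma square_integrable_diff:
  assumes "square_integrable f" "square_integrable g"
  shows "square_integrable (\<lambda>x. f x - g x)"
  using square_integrable_add[OF assms(1) square_integrable_scale[OF assms(2), of "-1"]] by simp

lemma abs_L2_diff:
  assumes "square_integrable f" "square_integrable g"
  shows "abs_L2 f - abs_L2 g = abs_L2 (\<lambda>x. f x - g x)"
proof -
  have "abs_L2 f - abs_L2 g = abs_L2 f + (- 1) *\<^sub>C abs_L2 g"
    by (simp add: scaleC_minus1)
  also have "\<dots> = abs_L2 (\<lambda>x. f x - g x)"
    by (simp only: abs_L2_scaleC abs_L2_add square_integrable_scale assms) simp
  finally show ?thesis .
qed

lemma norm_abs_L2:
  assumes "square_integrable f"
  shows "(norm (abs_L2 f))\<^sup>2 = (LINT x|lborel. (cmod (f x))\<^sup>2)"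
proof -
  have "complex_of_real ((norm (abs_L2 f))\<^sup>2) = (LINT x|lborel. f x * cnj (f x))"
    by (simp only: cinner_self_norm[symmetric] cinner_abs_L2 assms)
  also have "\<dots> = (LINT x|lborel. complex_of_real ((cmod (f x))\<^sup>2))"
    by (intro Bochner_Integration.integral_cong refl) (simp only: complex_norm_square)
  also have "\<dots> = complex_of_real (LINT x|lborel. (cmod (f x))\<^sup>2)"
    by (rule integral_complex_of_real)
  finally show ?thesis by (simp only: of_real_eq_iff)
qed

lemma nn_integral_norm_abs_L2:
  assumes "square_integrable f"
  shows "(\<integral>\<^sup>+x. ennreal ((cmod (f x))\<^sup>2) \<partial>lborel) = ennreal ((norm (abs_L2 f))\<^sup>2)"
  using assms by (simp add: norm_abs_L2 square_integrable_def nn_integral_eq_integral)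

lemma square_integrable_measurable [measurable_dest]:
  "square_integrable f \<Longrightarrow> f \<in> borel_measurable borel"
  by (simp add: square_integrable_def)

lemma square_integrableI:
  assumes [measurable]: "f \<in> borel_measurable borel"
    and "(\<integral>\<^sup>+x. ennreal ((cmod (f x))\<^sup>2) \<partial>lborel) < \<infinity>"
  shows "square_integrable f"
  using assms unfolding square_integrable_def
  by (auto intro!: integrableI_nonneg)

text \<open>
  The Riesz-Fischer argument.  With \<open>g k = F (k+1) - F k\<close> the weighted series
  \<open>\<Sum>k. 2^k |g k|\<^sup>2\<close> has finite integral, so it converges almost everywhere, and this forces
  \<open>\<Sum>k. |g k|\<close> to converge there.  Hence \<open>F\<close> has a pointwise limit almost everywhere, and Fatou's
  lemma turns the bound on \<open>F m - F k\<close> into the same bound on the distance of \<open>F k\<close> to that limit.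
\<close>

lemma rapidly_Cauchy_convergent:
  fixes F :: "nat \<Rightarrow> 'a::euclidean_space \<Rightarrow> complex"
  assumes F: "\<And>k. square_integrable (F k)"
    and dist: "\<And>k m. k \<le> m \<Longrightarrow> norm (abs_L2 (F m) - abs_L2 (F k)) \<le> (1/2)^k"
  shows "\<exists>f. square_integrable f \<and> (\<lambda>k. abs_L2 (F k)) \<longlonglongrightarrow> abs_L2 f"
proof -
  note [measurable] = square_integrable_measurable[OF F]
  define g where "g = (\<lambda>k x. F (Suc k) x - F k x)"
  have g: "square_integrable (g k)" for k
    unfolding g_def by (intro square_integrable_diff F)
  note [measurable] = square_integrable_measurable[OF g]
  have ng: "(norm (abs_L2 (g k)))\<^sup>2 \<le> (1/4)^k" for k
  proof -
    have "norm (abs_L2 (g k)) \<le> (1/2)^k"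
      using dist[of k "Suc k"] by (simp add: g_def abs_L2_diff F)
    hence "(norm (abs_L2 (g k)))\<^sup>2 \<le> ((1/2)^k)\<^sup>2"
      by (intro power_mono) auto
    also have "\<dots> = (1/4)^k"
      by (simp add: power2_eq_square power_mult_distrib[symmetric])
    finally show ?thesis .
  qed
  have "(\<integral>\<^sup>+x. (\<Sum>k. ennreal (2^k * (cmod (g k x))\<^sup>2)) \<partial>lborel) =
      (\<Sum>k. \<integral>\<^sup>+x. ennreal (2^k * (cmod (g k x))\<^sup>2) \<partial>lborel)"
    by (rule nn_integral_suminf) measurable
  also have "\<dots> \<le> (\<Sum>k. ennreal ((1/2)^k))"
  proof (rule suminf_le)
    fix k
    have "(\<integral>\<^sup>+x. ennreal (2^k * (cmod (g k x))\<^sup>2) \<partial>lborel)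
        = ennreal (2^k) * (\<integral>\<^sup>+x. ennreal ((cmod (g k x))\<^sup>2) \<partial>lborel)"
      by (simp add: ennreal_mult nn_integral_cmult)
    also have "\<dots> = ennreal (2^k * (norm (abs_L2 (g k)))\<^sup>2)"
      by (simp add: nn_integral_norm_abs_L2 g ennreal_mult)
    also have "\<dots> \<le> ennreal (2^k * (1/4)^k)"
      by (intro ennreal_leI mult_left_mono ng) simp
    also have "(2::real)^k * (1/4)^k = (1/2)^k"
      by (simp add: power_mult_distrib[symmetric])
    finally show "(\<integral>\<^sup>+x. ennreal (2^k * (cmod (g k x))\<^sup>2) \<partial>lborel) \<le> ennreal ((1/2)^k)" .
  qed auto
  also have "\<dots> < \<infinity>"
    by (subst suminf_ennreal2) (auto intro: summable_geometric)
  finally have "AE x in lborel. (\<Sum>k. ennreal (2^k * (cmod (g k x))\<^sup>2)) \<noteq> \<infinity>"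
    by (intro nn_integral_PInf_AE) auto
  hence AE_conv: "AE x in lborel. convergent (\<lambda>k. F k x)"
  proof eventually_elim
    case (elim x)
    have "summable (\<lambda>k. 2^k * (cmod (g k x))\<^sup>2)"
      using elim by (intro summable_suminf_not_top) auto
    hence s: "summable (\<lambda>k. 2^k * (cmod (g k x))\<^sup>2 + (1/2)^k)"
      by (intro summable_add summable_geometric) auto
    have "summable (\<lambda>k. g k x)"
    proof (rule summable_comparison_test'[OF s])
      fix k :: nat
      define p where "p = (2::real)^k"
      have p: "p > 0" by (simp add: p_def)
      \<comment> \<open>This square expresses \<open>2 |g| \<le> p |g|\<^sup>2 + 1 / p\<close>.\<close>
      have "0 \<le> (p * cmod (g k x) - 1)\<^sup>2 / p" using p by simp
      also have "\<dots> = p * (cmod (g k x))\<^sup>2 + 1/p - 2 * cmod (g k x)"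
        using p by (simp add: power2_diff power2_eq_square field_simps)
      finally show "norm (g k x) \<le> 2^k * (cmod (g k x))\<^sup>2 + (1/2)^k"
        using norm_ge_zero[of "g k x"] by (simp add: p_def power_one_over del: norm_ge_zero)
    qed
    hence "convergent (\<lambda>n. (\<Sum>k<n. g k x))"
      by (simp add: summable_iff_convergent)
    moreover have "(\<lambda>n. (\<Sum>k<n. g k x)) = (\<lambda>n. F n x - F 0 x)"
      unfolding g_def by (rule ext) (rule sum_lessThan_telescope)
    ultimately have "convergent (\<lambda>n. (F n x - F 0 x) + F 0 x)"
      by (intro convergent_add convergent_const) simp_all
    thus ?case by simp
  qed
  define f where "f = (\<lambda>x. lim (\<lambda>k. F k x))"
  have [measurable]: "f \<in> borel_measurable borel"
    unfolding f_def by measurable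
  have bound: "(\<integral>\<^sup>+x. ennreal ((cmod (f x - F k x))\<^sup>2) \<partial>lborel) \<le> ennreal ((1/4)^k)" for k
  proof -
    have "(\<integral>\<^sup>+x. ennreal ((cmod (f x - F k x))\<^sup>2) \<partial>lborel)
        = (\<integral>\<^sup>+x. liminf (\<lambda>m. ennreal ((cmod (F m x - F k x))\<^sup>2)) \<partial>lborel)"
    proof (rule nn_integral_cong_AE)
      show "AE x in lborel. ennreal ((cmod (f x - F k x))\<^sup>2)
          = liminf (\<lambda>m. ennreal ((cmod (F m x - F k x))\<^sup>2))"
        using AE_conv
      proof eventually_elim
        case (elim x)
        hence "(\<lambda>m. F m x) \<longlonglongrightarrow> f x" by (simp add: f_def convergent_LIMSEQ_iff)
        hence "(\<lambda>m. ennreal ((cmod (F m x - F k x))\<^sup>2)) \<longlonglongrightarrow> ennreal ((cmod (f x - F k x))\<^sup>2)"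
          by (intro tendsto_ennrealI tendsto_intros)
        thus ?case
          by (metis lim_imp_Liminf sequentially_bot)
      qed
    qed
    also have "\<dots> \<le> liminf (\<lambda>m. \<integral>\<^sup>+x. ennreal ((cmod (F m x - F k x))\<^sup>2) \<partial>lborel)"
      by (rule nn_integral_liminf) measurable
    also have "\<dots> \<le> ennreal ((1/4)^k)"
    proof (rule Liminf_le)
      show "\<forall>\<^sub>F m in sequentially. (\<integral>\<^sup>+x. ennreal ((cmod (F m x - F k x))\<^sup>2) \<partial>lborel) \<le> ennreal ((1/4)^k)"
      proof (rule eventually_sequentiallyI[of k])
        fix m assume "k \<le> m"
        have "(\<integral>\<^sup>+x. ennreal ((cmod (F m x - F k x))\<^sup>2) \<partial>lborel) = ennreal ((norm (abs_L2 (F m) - abs_L2 (F k)))\<^sup>2)"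
          by (simp add: nn_integral_norm_abs_L2 square_integrable_diff F abs_L2_diff)
        also have "\<dots> \<le> ennreal (((1/2)^k)\<^sup>2)"
          by (intro ennreal_leI power_mono dist \<open>k \<le> m\<close>) auto
        also have "((1/2::real)^k)\<^sup>2 = (1/4)^k"
          by (simp add: power2_eq_square power_mult_distrib[symmetric])
        finally show "(\<integral>\<^sup>+x. ennreal ((cmod (F m x - F k x))\<^sup>2) \<partial>lborel) \<le> ennreal ((1/4)^k)" .
      qed
    qed simp
    finally show ?thesis .
  qed
  have d: "square_integrable (\<lambda>x. f x - F k x)" for k
    by (rule square_integrableI) (use bound[of k] in \<open>auto simp: less_top[symmetric] top_unique\<close>)
  have f: "square_integrable f"
    using square_integrable_add[OF d[of 0] F[of 0]] by simp
  have n: "norm (abs_L2 (F k) - abs_L2 f) \<le> (1/2)^k" for k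
  proof -
    have "ennreal ((norm (abs_L2 f - abs_L2 (F k)))\<^sup>2) \<le> ennreal ((1/4)^k)"
      using bound[of k] by (simp add: nn_integral_norm_abs_L2 d abs_L2_diff f F)
    hence "(norm (abs_L2 f - abs_L2 (F k)))\<^sup>2 \<le> (1/4)^k" by simp
    also have "(1/4::real)^k = ((1/2)^k)\<^sup>2"
      by (simp add: power2_eq_square power_mult_distrib[symmetric])
    finally have "norm (abs_L2 f - abs_L2 (F k)) \<le> (1/2)^k"
      by (rule power2_le_imp_le) simp
    thus ?thesis by (simp add: norm_minus_commute)
  qed
  have "(\<lambda>k. abs_L2 (F k) - abs_L2 f) \<longlonglongrightarrow> 0"
    by (rule tendsto_norm_zero_cancel, rule Lim_null_comparison[of _ "\<lambda>k. (1/2)^k"])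
      (auto simp: n intro!: LIMSEQ_power_zero)
  hence "(\<lambda>k. abs_L2 (F k)) \<longlonglongrightarrow> abs_L2 f"
    by (simp add: LIM_zero_iff)
  with f show ?thesis by blast
qed

instance L2 :: (euclidean_space) banach
proof
  fix X :: "nat \<Rightarrow> 'a L2" assume X: "Cauchy X"
  have "\<forall>k. \<exists>N. \<forall>m\<ge>N. \<forall>n\<ge>N. dist (X m) (X n) < (1/2)^k"
    using X unfolding Cauchy_def by (metis half_gt_zero_iff zero_less_one zero_less_power)
  then obtain N where N: "\<And>k m n. m \<ge> N k \<Longrightarrow> n \<ge> N k \<Longrightarrow> dist (X m) (X n) < (1/2)^k"
    by metis
  \<comment> \<open>Summing the thresholds keeps \<open>r\<close> strictly increasing and above all \<open>N i\<close> with \<open>i \<le> k\<close>.\<close>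
  define r where "r = (\<lambda>k. (\<Sum>i\<le>k. N i) + k)"
  have r: "strict_mono r"
    by (rule strict_monoI_Suc) (simp add: r_def)
  have rN: "N k \<le> r m" if "k \<le> m" for k m
  proof -
    have "N k \<le> (\<Sum>i\<le>m. N i)" using that by (intro member_le_sum) auto
    thus ?thesis by (simp add: r_def)
  qed
  define F where "F = (\<lambda>k. rep_L2 (X (r k)))"
  have F: "square_integrable (F k)" "abs_L2 (F k) = X (r k)" for k
    unfolding F_def using Quotient3_rep_reflp[OF Quotient3_L2, of "X (r k)"]
    by (simp_all add: L2_rel_def Quotient3_abs_rep[OF Quotient3_L2])
  have "\<exists>f. square_integrable f \<and> (\<lambda>k. abs_L2 (F k)) \<longlonglongrightarrow> abs_L2 f"
  proof (rule rapidly_Cauchy_convergent)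
    fix k m :: nat assume "k \<le> m"
    thus "norm (abs_L2 (F m) - abs_L2 (F k)) \<le> (1/2)^k"
      using N[of k "r m" "r k"] rN[of k m] rN[of k k] by (simp add: F dist_norm)
  qed (rule F)
  then obtain f where "(X \<circ> r) \<longlonglongrightarrow> abs_L2 f"
    by (auto simp: F o_def)
  thus "convergent X"
    using Cauchy_converges_subseq[OF X r] by (auto simp: convergent_def)
qed

section \<open>Orthonormal families and diagonal operators\<close>

locale orthonormal_family =
  fixes e :: "'i \<Rightarrow> 'a::euclidean_space L2" and I :: "'i set"
  assumes ortho: "\<And>i j. i \<in> I \<Longrightarrow> j \<in> I \<Longrightarrow> cinner (e i) (e j) = (if i = j then 1 else 0)"
begin

definition K :: "'a L2 set"
  where "K = closure (cspan (e ` I))"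

lemma closed_K: "closed K"
  by (simp add: K_def)

lemma csubspace_K: "csubspace K"
  unfolding K_def by (intro csubspace_closure complex_vector.subspace_span)

lemmas K_add = complex_vector.subspace_add[OF csubspace_K]
lemmas K_scale = complex_vector.subspace_scale[OF csubspace_K]
lemmas K_diff = complex_vector.subspace_diff[OF csubspace_K]
lemmas K_sum = complex_vector.subspace_sum[OF csubspace_K]
lemmas K_zero = complex_vector.subspace_0[OF csubspace_K]

lemma e_in_K: "i \<in> I \<Longrightarrow> e i \<in> K"
  unfolding K_def by (meson closure_subset complex_vector.span_base image_eqI subsetD)

lemma cinner_lin_comb:
  assumes "finite F" "F \<subseteq> I" "i \<in> I"
  shows "cinner (\<Sum>j\<in>F. c j *\<^sub>C e j) (e i) = (if i \<in> F then c i else 0)"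
proof -
  have "cinner (\<Sum>j\<in>F. c j *\<^sub>C e j) (e i) = (\<Sum>j\<in>F. if j = i then c j else 0)"
    unfolding cinner_sum_left cinner_scaleC_left
    by (rule sum.cong) (use assms ortho in auto)
  thus ?thesis using assms by simp
qed

lemma norm_lin_comb:
  assumes "finite F" "F \<subseteq> I"
  shows "(norm (\<Sum>j\<in>F. c j *\<^sub>C e j))\<^sup>2 = (\<Sum>j\<in>F. (cmod (c j))\<^sup>2)"
proof -
  have "complex_of_real ((norm (\<Sum>j\<in>F. c j *\<^sub>C e j))\<^sup>2)
      = (\<Sum>i\<in>F. cnj (c i) * cinner (\<Sum>j\<in>F. c j *\<^sub>C e j) (e i))"
    by (simp only: cinner_self_norm[symmetric] cinner_sum_right cinner_scaleC_right)
  also have "\<dots> = (\<Sum>i\<in>F. cnj (c i) * c i)"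
    by (rule sum.cong) (auto simp: cinner_lin_comb[OF assms subsetD[OF assms(2)]])
  also have "\<dots> = complex_of_real (\<Sum>j\<in>F. (cmod (c j))\<^sup>2)"
    unfolding of_real_sum complex_norm_square by (simp add: mult.commute)
  finally show ?thesis by (simp only: of_real_eq_iff)
qed

definition fourier :: "'i set \<Rightarrow> 'a L2 \<Rightarrow> 'a L2"
  where "fourier F v = (\<Sum>j\<in>F. cinner v (e j) *\<^sub>C e j)"

text \<open>
  The remainder \<open>v - fourier F v\<close> is orthogonal to every \<open>e i\<close> with \<open>i \<in> F\<close>, so this is the
  theorem of Pythagoras.  It yields Bessel's inequality and the best-approximation property.
\<close>

lemma norm_fourier_remainder:
  assumes F: "finite F" "F \<subseteq> I"
  shows "(norm (v - fourier F v))\<^sup>2 = (norm v)\<^sup>2 - (\<Sum>j\<in>F. (cmod (cinner v (e j)))\<^sup>2)"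
proof -
  have orth: "cinner (v - fourier F v) (fourier F v) = 0"
    unfolding fourier_def cinner_sum_right cinner_scaleC_right cinner_diff_left
    by (intro sum.neutral ballI) (auto simp: cinner_lin_comb[OF F subsetD[OF F(2)]])
  have "cinner v v = cinner ((v - fourier F v) + fourier F v) ((v - fourier F v) + fourier F v)"
    by simp
  also have "\<dots> = cinner (v - fourier F v) (v - fourier F v) + cinner (fourier F v) (fourier F v)"
    using orth cinner_commute[of "fourier F v" "v - fourier F v"]
    unfolding cinner_add_left cinner_add_right by simp
  finally have "(norm v)\<^sup>2 = (norm (v - fourier F v))\<^sup>2 + (norm (fourier F v))\<^sup>2"
    unfolding cinner_self_norm of_real_add[symmetric] of_real_eq_iff .
  thus ?thesis
    using norm_lin_comb[OF F] by (simp add: fourier_def)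
qed

lemma bessel:
  assumes "finite F" "F \<subseteq> I"
  shows "(\<Sum>j\<in>F. (cmod (cinner v (e j)))\<^sup>2) \<le> (norm v)\<^sup>2"
  using norm_fourier_remainder[OF assms, of v] zero_le_power2[of "norm (v - fourier F v)"] by linarith

lemma fourier_eq_self:
  assumes F: "finite F" "F \<subseteq> I" and "u \<in> cspan (e ` F)"
  shows "fourier F u = u"
  using assms(3)
proof (induction rule: complex_vector.span_induct_alt)
  case base
  show ?case by (simp add: fourier_def)
next
  case (step c x y)
  then obtain i where i: "i \<in> F" "x = e i" by auto
  have "fourier F x = (\<Sum>j\<in>F. if j = i then e i else 0)"
    unfolding fourier_def i by (rule sum.cong) (use ortho[OF subsetD[OF F(2)] subsetD[OF F(2)]] i in auto)
  also have "\<dots> = x" using i F by simp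
  finally have "fourier F x = x" .
  moreover have "fourier F (c *\<^sub>C x + y) = c *\<^sub>C fourier F x + fourier F y"
    unfolding fourier_def
    by (simp add: cinner_add_left cinner_scaleC_left scaleC_add_left sum.distrib
        complex_vector.scale_sum_right scaleC_scaleC)
  ultimately show ?case using step by simp
qed

lemma fourier_best_approximation:
  assumes F: "finite F" "F \<subseteq> I" and u: "u \<in> cspan (e ` F)"
  shows "norm (v - fourier F v) \<le> norm (v - u)"
proof -
  have "fourier F (v - u) = fourier F v - fourier F u"
    unfolding fourier_def
    by (simp add: cinner_diff_left complex_vector.scale_left_diff_distrib sum_subtractf)
  hence "v - fourier F v = (v - u) - fourier F (v - u)"
    by (simp add: fourier_eq_self[OF F u])
  hence "norm (v - fourier F v) = norm ((v - u) - fourier F (v - u))" by (rule arg_cong)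
  hence "(norm (v - fourier F v))\<^sup>2 = (norm (v - u))\<^sup>2 - (\<Sum>j\<in>F. (cmod (cinner (v - u) (e j)))\<^sup>2)"
    using norm_fourier_remainder[OF F, of "v - u"] by simp
  also have "\<dots> \<le> (norm (v - u))\<^sup>2" by (simp add: sum_nonneg)
  finally show ?thesis by (rule power2_le_imp_le) simp
qed

text \<open>
  A vector of \<open>K\<close> is approximated by finite combinations of the \<open>e i\<close>; the partial Fourier sum over
  any larger finite index set approximates at least as well, which is convergence along the net of
  finite sets.
\<close>

lemma fourier_expansion:
  assumes "v \<in> K"
  shows "((\<lambda>i. cinner v (e i) *\<^sub>C e i) has_sum v) I"
  unfolding has_sum_def
proof (rule tendstoI)
  fix r :: real assume "r > 0"
  then obtain u where u: "u \<in> cspan (e ` I)" "dist u v < r"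
    using assms unfolding K_def closure_approachable by blast
  obtain T c where T: "finite T" "T \<subseteq> e ` I" "u = (\<Sum>a\<in>T. c a *\<^sub>C a)"
    using u(1) unfolding complex_vector.span_explicit by auto
  obtain F0 where F0: "F0 \<subseteq> I" "finite F0" "T = e ` F0"
    using finite_subset_image[OF T(1,2)] by auto
  show "\<forall>\<^sub>F F in finite_subsets_at_top I. dist (\<Sum>i\<in>F. cinner v (e i) *\<^sub>C e i) v < r"
    unfolding eventually_finite_subsets_at_top
  proof (intro exI[of _ F0] conjI allI impI)
    fix F assume F: "finite F \<and> F0 \<subseteq> F \<and> F \<subseteq> I"
    have "u \<in> cspan (e ` F)"
      unfolding T(3) using F F0
      by (intro complex_vector.span_sum complex_vector.span_scale complex_vector.span_base) auto
    hence "norm (v - fourier F v) \<le> norm (v - u)"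
      using F by (intro fourier_best_approximation) auto
    thus "dist (\<Sum>i\<in>F. cinner v (e i) *\<^sub>C e i) v < r"
      using u(2) by (simp add: fourier_def dist_norm norm_minus_commute)
  qed (use F0 in auto)
qed

lemma parseval:
  assumes "v \<in> K"
  shows "((\<lambda>i. cinner v (e i) * cnj (cinner w (e i))) has_sum cinner v w) I"
proof -
  have "((\<lambda>i. cinner (cinner v (e i) *\<^sub>C e i) w) has_sum cinner v w) I"
    by (rule has_sum_bounded_linear[OF bounded_bilinear.bounded_linear_left[OF bounded_bilinear_cinner]
        fourier_expansion[OF assms]])
  moreover have "cinner (cinner v (e i) *\<^sub>C e i) w = cinner v (e i) * cnj (cinner w (e i))" for i
    by (metis cinner_scaleC_left cinner_commute)
  ultimately show ?thesis by simp
qed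

lemma parseval_norm:
  assumes "v \<in> K"
  shows "((\<lambda>i. (cmod (cinner v (e i)))\<^sup>2) has_sum (norm v)\<^sup>2) I"
proof -
  have "((\<lambda>i. Re (cinner v (e i) * cnj (cinner v (e i)))) has_sum Re (cinner v v)) I"
    by (rule has_sum_bounded_linear[OF bounded_linear_Re parseval[OF assms]])
  thus ?thesis
    by (simp add: cinner_self_norm complex_norm_square[symmetric] flip: of_real_power)
qed

lemma K_eqI:
  assumes "v \<in> K" "w \<in> K" "\<And>i. i \<in> I \<Longrightarrow> cinner v (e i) = cinner w (e i)"
  shows "v = w"
proof -
  have "((\<lambda>i. (cmod (cinner (v - w) (e i)))\<^sup>2) has_sum (norm (v - w))\<^sup>2) I"
    by (intro parseval_norm K_diff assms)
  moreover have "((\<lambda>i. (cmod (cinner (v - w) (e i)))\<^sup>2) has_sum 0) I"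
    by (rule has_sum_0) (simp add: cinner_diff_left assms)
  ultimately have "(norm (v - w))\<^sup>2 = 0" by (rule has_sum_unique)
  thus ?thesis by simp
qed

text \<open>
  By Pythagoras the partial sums of \<open>\<Sum>i. c i *\<^sub>C e i\<close> form a Cauchy net, and the space is complete.
  Together with \<open>K_eqI\<close> this identifies \<open>K\<close> with the square-summable families, so that projections
  and resolvents can be defined by prescribing coordinates.
\<close>

lemma riesz_fischer:
  assumes c: "(\<lambda>i. (cmod (c i))\<^sup>2) summable_on I"
  shows "\<exists>v\<in>K. \<forall>i\<in>I. cinner v (e i) = c i"
proof -
  define s where "s = (\<lambda>F. \<Sum>i\<in>F. c i *\<^sub>C e i)"
  have "\<exists>P. eventually P (finite_subsets_at_top I) \<and> (\<forall>F F'. P F \<and> P F' \<longrightarrow> dist (s F) (s F') < r)"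
    if "r > 0" for r
  proof -
    obtain L where L: "((\<lambda>i. (cmod (c i))\<^sup>2) has_sum L) I"
      using c by (auto simp: summable_on_def)
    define d where "d = (r/2)\<^sup>2"
    have d: "d > 0" using that by (simp add: d_def)
    have "\<forall>\<^sub>F F in finite_subsets_at_top I. dist (\<Sum>i\<in>F. (cmod (c i))\<^sup>2) L < d"
      using L d unfolding has_sum_def tendsto_iff by blast
    then obtain F0 where F0: "finite F0" "F0 \<subseteq> I" "dist (\<Sum>i\<in>F0. (cmod (c i))\<^sup>2) L < d"
      unfolding eventually_finite_subsets_at_top by blast
    define P where "P = (\<lambda>F. finite F \<and> F0 \<subseteq> F \<and> F \<subseteq> I)"
    have *: "dist (s F) (s F0) < r / 2" if "P F" for F
    proof -
      have F: "finite F" "F0 \<subseteq> F" "F \<subseteq> I" using that by (auto simp: P_def)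
      have "s F - s F0 = (\<Sum>i\<in>F - F0. c i *\<^sub>C e i)"
        using F by (simp add: s_def sum_diff)
      hence "(norm (s F - s F0))\<^sup>2 = (\<Sum>i\<in>F - F0. (cmod (c i))\<^sup>2)"
        using F norm_lin_comb[of "F - F0" c] by auto
      also have "\<dots> = (\<Sum>i\<in>F. (cmod (c i))\<^sup>2) - (\<Sum>i\<in>F0. (cmod (c i))\<^sup>2)"
        using F by (simp add: sum_diff)
      also have "(\<Sum>i\<in>F. (cmod (c i))\<^sup>2) \<le> L"
        using L F by (intro has_sum_mono2[OF has_sum_finite L]) auto
      also have "L - (\<Sum>i\<in>F0. (cmod (c i))\<^sup>2) < d"
        using F0(3) by (auto simp: dist_real_def)
      finally have "(norm (s F - s F0))\<^sup>2 < (r/2)\<^sup>2" by (simp add: d_def)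
      hence "norm (s F - s F0) < r / 2"
        by (rule power2_less_imp_less) (use \<open>r > 0\<close> in simp)
      thus ?thesis by (simp add: dist_norm)
    qed
    have "eventually P (finite_subsets_at_top I)"
      unfolding eventually_finite_subsets_at_top P_def using F0 by blast
    moreover have "dist (s F) (s F') < r" if "P F" "P F'" for F F'
      using *[OF that(1)] *[OF that(2)] dist_triangle3[of "s F" "s F'" "s F0"]
      by (simp add: dist_commute)
    ultimately show ?thesis by blast
  qed
  hence "cauchy_filter (filtermap s (finite_subsets_at_top I))"
    by (simp add: cauchy_filter_metric_filtermap)
  moreover have "complete (UNIV :: 'a L2 set)"
    by (meson Cauchy_convergent UNIV_I complete_def convergent_def)
  ultimately obtain v where v: "(s \<longlongrightarrow> v) (finite_subsets_at_top I)"
    using complete_uniform[where S = UNIV] by (force simp: filterlim_def)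
  have "v \<in> K"
  proof (rule Lim_in_closed_set[OF closed_K _ _ v])
    show "\<forall>\<^sub>F F in finite_subsets_at_top I. s F \<in> K"
      by (rule eventually_finite_subsets_at_top_weakI) (auto simp: s_def intro!: K_sum K_scale e_in_K)
  qed simp
  moreover have "cinner v (e i) = c i" if "i \<in> I" for i
  proof (rule tendsto_unique)
    show "((\<lambda>F. cinner (s F) (e i)) \<longlongrightarrow> cinner v (e i)) (finite_subsets_at_top I)"
      by (intro tendsto_cinner v tendsto_const)
    have "\<forall>\<^sub>F F in finite_subsets_at_top I. cinner (s F) (e i) = c i"
      unfolding eventually_finite_subsets_at_top
      by (rule exI[of _ "{i}"]) (use that in \<open>auto simp: s_def cinner_lin_comb\<close>)
    thus "((\<lambda>F. cinner (s F) (e i)) \<longlongrightarrow> c i) (finite_subsets_at_top I)"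
      by (rule tendsto_eventually)
  qed simp
  ultimately show ?thesis by blast
qed

lemma coeff_summable:
  "(\<lambda>i. (cmod (cinner v (e i)))\<^sup>2) summable_on I"
  by (rule nonneg_bounded_partial_sums_imp_summable_on[of _ _ "(norm v)\<^sup>2"])
    (auto simp: bessel)

text \<open>
  The orthogonal projection onto the closed span of the \<open>e i\<close> with \<open>i \<in> S\<close>, described by its
  coordinates; the choice exists by \<open>riesz_fischer\<close> and is unique by \<open>K_eqI\<close>.
\<close>

definition proj :: "'i set \<Rightarrow> 'a L2 \<Rightarrow> 'a L2"
  where "proj S v = (SOME w. w \<in> K \<and> (\<forall>i\<in>I. cinner w (e i) = (if i \<in> S then cinner v (e i) else 0)))"

lemma proj_props:
  "proj S v \<in> K" "i \<in> I \<Longrightarrow> cinner (proj S v) (e i) = (if i \<in> S then cinner v (e i) else 0)"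
proof -
  have "(\<lambda>i. (cmod (if i \<in> S then cinner v (e i) else 0))\<^sup>2) summable_on I"
    by (rule summable_on_comparison_test[OF coeff_summable[of v]]) auto
  from riesz_fischer[OF this]
  have "\<exists>w. w \<in> K \<and> (\<forall>i\<in>I. cinner w (e i) = (if i \<in> S then cinner v (e i) else 0))"
    by blast
  from someI_ex[OF this]
  show "proj S v \<in> K" "i \<in> I \<Longrightarrow> cinner (proj S v) (e i) = (if i \<in> S then cinner v (e i) else 0)"
    unfolding proj_def by auto
qed

text \<open>
  The maximal operator with eigenvectors \<open>e i\<close> and eigenvalues \<open>l i\<close>: its domain consists of the
  \<open>v\<close> for which the coordinates \<open>l i * \<langle>v, e i\<rangle>\<close> are those of some vector.
\<close>

definition diag_op :: "('i \<Rightarrow> real) \<Rightarrow> 'a operator"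
  where "diag_op l = {(v, w). v \<in> K \<and> w \<in> K \<and>
    (\<forall>i\<in>I. cinner w (e i) = complex_of_real (l i) * cinner v (e i))}"

lemma diag_op_e: "i \<in> I \<Longrightarrow> (e i, complex_of_real (l i) *\<^sub>C e i) \<in> diag_op l"
  by (auto simp: diag_op_def e_in_K K_scale cinner_scaleC_left ortho)

lemma csubspace_diag_op: "csubspace (diag_op l)"
  by (rule complex_vector.subspaceI)
    (auto simp: diag_op_def K_zero K_add K_scale cinner_add_left cinner_scaleC_left scaleC_prod_def
      zero_prod_def algebra_simps)

lemma single_valued_diag_op: "single_valued (diag_op l)"
  by (rule single_valuedI) (auto simp: diag_op_def intro: K_eqI)

lemma closed_diag_op: "closed (diag_op l)"
proof -
  have "diag_op l = (K \<times> K) \<inter>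
      (\<Inter>i\<in>I. {p. cinner (snd p) (e i) = complex_of_real (l i) * cinner (fst p) (e i)})"
    by (auto simp: diag_op_def)
  also have "closed \<dots>"
    by (intro closed_Int closed_Times closed_K closed_INT ballI closed_Collect_eq
        continuous_intros continuous_on_cinner)
  finally show ?thesis .
qed

text \<open>
  Essential self-adjointness from a complete set of eigenvectors.  The graph \<open>A\<close> lies in the closed
  graph \<open>diag_op l\<close>.  Conversely, truncating the expansions of \<open>v\<close> and \<open>w\<close> to the same finite index
  set gives an element of \<open>A\<close>, and these truncations converge to \<open>(v, w)\<close>.
\<close>

lemma closure_eq_diag_op:
  assumes sub: "A \<subseteq> K \<times> K" and lin: "csubspace A"
    and sym: "\<And>v w i. (v, w) \<in> A \<Longrightarrow> i \<in> I \<Longrightarrow> cinner w (e i) = complex_of_real (l i) * cinner v (e i)"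
    and eig: "\<And>i. i \<in> I \<Longrightarrow> (e i, complex_of_real (l i) *\<^sub>C e i) \<in> A"
  shows "closure A = diag_op l"
proof
  have "A \<subseteq> diag_op l" using sub sym by (auto simp: diag_op_def)
  thus "closure A \<subseteq> diag_op l" by (rule closure_minimal) (rule closed_diag_op)
  show "diag_op l \<subseteq> closure A"
  proof clarify
    fix v w assume vw: "(v, w) \<in> diag_op l"
    hence K: "v \<in> K" "w \<in> K" by (auto simp: diag_op_def)
    let ?s = "\<lambda>F. (\<Sum>i\<in>F. cinner v (e i) *\<^sub>C e i, \<Sum>i\<in>F. cinner w (e i) *\<^sub>C e i)"
    have lim: "(?s \<longlongrightarrow> (v, w)) (finite_subsets_at_top I)"
      using fourier_expansion[OF K(1)] fourier_expansion[OF K(2)]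
      unfolding has_sum_def by (rule tendsto_Pair)
    have "?s F \<in> A" if "finite F" "F \<subseteq> I" for F
    proof -
      have "(\<Sum>i\<in>F. cinner v (e i) *\<^sub>C (e i, complex_of_real (l i) *\<^sub>C e i)) \<in> A"
        using that by (intro complex_vector.subspace_sum[OF lin] complex_vector.subspace_scale[OF lin] eig) auto
      also have "(\<Sum>i\<in>F. cinner v (e i) *\<^sub>C (e i, complex_of_real (l i) *\<^sub>C e i))
        = (\<Sum>i\<in>F. cinner v (e i) *\<^sub>C e i, \<Sum>i\<in>F. (complex_of_real (l i) * cinner v (e i)) *\<^sub>C e i)"
        by (simp add: scaleC_prod_def scaleC_scaleC prod_eq_iff fst_sum snd_sum mult.commute)
      also have "\<dots> = ?s F"
        using vw that by (auto simp: diag_op_def intro!: sum.cong)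
      finally show ?thesis .
    qed
    hence "\<forall>\<^sub>F F in finite_subsets_at_top I. ?s F \<in> closure A"
      using closure_subset by (intro eventually_finite_subsets_at_top_weakI) blast
    thus "(v, w) \<in> closure A"
      by (rule Lim_in_closed_set[OF closed_closure _ _ lim]) simp
  qed
qed

lemma densely_defined_diag_op: "densely_defined_operator K (diag_op l)"
  unfolding densely_defined_operator_def
proof (intro conjI single_valued_diag_op csubspace_diag_op)
  show "diag_op l \<subseteq> K \<times> K" by (auto simp: diag_op_def)
  have "csubspace (Domain (diag_op l))"
  proof (rule complex_vector.subspaceI)
    show "0 \<in> Domain (diag_op l)"
      using complex_vector.subspace_0[OF csubspace_diag_op] by (auto simp: zero_prod_def)
  next
    fix x y assume "x \<in> Domain (diag_op l)" "y \<in> Domain (diag_op l)"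
    thus "x + y \<in> Domain (diag_op l)"
      using complex_vector.subspace_add[OF csubspace_diag_op] by fastforce
  next
    fix c x assume "x \<in> Domain (diag_op l)"
    thus "c *\<^sub>C x \<in> Domain (diag_op l)"
      using complex_vector.subspace_scale[OF csubspace_diag_op] by (fastforce simp: scaleC_prod_def)
  qed
  moreover have "e ` I \<subseteq> Domain (diag_op l)" using diag_op_e by blast
  ultimately have "cspan (e ` I) \<subseteq> Domain (diag_op l)"
    by (intro complex_vector.span_minimal)
  thus "K \<subseteq> closure (Domain (diag_op l))"
    unfolding K_def by (rule closure_mono)
qed

text \<open>
  Testing the adjoint relation on the eigenvectors already determines the coordinates of \<open>w\<close>; the
  converse inclusion is Parseval's identity with real weights.
\<close>

lemma self_adjoint_diag_op: "self_adjoint K (diag_op l)"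
  unfolding self_adjoint_def
proof (intro conjI densely_defined_diag_op set_eqI)
  fix p :: "'a L2 \<times> 'a L2"
  obtain v w where p: "p = (v, w)" by fastforce
  show "p \<in> adjoint_operator K (diag_op l) \<longleftrightarrow> p \<in> diag_op l"
  proof
    assume "p \<in> adjoint_operator K (diag_op l)"
    hence *: "v \<in> K" "w \<in> K" "\<And>x y. (x, y) \<in> diag_op l \<Longrightarrow> cinner y v = cinner x w"
      by (auto simp: adjoint_operator_def p)
    have "cinner w (e i) = complex_of_real (l i) * cinner v (e i)" if "i \<in> I" for i
    proof -
      have "cinner (e i) w = complex_of_real (l i) * cinner (e i) v"
        using *(3)[OF diag_op_e[OF that]] by (simp add: cinner_scaleC_left)
      thus ?thesis
        by (metis cinner_commute complex_cnj_complex_of_real complex_cnj_mult)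
    qed
    with * show "p \<in> diag_op l" by (simp add: diag_op_def p)
  next
    assume "p \<in> diag_op l"
    hence vw: "v \<in> K" "w \<in> K"
        "\<And>i. i \<in> I \<Longrightarrow> cinner w (e i) = complex_of_real (l i) * cinner v (e i)"
      by (auto simp: diag_op_def p)
    have "cinner y v = cinner x w" if "(x, y) \<in> diag_op l" for x y
    proof (rule has_sum_unique)
      show "((\<lambda>i. cinner y (e i) * cnj (cinner v (e i))) has_sum cinner y v) I"
        using that by (intro parseval) (auto simp: diag_op_def)
      have "((\<lambda>i. cinner x (e i) * cnj (cinner w (e i))) has_sum cinner x w) I"
        using that by (intro parseval) (auto simp: diag_op_def)
      thus "((\<lambda>i. cinner y (e i) * cnj (cinner v (e i))) has_sum cinner x w) I"
        by (rule has_sum_cong[THEN iffD1, rotated]) (use that vw in \<open>auto simp: diag_op_def\<close>)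
    qed
    with vw show "p \<in> adjoint_operator K (diag_op l)"
      by (auto simp: adjoint_operator_def p)
  qed
qed

lemma Domain_diag_op:
  "Domain (diag_op l) = {v \<in> K. (\<lambda>i. (l i)\<^sup>2 * (cmod (cinner v (e i)))\<^sup>2) summable_on I}"
proof (intro set_eqI iffI)
  fix v assume "v \<in> Domain (diag_op l)"
  then obtain w where w: "v \<in> K" "w \<in> K"
      "\<And>i. i \<in> I \<Longrightarrow> cinner w (e i) = complex_of_real (l i) * cinner v (e i)"
    by (auto simp: diag_op_def)
  have "(\<lambda>i. (l i)\<^sup>2 * (cmod (cinner v (e i)))\<^sup>2) summable_on I"
    by (rule summable_on_cong[THEN iffD1, OF _ coeff_summable[of w]])
      (simp add: w norm_mult power_mult_distrib)
  with w show "v \<in> {v \<in> K. (\<lambda>i. (l i)\<^sup>2 * (cmod (cinner v (e i)))\<^sup>2) summable_on I}" by simp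
next
  fix v assume v: "v \<in> {v \<in> K. (\<lambda>i. (l i)\<^sup>2 * (cmod (cinner v (e i)))\<^sup>2) summable_on I}"
  hence "(\<lambda>i. (cmod (complex_of_real (l i) * cinner v (e i)))\<^sup>2) summable_on I"
    by (simp add: norm_mult power_mult_distrib)
  from riesz_fischer[OF this] show "v \<in> Domain (diag_op l)"
    using v by (auto simp: diag_op_def)
qed

lemma eigenspace_diag_op:
  "eigenspace (diag_op l) z = {v \<in> K. \<forall>i\<in>I. complex_of_real (l i) \<noteq> z \<longrightarrow> cinner v (e i) = 0}"
  by (auto simp: eigenspace_def diag_op_def cinner_scaleC_left K_scale)

lemma eigenspace_diag_op_finite:
  assumes fin: "finite {i \<in> I. complex_of_real (l i) = z}"
  shows "eigenspace (diag_op l) z = cspan (e ` {i \<in> I. complex_of_real (l i) = z})" (is "_ = cspan (e ` ?F)")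
proof (intro set_eqI iffI)
  fix v assume "v \<in> eigenspace (diag_op l) z"
  hence v: "v \<in> K" "\<And>i. i \<in> I \<Longrightarrow> complex_of_real (l i) \<noteq> z \<Longrightarrow> cinner v (e i) = 0"
    by (auto simp: eigenspace_diag_op)
  have "v = fourier ?F v"
    by (rule K_eqI)
      (use v fin in \<open>auto simp: fourier_def cinner_lin_comb intro!: K_sum K_scale e_in_K\<close>)
  moreover have "fourier ?F v \<in> cspan (e ` ?F)"
    unfolding fourier_def
    by (intro complex_vector.span_sum complex_vector.span_scale complex_vector.span_base) auto
  ultimately show "v \<in> cspan (e ` ?F)" by simp
next
  have "csubspace (eigenspace (diag_op l) z)"
    by (rule complex_vector.subspaceI)
      (auto simp: eigenspace_diag_op K_zero K_add K_scale cinner_add_left cinner_scaleC_left)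
  moreover have "e ` ?F \<subseteq> eigenspace (diag_op l) z"
    by (auto simp: eigenspace_diag_op e_in_K ortho)
  ultimately have "cspan (e ` ?F) \<subseteq> eigenspace (diag_op l) z"
    by (intro complex_vector.span_minimal)
  thus "v \<in> cspan (e ` ?F) \<Longrightarrow> v \<in> eigenspace (diag_op l) z" for v by blast
qed

lemma e_nonzero: "i \<in> I \<Longrightarrow> e i \<noteq> 0"
  using ortho[of i i] by auto

lemma eigenvalue_diag_op_iff:
  "eigenvalue (diag_op l) z \<longleftrightarrow> z \<in> complex_of_real ` l ` I"
proof
  assume "eigenvalue (diag_op l) z"
  then obtain v where v: "v \<in> K" "v \<noteq> 0"
      "\<And>i. i \<in> I \<Longrightarrow> complex_of_real (l i) \<noteq> z \<Longrightarrow> cinner v (e i) = 0"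
    by (auto simp: eigenvalue_def eigenspace_diag_op)
  have "\<not> (\<forall>i\<in>I. cinner v (e i) = 0)"
    using K_eqI[of v 0] v K_zero by auto
  with v(3) show "z \<in> complex_of_real ` l ` I" by blast
next
  assume "z \<in> complex_of_real ` l ` I"
  then obtain i where i: "i \<in> I" "z = complex_of_real (l i)" by blast
  show "eigenvalue (diag_op l) z"
    unfolding eigenvalue_def
    by (rule bexI[of _ "e i"]) (use i diag_op_e e_nonzero in \<open>auto simp: eigenspace_def\<close>)
qed

text \<open>
  Away from the closed set of eigenvalues the resolvent divides the coordinates by \<open>l i - z\<close>, which
  is bounded away from zero.
\<close>

lemma spectrum_diag_op:
  assumes closed: "closed (complex_of_real ` l ` I)"
  shows "spectrum K (diag_op l) = complex_of_real ` l ` I"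
proof -
  have "z \<in> resolvent_set K (diag_op l)" if z: "z \<notin> complex_of_real ` l ` I" for z
  proof -
    obtain d where d: "d > 0" "\<And>i. i \<in> I \<Longrightarrow> d \<le> cmod (complex_of_real (l i) - z)"
      using separate_point_closed[OF closed z] by (auto simp: dist_norm norm_minus_commute)
    have nz: "complex_of_real (l i) - z \<noteq> 0" if "i \<in> I" for i
      using d(1) d(2)[OF that] by auto
    have "\<exists>!v. (v, w + z *\<^sub>C v) \<in> diag_op l" if w: "w \<in> K" for w
    proof -
      have "(\<lambda>i. (cmod (cinner w (e i) / (complex_of_real (l i) - z)))\<^sup>2) summable_on I"
      proof (rule summable_on_comparison_test)
        show "(\<lambda>i. (1/d\<^sup>2) * (cmod (cinner w (e i)))\<^sup>2) summable_on I"
          by (intro summable_on_cmult_right coeff_summable)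
        fix i assume i: "i \<in> I"
        have "(cmod (cinner w (e i) / (complex_of_real (l i) - z)))\<^sup>2 \<le> (cmod (cinner w (e i)) / d)\<^sup>2"
          unfolding norm_divide using d(1) d(2)[OF i] nz[OF i]
          by (intro power_mono divide_left_mono mult_pos_pos) auto
        thus "(cmod (cinner w (e i) / (complex_of_real (l i) - z)))\<^sup>2 \<le> (1/d\<^sup>2) * (cmod (cinner w (e i)))\<^sup>2"
          by (simp add: power_divide)
      qed simp
      from riesz_fischer[OF this] obtain v where v: "v \<in> K"
          "\<And>i. i \<in> I \<Longrightarrow> cinner v (e i) = cinner w (e i) / (complex_of_real (l i) - z)"
        by blast
      show ?thesis
      proof (rule ex1I)
        show "(v, w + z *\<^sub>C v) \<in> diag_op l"
          using v w nz
          by (auto simp: diag_op_def K_add K_scale cinner_add_left cinner_scaleC_left field_simps)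
        fix u assume "(u, w + z *\<^sub>C u) \<in> diag_op l"
        hence u: "u \<in> K" "\<And>i. i \<in> I \<Longrightarrow> cinner w (e i) + z * cinner u (e i) = complex_of_real (l i) * cinner u (e i)"
          by (auto simp: diag_op_def cinner_add_left cinner_scaleC_left)
        show "u = v"
        proof (rule K_eqI[OF u(1) v(1)])
          fix i assume i: "i \<in> I"
          show "cinner u (e i) = cinner v (e i)"
            using u(2)[OF i] v(2)[OF i] nz[OF i]
            by (metis (no_types) add_diff_cancel_right' left_diff_distrib nonzero_mult_div_cancel_left)
        qed
      qed
    qed
    moreover have "norm v \<le> (1/d) * norm (y - z *\<^sub>C v)" if vy: "(v, y) \<in> diag_op l" for v y
    proof -
      have K: "v \<in> K" "y - z *\<^sub>C v \<in> K"
        using vy by (auto simp: diag_op_def K_diff K_scale)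
      have "(norm v)\<^sup>2 \<le> (1/d\<^sup>2) * (norm (y - z *\<^sub>C v))\<^sup>2"
      proof (rule has_sum_mono[OF parseval_norm[OF K(1)] has_sum_cmult_right[OF parseval_norm[OF K(2)]]])
        fix i assume i: "i \<in> I"
        have eq: "cinner (y - z *\<^sub>C v) (e i) = (complex_of_real (l i) - z) * cinner v (e i)"
          using vy i by (auto simp: diag_op_def cinner_diff_left cinner_scaleC_left algebra_simps)
        have "d * cmod (cinner v (e i)) \<le> cmod (cinner (y - z *\<^sub>C v) (e i))"
          unfolding eq norm_mult using d(2)[OF i] by (intro mult_right_mono) auto
        hence "(d * cmod (cinner v (e i)))\<^sup>2 \<le> (cmod (cinner (y - z *\<^sub>C v) (e i)))\<^sup>2"
          using d(1) by (intro power_mono) auto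
        thus "(cmod (cinner v (e i)))\<^sup>2 \<le> (1/d\<^sup>2) * (cmod (cinner (y - z *\<^sub>C v) (e i)))\<^sup>2"
          using d(1) by (simp add: power_mult_distrib field_simps)
      qed
      also have "\<dots> = ((1/d) * norm (y - z *\<^sub>C v))\<^sup>2" by (simp add: power_mult_distrib power_divide)
      finally show ?thesis by (rule power2_le_imp_le) (use d(1) in simp)
    qed
    ultimately show ?thesis unfolding resolvent_set_def by blast
  qed
  moreover have "z \<notin> resolvent_set K (diag_op l)" if z: "z \<in> complex_of_real ` l ` I" for z
  proof
    assume "z \<in> resolvent_set K (diag_op l)"
    hence ex1: "\<exists>!v. (v, 0 + z *\<^sub>C v) \<in> diag_op l" unfolding resolvent_set_def using K_zero by blast
    obtain i where i: "i \<in> I" "z = complex_of_real (l i)" using z by auto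
    have "(e i, 0 + z *\<^sub>C e i) \<in> diag_op l" using diag_op_e i by simp
    moreover have "(0, 0 + z *\<^sub>C 0) \<in> diag_op l"
      using complex_vector.subspace_0[OF csubspace_diag_op] by (simp add: zero_prod_def)
    ultimately show False using ex1 e_nonzero[OF i(1)] by blast
  qed
  ultimately show ?thesis unfolding spectrum_def by blast
qed

end

section \<open>Spectral measures of diagonal operators\<close>

lemma nn_integral_count_space_has_sum:
  fixes f :: "'i \<Rightarrow> real"
  assumes "(f has_sum s) A" and "\<And>i. i \<in> A \<Longrightarrow> f i \<ge> 0"
  shows "(\<integral>\<^sup>+i. ennreal (f i) \<partial>count_space A) = ennreal s"
proof -
  have "(\<lambda>i. norm (f i)) summable_on A"
    using assms summable_on_cong[of A "\<lambda>i. norm (f i)" f] by (auto simp: summable_on_def)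
  hence f: "Infinite_Set_Sum.abs_summable_on f A"
    by (rule abs_summable_equivalent[THEN iffD1])
  show ?thesis
    using nn_integral_conv_infsetsum[OF f] assms infsetsum_infsum[OF f] infsumI[OF assms(1)] by simp
qed

context orthonormal_family
begin

lemma proj_idem: "proj S (proj S v) = proj S v"
  by (rule K_eqI) (auto simp: proj_props)

lemma proj_commute: "proj S (proj T v) = proj T (proj S v)"
  by (rule K_eqI) (auto simp: proj_props)

lemma cinner_proj_commute:
  assumes "v \<in> K" "w \<in> K"
  shows "cinner (proj S v) w = cinner v (proj S w)"
proof (rule has_sum_unique)
  show "((\<lambda>i. cinner (proj S v) (e i) * cnj (cinner w (e i))) has_sum cinner (proj S v) w) I"
    by (intro parseval proj_props)
  have "((\<lambda>i. cinner v (e i) * cnj (cinner (proj S w) (e i))) has_sum cinner v (proj S w)) I"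
    by (intro parseval assms)
  thus "((\<lambda>i. cinner (proj S v) (e i) * cnj (cinner w (e i))) has_sum cinner v (proj S w)) I"
    by (rule has_sum_cong[THEN iffD1, rotated]) (auto simp: proj_props)
qed

lemma orthogonal_projection_proj: "orthogonal_projection K (proj S)"
  unfolding orthogonal_projection_def
proof (intro conjI ballI allI)
  fix v w c assume vw: "v \<in> K" "w \<in> K"
  show "proj S (v + w) = proj S v + proj S w"
    by (rule K_eqI) (auto simp: proj_props K_add cinner_add_left)
  show "proj S (c *\<^sub>C v) = c *\<^sub>C proj S v"
    by (rule K_eqI) (auto simp: proj_props K_scale cinner_scaleC_left)
  show "cinner (proj S v) w = cinner v (proj S w)"
    by (rule cinner_proj_commute[OF vw])
qed (auto simp: proj_props proj_idem)

lemma proj_has_sum: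
  "((\<lambda>i. cinner v (e i) *\<^sub>C e i) has_sum proj S v) (I \<inter> S)"
  using fourier_expansion[OF proj_props(1)[of S v]]
  by (rule has_sum_cong_neutral[THEN iffD1, rotated -1]) (auto simp: proj_props)

definition spectral_proj :: "('i \<Rightarrow> real) \<Rightarrow> real set \<Rightarrow> 'a L2 \<Rightarrow> 'a L2"
  where "spectral_proj l S = proj (l -` S)"

text \<open>
  Countable additivity is the regrouping of a summable family along the partition of the index set
  into the sets \<open>l -` S k\<close>.
\<close>

lemma spectral_proj_sums:
  assumes "disjoint_family S"
  shows "(\<lambda>k. spectral_proj l (S k) v) sums spectral_proj l (\<Union>k. S k) v"
proof -
  define A where "A = (\<lambda>k. I \<inter> l -` S k)"
  have "((\<lambda>i. cinner v (e i) *\<^sub>C e i) has_sum spectral_proj l (\<Union>k. S k) v) (I \<inter> l -` (\<Union>k. S k))"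
    unfolding spectral_proj_def by (rule proj_has_sum)
  moreover have "bij_betw snd (Sigma UNIV A) (I \<inter> l -` (\<Union>k. S k))"
    using assms unfolding A_def disjoint_family_on_def bij_betw_def inj_on_def
    by (auto simp: image_iff)
  ultimately have *: "((\<lambda>p. cinner v (e (snd p)) *\<^sub>C e (snd p)) has_sum spectral_proj l (\<Union>k. S k) v)
      (Sigma UNIV A)"
    using has_sum_reindex_bij_betw[of snd "Sigma UNIV A" _ "\<lambda>i. cinner v (e i) *\<^sub>C e i"] by blast
  have "((\<lambda>k. spectral_proj l (S k) v) has_sum spectral_proj l (\<Union>k. S k) v) UNIV"
    by (rule has_sum_SigmaD[OF *]) (auto simp: A_def spectral_proj_def intro!: proj_has_sum)
  thus ?thesis by (rule has_sum_imp_sums)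
qed

lemma projection_valued_measure_spectral_proj: "projection_valued_measure K (spectral_proj l)"
  unfolding projection_valued_measure_def
proof (intro conjI ballI allI impI)
  fix v assume "v \<in> K"
  thus "spectral_proj l UNIV v = v"
    unfolding spectral_proj_def by (intro K_eqI) (auto simp: proj_props)
qed (auto simp: spectral_proj_def[of l] orthogonal_projection_proj
      intro!: spectral_proj_sums[unfolded spectral_proj_def])

text \<open>
  The measure with mass \<open>|\<langle>v, e i\<rangle>|\<^sup>2\<close> at each \<open>l i\<close>.  It is the scalar spectral measure of
  \<open>diag_op l\<close> at \<open>v\<close>; as an image of a density over counting measure it turns integrals into sums
  over \<open>I\<close>.
\<close>

definition weight_measure :: "('i \<Rightarrow> real) \<Rightarrow> 'a L2 \<Rightarrow> real measure"
  where "weight_measure l v =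
    distr (density (count_space I) (\<lambda>i. ennreal ((cmod (cinner v (e i)))\<^sup>2))) borel l"

lemma emeasure_weight_measure:
  assumes "v \<in> K" "S \<in> sets borel"
  shows "emeasure (weight_measure l v) S = ennreal (Re (cinner (spectral_proj l S v) v))"
proof -
  have eq: "cinner (spectral_proj l S v) v = complex_of_real ((norm (spectral_proj l S v))\<^sup>2)"
    by (metis assms(1) cinner_proj_commute cinner_self_norm proj_idem proj_props(1) spectral_proj_def)
  have "emeasure (weight_measure l v) S = emeasure (density (count_space I)
      (\<lambda>i. ennreal ((cmod (cinner v (e i)))\<^sup>2))) (l -` S \<inter> I)"
    unfolding weight_measure_def using assms by (subst emeasure_distr) auto
  also have "\<dots> = (\<integral>\<^sup>+i. ennreal ((cmod (cinner v (e i)))\<^sup>2) * indicator (l -` S \<inter> I) i \<partial>count_space I)"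
    by (rule emeasure_density) auto
  also have "\<dots> = (\<integral>\<^sup>+i. ennreal ((cmod (cinner (spectral_proj l S v) (e i)))\<^sup>2) \<partial>count_space I)"
    by (rule nn_integral_cong) (auto simp: spectral_proj_def proj_props indicator_def)
  also have "\<dots> = ennreal ((norm (spectral_proj l S v))\<^sup>2)"
    by (rule nn_integral_count_space_has_sum[OF parseval_norm])
      (auto simp: spectral_proj_def proj_props)
  finally show ?thesis by (simp only: eq Re_complex_of_real)
qed

lemma scalar_spectral_measure_spectral_proj:
  assumes "v \<in> K"
  shows "scalar_spectral_measure (spectral_proj l) v = weight_measure l v"
proof -
  have "scalar_spectral_measure (spectral_proj l) v
      = measure_of (space (weight_measure l v)) (sets (weight_measure l v)) (emeasure (weight_measure l v))"
    unfolding scalar_spectral_measure_def weight_measure_def space_distr sets_distr space_borel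
  proof (rule measure_of_eq)
    fix S :: "real set" assume "S \<in> sigma_sets UNIV (sets borel)"
    hence "S \<in> sets borel" by (metis sets.sigma_sets_eq space_borel)
    thus "ennreal (Re (cinner (spectral_proj l S v) v)) = emeasure (distr (density (count_space I)
        (\<lambda>i. ennreal ((cmod (cinner v (e i)))\<^sup>2))) borel l) S"
      using emeasure_weight_measure[OF assms] by (simp add: weight_measure_def)
  qed simp
  also have "\<dots> = weight_measure l v" by (rule measure_of_of_measure)
  finally show ?thesis .
qed

lemma integrable_weight_measure_iff:
  assumes [measurable]: "f \<in> borel_measurable borel"
  shows "integrable (weight_measure l v) (f :: real \<Rightarrow> real) \<longleftrightarrow>
    Infinite_Set_Sum.abs_summable_on (\<lambda>i. (cmod (cinner v (e i)))\<^sup>2 * f (l i)) I"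
  unfolding weight_measure_def
  by (subst integrable_distr_eq) (auto simp: integrable_density abs_summable_on_def)

lemma integral_weight_measure:
  assumes [measurable]: "f \<in> borel_measurable borel"
  shows "(LINT t|weight_measure l v. (f t :: real)) = infsetsum (\<lambda>i. (cmod (cinner v (e i)))\<^sup>2 * f (l i)) I"
  unfolding weight_measure_def infsetsum_def
  by (subst integral_distr) (auto simp: integral_density)

text \<open>
  Under \<open>weight_measure\<close> the second moment is \<open>\<Sum>i. (l i)\<^sup>2 |\<langle>v, e i\<rangle>|\<^sup>2\<close>, whose finiteness is the
  domain condition, and the first moment is \<open>\<Sum>i. l i |\<langle>v, e i\<rangle>|\<^sup>2\<close>, which is \<open>\<langle>w, v\<rangle>\<close> by Parseval.
\<close>

lemma spectral_measure_diag_op: "spectral_measure_of K (diag_op l) (spectral_proj l)"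
  unfolding spectral_measure_of_def
proof (intro conjI projection_valued_measure_spectral_proj ballI set_eqI)
  fix v
  have "integrable (weight_measure l v) (\<lambda>t. t\<^sup>2) \<longleftrightarrow> (\<lambda>i. (l i)\<^sup>2 * (cmod (cinner v (e i)))\<^sup>2) summable_on I"
    by (subst integrable_weight_measure_iff)
      (auto simp: abs_summable_equivalent[symmetric] norm_mult mult.commute)
  thus "v \<in> Domain (diag_op l) \<longleftrightarrow>
      v \<in> {v \<in> K. integrable (scalar_spectral_measure (spectral_proj l) v) (\<lambda>t. t\<^sup>2)}"
    by (auto simp: Domain_diag_op scalar_spectral_measure_spectral_proj)
next
  fix p assume "p \<in> diag_op l"
  then obtain v w where p: "p = (v, w)" and vw: "v \<in> K" "w \<in> K"
      "\<And>i. i \<in> I \<Longrightarrow> cinner w (e i) = complex_of_real (l i) * cinner v (e i)"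
    by (auto simp: diag_op_def)
  define f where "f = (\<lambda>i. (cmod (cinner v (e i)))\<^sup>2 * l i)"
  have 1: "((\<lambda>i. complex_of_real (f i)) has_sum cinner w v) I"
    using parseval[OF vw(2), of v]
    by (rule has_sum_cong[THEN iffD1, rotated])
      (simp only: f_def vw(3) complex_norm_square of_real_mult mult.assoc mult.commute mult.left_commute)
  have 2: "(f has_sum Re (cinner w v)) I"
    using has_sum_bounded_linear[OF bounded_linear_Re 1] by simp
  hence "((\<lambda>i. complex_of_real (f i)) has_sum complex_of_real (Re (cinner w v))) I"
    by (rule has_sum_of_real)
  with 1 have re: "cinner w v = complex_of_real (Re (cinner w v))" by (rule has_sum_unique)
  have "Infinite_Set_Sum.abs_summable_on f I"
    by (rule abs_summable_equivalent[THEN iffD1])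
      (use 2 in \<open>auto simp: summable_on_iff_abs_summable_on_real[symmetric, unfolded real_norm_def]
        intro: has_sum_imp_summable\<close>)
  hence "infsetsum f I = Re (cinner w v)"
    using infsumI[OF 2] by (simp add: infsetsum_infsum)
  moreover have "(LINT t|weight_measure l v. t) = infsetsum f I"
    unfolding f_def by (rule integral_weight_measure) simp
  ultimately have "cinner w v = complex_of_real (LINT t|scalar_spectral_measure (spectral_proj l) v. t)"
    using re vw(1) by (simp add: scalar_spectral_measure_spectral_proj)
  thus "case p of (v, w) \<Rightarrow> cinner w v = complex_of_real (LINT t|scalar_spectral_measure (spectral_proj l) v. t)"
    by (simp add: p)
qed

text \<open>
  The spectral projections of both operators are coordinate projections for the same family.
\<close>

lemma diag_ops_commute: "operators_commute K (diag_op l) (diag_op m)"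
  unfolding operators_commute_def
  by (rule exI[of _ "spectral_proj l"], rule exI[of _ "spectral_proj m"])
    (auto simp: spectral_measure_diag_op spectral_proj_def intro: proj_commute)

end

section \<open>Simultaneous diagonalization\<close>

definition poly_apply :: "('a::complex_vector \<Rightarrow> 'a) \<Rightarrow> complex poly \<Rightarrow> 'a \<Rightarrow> 'a"
  where "poly_apply T p v = (\<Sum>i\<le>degree p. coeff p i *\<^sub>C (T ^^ i) v)"

lemma poly_apply_bound:
  assumes "degree p \<le> N"
  shows "poly_apply T p v = (\<Sum>i\<le>N. coeff p i *\<^sub>C (T ^^ i) v)"
  unfolding poly_apply_def
  by (rule sum.mono_neutral_left) (use assms in \<open>auto simp: coeff_eq_0\<close>)

lemma poly_apply_linear_factor:
  assumes add: "\<And>x y. T (x + y) = T x + T y" and scale: "\<And>c x. T (c *\<^sub>C x) = c *\<^sub>C T x"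
  shows "poly_apply T ([:- z, 1:] * q) v = T (poly_apply T q v) - z *\<^sub>C poly_apply T q v"
proof -
  have T0: "T 0 = 0" using scale[of 0 0] by simp
  have Tsum: "T (\<Sum>i\<in>A. f i) = (\<Sum>i\<in>A. T (f i))" for A :: "nat set" and f
    by (induction A rule: infinite_finite_induct) (auto simp: add T0)
  define N where "N = degree q"
  have "degree ([:- z, 1:] * q) \<le> Suc N"
    using degree_mult_le[of "[:- z, 1:]" q] by (simp add: N_def)
  hence "poly_apply T ([:- z, 1:] * q) v
      = (\<Sum>i\<le>Suc N. coeff (pCons 0 q) i *\<^sub>C (T ^^ i) v) - (\<Sum>i\<le>Suc N. (z * coeff q i) *\<^sub>C (T ^^ i) v)"
    by (simp only: poly_apply_bound sum_subtractf[symmetric]) (simp add: complex_vector.scale_left_diff_distrib)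
  also have "(\<Sum>i\<le>Suc N. coeff (pCons 0 q) i *\<^sub>C (T ^^ i) v) = T (poly_apply T q v)"
    by (subst sum.atMost_Suc_shift) (simp add: poly_apply_def N_def Tsum scale)
  also have "(\<Sum>i\<le>Suc N. (z * coeff q i) *\<^sub>C (T ^^ i) v) = z *\<^sub>C poly_apply T q v"
    by (subst poly_apply_bound[of q "Suc N"])
      (auto simp: N_def complex_vector.scale_sum_right scaleC_add_right)
  finally show ?thesis .
qed

text \<open>
  Split off a linear factor \<open>[:- z, 1:]\<close>, with cofactor \<open>q\<close>.  Either \<open>q(T) v\<close> is an eigenvector for
  \<open>z\<close>, or it vanishes and \<open>q\<close> annihilates \<open>v\<close> with smaller degree.
\<close>

lemma eigenvector_from_annihilating_poly:
  assumes add: "\<And>x y. T (x + y) = T x + T y" and scale: "\<And>c x. T (c *\<^sub>C x) = c *\<^sub>C T x"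
    and V: "csubspace V" "\<And>x. x \<in> V \<Longrightarrow> T x \<in> V"
    and v: "v \<in> V" "v \<noteq> 0" and p: "p \<noteq> 0" "poly_apply T p v = 0"
  shows "\<exists>w\<in>V. w \<noteq> 0 \<and> (\<exists>z. T w = z *\<^sub>C w)"
  using p
proof (induction "degree p" arbitrary: p)
  case 0
  then obtain c where "p = [:c:]" using degree_0_id[of p] by metis
  with 0 v show ?case by (auto simp: poly_apply_def)
next
  case (Suc d)
  obtain z where "poly p z = 0"
    using fundamental_theorem_of_algebra[of p] Suc.hyps(2) by (auto simp: constant_degree)
  then obtain q where q: "p = [:- z, 1:] * q"
    by (auto simp: poly_eq_0_iff_dvd)
  with Suc.prems have q0: "q \<noteq> 0" by auto
  have deg: "d = degree q"
    using Suc.hyps(2) q0 unfolding q by (subst (asm) degree_mult_eq) auto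
  define u where "u = poly_apply T q v"
  have iter: "(T ^^ i) v \<in> V" for i
    by (induction i) (use v V in auto)
  have "u \<in> V" unfolding u_def poly_apply_def
    by (intro complex_vector.subspace_sum[OF V(1)] complex_vector.subspace_scale[OF V(1)] iter)
  moreover have "T u = z *\<^sub>C u"
    using Suc.prems(2) unfolding q u_def poly_apply_linear_factor[OF add scale] by simp
  ultimately show ?case
    using Suc.hyps(1)[OF deg q0] unfolding u_def[symmetric] by blast
qed

text \<open>
  The family may have repeated members, and then two equal members already give the relation.
\<close>

lemma finite_span_dependence:
  fixes f :: "nat \<Rightarrow> 'a::complex_vector"
  assumes "finite B" "\<And>i. f i \<in> cspan B"
  shows "\<exists>c. (\<exists>i\<le>card B. c i \<noteq> 0) \<and> (\<Sum>i\<le>card B. c i *\<^sub>C f i) = 0"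
proof (cases "inj_on f {..card B}")
  case True
  have "\<not> (card (f ` {..card B}) \<le> card B)"
    using True by (simp add: card_image)
  hence "cdependent (f ` {..card B})"
    using complex_vector.independent_span_bound[OF assms(1), of "f ` {..card B}"] assms(2) by blast
  then obtain u where u: "\<exists>v\<in>f ` {..card B}. u v \<noteq> 0" "(\<Sum>v\<in>f ` {..card B}. u v *\<^sub>C v) = 0"
    by (subst (asm) complex_vector.dependent_finite) auto
  have "(\<Sum>i\<le>card B. u (f i) *\<^sub>C f i) = 0"
    using u(2) by (subst (asm) sum.reindex[OF True]) simp
  with u(1) show ?thesis by (intro exI[of _ "u \<circ> f"]) auto
next
  case False
  then obtain i j where ij: "i \<le> card B" "j \<le> card B" "i \<noteq> j" "f i = f j"
    by (auto simp: inj_on_def)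
  define c where "c = (\<lambda>k. if k = i then 1 else if k = j then -1 else (0::complex))"
  have "(\<Sum>k\<le>card B. c k *\<^sub>C f k) = (\<Sum>k\<in>{i, j}. c k *\<^sub>C f k)"
    by (rule sum.mono_neutral_right) (use ij in \<open>auto simp: c_def\<close>)
  also have "\<dots> = 0" using ij by (simp add: c_def)
  finally show ?thesis using ij by (intro exI[of _ c]) (auto simp: c_def)
qed

lemma eigenvector_exists:
  assumes add: "\<And>x y. T (x + y) = T x + T y" and scale: "\<And>c x. T (c *\<^sub>C x) = c *\<^sub>C T x"
    and V: "csubspace V" "\<And>x. x \<in> V \<Longrightarrow> T x \<in> V" and B: "finite B" "V \<subseteq> cspan B"
    and v: "v \<in> V" "v \<noteq> 0"
  shows "\<exists>w\<in>V. w \<noteq> 0 \<and> (\<exists>z. T w = z *\<^sub>C w)"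
proof -
  have iter: "(T ^^ i) v \<in> V" for i
    by (induction i) (use v V in auto)
  obtain c i where c: "i \<le> card B" "c i \<noteq> 0" "(\<Sum>i\<le>card B. c i *\<^sub>C (T ^^ i) v) = 0"
    using finite_span_dependence[OF B(1), of "\<lambda>i. (T ^^ i) v"] iter B(2) by blast
  define p where "p = (\<Sum>j\<le>card B. monom (c j) j)"
  have coeff: "coeff p j = (if j \<le> card B then c j else 0)" for j
    by (auto simp: p_def coeff_sum)
  have "degree p \<le> card B" by (rule degree_le) (auto simp: coeff)
  hence "poly_apply T p v = 0" using c(3) by (simp add: poly_apply_bound coeff)
  moreover have "p \<noteq> 0" using c(1,2) coeff[of i] by auto
  ultimately show ?thesis by (intro eigenvector_from_annihilating_poly[OF add scale V v])
qed

text \<open>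
  The finite-dimensional spectral theorem.  The orthogonal complement in \<open>V\<close> of a unit eigenvector is
  again invariant, by symmetry, and has a smaller spanning set.
\<close>

lemma symmetric_eigenbasis:
  fixes T :: "'a::euclidean_space L2 \<Rightarrow> 'a L2"
  assumes add: "\<And>x y. T (x + y) = T x + T y" and scale: "\<And>c x. T (c *\<^sub>C x) = c *\<^sub>C T x"
    and "csubspace V" "\<And>x. x \<in> V \<Longrightarrow> T x \<in> V" and "finite B" "V \<subseteq> cspan B"
    and "\<And>x y. x \<in> V \<Longrightarrow> y \<in> V \<Longrightarrow> cinner (T x) y = cinner x (T y)"
  shows "\<exists>F \<subseteq> V. (\<forall>f\<in>F. \<forall>g\<in>F. cinner f g = (if f = g then 1 else 0)) \<and>
    (\<forall>f\<in>F. \<exists>r. T f = complex_of_real r *\<^sub>C f) \<and> cspan F = V"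
  using assms(3-)
proof (induction "card B" arbitrary: B V rule: less_induct)
  case less
  note V = less.prems(1,2) and B = less.prems(3,4) and sym = less.prems(5)
  show ?case
  proof (cases "V = {0}")
    case True
    thus ?thesis by (intro exI[of _ "{}"]) auto
  next
    case False
    then obtain v where "v \<in> V" "v \<noteq> 0"
      using complex_vector.subspace_0[OF V(1)] by auto
    then obtain w z where w: "w \<in> V" "w \<noteq> 0" "T w = z *\<^sub>C w"
      using eigenvector_exists[OF add scale V B] by blast
    define f where "f = complex_of_real (1 / norm w) *\<^sub>C w"
    have f: "f \<in> V" "T f = z *\<^sub>C f"
      unfolding f_def using w complex_vector.subspace_scale[OF V(1)]
      by (auto simp: scale scaleC_scaleC mult.commute)
    have ff: "cinner f f = 1"
      using w(2) by (simp add: f_def cinner_self_norm norm_scaleC norm_divide)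
    have "cinner (T f) f = cinner f (T f)" by (intro sym f)
    hence "z = cnj z" by (simp add: f cinner_scaleC_left cinner_scaleC_right ff)
    then obtain r where r: "z = complex_of_real r" by (metis Reals_cases Reals_cnj_iff)
    define V' where "V' = {x \<in> V. cinner x f = 0}"
    have V': "csubspace V'"
      by (rule complex_vector.subspaceI)
        (auto simp: V'_def cinner_add_left cinner_scaleC_left complex_vector.subspace_0[OF V(1)]
          complex_vector.subspace_add[OF V(1)] complex_vector.subspace_scale[OF V(1)])
    have TV': "T x \<in> V'" if "x \<in> V'" for x
      using that sym[of x f] f V(2)[of x] by (auto simp: V'_def cinner_scaleC_right)
    obtain B' where B': "B' \<subseteq> V'" "\<not> cdependent B'" "V' \<subseteq> cspan B'"
      by (rule complex_vector.maximal_independent_subset)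
    have span_B': "cspan B' \<subseteq> V'"
      using B'(1) V' by (rule complex_vector.span_minimal)
    have fV': "f \<notin> V'" using ff by (simp add: V'_def)
    have "\<not> cdependent (insert f B')"
      using complex_vector.independent_insertI[OF _ B'(2)] fV' span_B' by blast
    hence fin: "finite (insert f B')" "card (insert f B') \<le> card B"
      using complex_vector.independent_span_bound[OF B(1), of "insert f B'"] B B' f
      by (auto simp: V'_def)
    have "f \<notin> B'" using fV' B' by blast
    hence "card B' < card B" using fin by simp
    have "\<exists>F \<subseteq> V'. (\<forall>f\<in>F. \<forall>g\<in>F. cinner f g = (if f = g then 1 else 0)) \<and>
        (\<forall>f\<in>F. \<exists>r. T f = complex_of_real r *\<^sub>C f) \<and> cspan F = V'"
    proof (rule less.hyps[OF \<open>card B' < card B\<close> V' TV' _ B'(3)])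
      show "finite B'" using fin by simp
      show "cinner (T x) y = cinner x (T y)" if "x \<in> V'" "y \<in> V'" for x y
        using that by (intro sym) (simp_all add: V'_def)
    qed
    then obtain F where F: "F \<subseteq> V'" "\<And>f g. f \<in> F \<Longrightarrow> g \<in> F \<Longrightarrow> cinner f g = (if f = g then 1 else 0)"
        "\<And>f. f \<in> F \<Longrightarrow> \<exists>r. T f = complex_of_real r *\<^sub>C f" "cspan F = V'"
      by metis
    have Ff: "cinner g f = 0" "cinner f g = 0" "g \<noteq> f" if "g \<in> F" for g
      using that F(1) ff cinner_commute[of f g] by (auto simp: V'_def)
    show ?thesis
    proof (intro exI[of _ "insert f F"] conjI ballI)
      show "insert f F \<subseteq> V" using f F(1) by (auto simp: V'_def)
      show "cinner g g' = (if g = g' then 1 else 0)" if "g \<in> insert f F" "g' \<in> insert f F" for g g'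
        using that F(2)[of g g'] Ff[of g] Ff[of g'] ff by auto
      show "\<exists>r. T g = complex_of_real r *\<^sub>C g" if "g \<in> insert f F" for g
        using that F(3) f(2) r by auto
      show "cspan (insert f F) = V"
      proof
        show "cspan (insert f F) \<subseteq> V"
          using f(1) F(1) V(1) by (intro complex_vector.span_minimal) (auto simp: V'_def)
        show "V \<subseteq> cspan (insert f F)"
        proof
          fix x assume x: "x \<in> V"
          define y where "y = x - cinner x f *\<^sub>C f"
          have "y \<in> V'"
            unfolding V'_def y_def using x f(1) ff
            by (auto simp: cinner_diff_left cinner_scaleC_left
                intro!: complex_vector.subspace_diff[OF V(1)] complex_vector.subspace_scale[OF V(1)])
          hence "y \<in> cspan (insert f F)"
            using F(4) complex_vector.span_mono[of F "insert f F"] by blast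
          moreover have "cinner x f *\<^sub>C f \<in> cspan (insert f F)"
            by (intro complex_vector.span_scale complex_vector.span_base) simp
          ultimately have "y + cinner x f *\<^sub>C f \<in> cspan (insert f F)"
            by (rule complex_vector.span_add)
          thus "x \<in> cspan (insert f F)" by (simp add: y_def)
        qed
      qed
    qed
  qed
qed

definition symmetric_operator :: "'a::euclidean_space operator \<Rightarrow> bool"
  where "symmetric_operator A \<longleftrightarrow> (\<forall>(v, w)\<in>A. \<forall>(v', w')\<in>A. cinner w v' = cinner v w')"

lemma symmetric_operatorD:
  "symmetric_operator A \<Longrightarrow> (v, w) \<in> A \<Longrightarrow> (v', w') \<in> A \<Longrightarrow> cinner w v' = cinner v w'"
  unfolding symmetric_operator_def by fastforce

lemma operator_lin_comb:
  fixes A :: "'a::euclidean_space operator"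
  assumes "csubspace A" and "\<And>i. i \<in> F \<Longrightarrow> (a i, b i) \<in> A"
  shows "(\<Sum>i\<in>F. c i *\<^sub>C a i, \<Sum>i\<in>F. c i *\<^sub>C b i) \<in> A"
proof -
  have "(\<Sum>i\<in>F. c i *\<^sub>C (a i, b i)) \<in> A"
    by (intro complex_vector.subspace_sum[OF assms(1)] complex_vector.subspace_scale[OF assms(1)] assms(2))
  thus ?thesis by (simp add: scaleC_prod_def sum_prod)
qed

context orthonormal_family
begin

text \<open>
  The level sets of \<open>l\<close> cut \<open>K\<close> into finite-dimensional blocks on which \<open>A\<close> is a scalar and which
  \<open>C\<close> maps to themselves.  Diagonalizing \<open>C\<close> in each block gives one orthonormal family that consists
  of eigenvectors of both operators and still spans \<open>K\<close>, so that both closures are diagonal in it.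
\<close>

theorem simultaneous_diagonalization:
  assumes A: "A \<subseteq> K \<times> K" "csubspace A" "symmetric_operator A"
    and C: "C \<subseteq> K \<times> K" "csubspace C" "symmetric_operator C"
    and eig: "\<And>i. i \<in> I \<Longrightarrow> (e i, complex_of_real (l i) *\<^sub>C e i) \<in> A"
    and block: "\<And>i. i \<in> I \<Longrightarrow> (e i, c i) \<in> C"
      "\<And>i. i \<in> I \<Longrightarrow> c i \<in> cspan (e ` {j \<in> I. l j = l i})"
    and fin: "\<And>x. finite {j \<in> I. l j = x}"
  shows "closure A = diag_op l" "self_adjoint K (closure C)" "operators_commute K (closure A) (closure C)"
proof -
  show "closure A = diag_op l"
  proof (rule closure_eq_diag_op[OF A(1,2) _ eig])
    fix v w i assume "(v, w) \<in> A" "i \<in> I"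
    thus "cinner w (e i) = complex_of_real (l i) * cinner v (e i)"
      using symmetric_operatorD[OF A(3) _ eig] by (simp add: cinner_scaleC_right)
  qed
  define L where "L = (\<lambda>x. {j \<in> I. l j = x})"
  define W where "W = (\<lambda>x. cspan (e ` L x))"
  \<comment> \<open>On the block \<open>W x\<close> this is the operator \<open>C\<close>, extended to a linear map on the whole space.\<close>
  define T where "T = (\<lambda>x w. \<Sum>i\<in>L x. cinner w (e i) *\<^sub>C c i)"
  have L: "finite (L x)" "L x \<subseteq> I" for x using fin by (auto simp: L_def)
  have W_sub: "csubspace (W x)" for x unfolding W_def by simp
  have W_fourier: "fourier (L x) w = w" if "w \<in> W x" for w x
    using fourier_eq_self[OF L] that by (simp add: W_def)
  have T_C: "(w, T x w) \<in> C" if "w \<in> W x" for w x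
  proof -
    have "(fourier (L x) w, T x w) \<in> C"
      unfolding fourier_def T_def by (rule operator_lin_comb[OF C(2)]) (use L block in blast)
    thus ?thesis using that by (simp add: W_fourier)
  qed
  have W_A: "(w, complex_of_real x *\<^sub>C w) \<in> A" if "w \<in> W x" for w x
  proof -
    have "(fourier (L x) w, \<Sum>i\<in>L x. cinner w (e i) *\<^sub>C complex_of_real x *\<^sub>C e i) \<in> A"
      unfolding fourier_def by (rule operator_lin_comb[OF A(2)]) (use eig in \<open>auto simp: L_def\<close>)
    also have "(\<Sum>i\<in>L x. cinner w (e i) *\<^sub>C complex_of_real x *\<^sub>C e i) = complex_of_real x *\<^sub>C fourier (L x) w"
      by (simp add: fourier_def complex_vector.scale_sum_right scaleC_scaleC mult.commute)
    finally show ?thesis using that by (simp add: W_fourier)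
  qed
  have T_W: "T x w \<in> W x" for w x
    unfolding T_def W_def
    by (intro complex_vector.span_sum complex_vector.span_scale) (use block(2) in \<open>auto simp: L_def\<close>)
  have "\<exists>F \<subseteq> W x. (\<forall>f\<in>F. \<forall>g\<in>F. cinner f g = (if f = g then 1 else 0)) \<and>
      (\<forall>f\<in>F. \<exists>r. T x f = complex_of_real r *\<^sub>C f) \<and> cspan F = W x" for x
  proof (rule symmetric_eigenbasis[where B = "e ` L x"])
    show "cinner (T x v) w = cinner v (T x w)" if "v \<in> W x" "w \<in> W x" for v w
      by (rule symmetric_operatorD[OF C(3) T_C[OF that(1)] T_C[OF that(2)]])
  qed (use L W_sub T_W in \<open>auto simp: T_def W_def cinner_add_left cinner_scaleC_left scaleC_add_left
      sum.distrib complex_vector.scale_sum_right\<close>)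
  then obtain F where F: "\<And>x. F x \<subseteq> W x"
      "\<And>x f g. f \<in> F x \<Longrightarrow> g \<in> F x \<Longrightarrow> cinner f g = (if f = g then 1 else 0)"
      "\<And>x f. f \<in> F x \<Longrightarrow> \<exists>r. T x f = complex_of_real r *\<^sub>C f" "\<And>x. cspan (F x) = W x"
    by metis
  define E where "E = (\<Union>x. F x)"
  have W_orth: "cinner v w = 0" if "v \<in> W x" "w \<in> W y" "x \<noteq> y" for v w x y
  proof -
    have "cinner (e i) (e j) = 0" if "i \<in> L x" "j \<in> L y" for i j
      using that \<open>x \<noteq> y\<close> by (auto simp: L_def ortho)
    hence "cinner (fourier (L x) v) (fourier (L y) w) = 0"
      by (simp add: fourier_def cinner_sum_left cinner_sum_right cinner_scaleC_left cinner_scaleC_right)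
    thus ?thesis using that by (simp add: W_fourier)
  qed
  interpret E: orthonormal_family "\<lambda>f. f" E
  proof
    fix f g assume "f \<in> E" "g \<in> E"
    then obtain x y where xy: "f \<in> F x" "g \<in> F y" by (auto simp: E_def)
    show "cinner f g = (if f = g then 1 else 0)"
    proof (cases "x = y")
      case False
      hence "cinner f g = 0" using W_orth xy F(1) by blast
      moreover have "f \<noteq> g" using calculation F(2)[OF xy(1) xy(1)] by auto
      ultimately show ?thesis by simp
    qed (use xy F(2) in auto)
  qed
  have "cspan E = cspan (e ` I)"
  proof
    have "W x \<subseteq> cspan (e ` I)" for x
      unfolding W_def using L by (intro complex_vector.span_mono) auto
    hence "E \<subseteq> cspan (e ` I)" using F(1) by (auto simp: E_def)
    thus "cspan E \<subseteq> cspan (e ` I)" by (intro complex_vector.span_minimal) auto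
    have "e i \<in> cspan E" if "i \<in> I" for i
    proof -
      have "e i \<in> W (l i)" unfolding W_def by (rule complex_vector.span_base) (use that in \<open>auto simp: L_def\<close>)
      also have "W (l i) \<subseteq> cspan E" unfolding F(4)[symmetric] E_def by (intro complex_vector.span_mono) auto
      finally show ?thesis .
    qed
    thus "cspan (e ` I) \<subseteq> cspan E" by (intro complex_vector.span_minimal) auto
  qed
  hence EK: "E.K = K" by (simp add: E.K_def K_def)
  have "\<forall>f\<in>E. \<exists>r s. (f, complex_of_real r *\<^sub>C f) \<in> A \<and> (f, complex_of_real s *\<^sub>C f) \<in> C"
  proof
    fix f assume "f \<in> E"
    then obtain x where x: "f \<in> F x" by (auto simp: E_def)
    obtain s where "T x f = complex_of_real s *\<^sub>C f" using F(3)[OF x] by blast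
    thus "\<exists>r s. (f, complex_of_real r *\<^sub>C f) \<in> A \<and> (f, complex_of_real s *\<^sub>C f) \<in> C"
      using W_A[of f x] T_C[of f x] x F(1) by (metis subsetD)
  qed
  then obtain r s where rs: "\<And>f. f \<in> E \<Longrightarrow> (f, complex_of_real (r f) *\<^sub>C f) \<in> A"
      "\<And>f. f \<in> E \<Longrightarrow> (f, complex_of_real (s f) *\<^sub>C f) \<in> C"
    by metis
  have cA: "closure A = E.diag_op r"
  proof (rule E.closure_eq_diag_op[OF A(1)[folded EK] A(2) _ rs(1)])
    fix v w f assume "(v, w) \<in> A" "f \<in> E"
    thus "cinner w f = complex_of_real (r f) * cinner v f"
      using symmetric_operatorD[OF A(3) _ rs(1)] by (simp add: cinner_scaleC_right)
  qed
  have cC: "closure C = E.diag_op s"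
  proof (rule E.closure_eq_diag_op[OF C(1)[folded EK] C(2) _ rs(2)])
    fix v w f assume "(v, w) \<in> C" "f \<in> E"
    thus "cinner w f = complex_of_real (s f) * cinner v f"
      using symmetric_operatorD[OF C(3) _ rs(2)] by (simp add: cinner_scaleC_right)
  qed
  show "self_adjoint K (closure C)"
    using E.self_adjoint_diag_op[of s] by (simp add: EK cC)
  show "operators_commute K (closure A) (closure C)"
    using E.diag_ops_commute[of r s] by (simp add: EK cA cC)
qed

end

section \<open>Schwartz functions\<close>

text \<open>
  The Schwartz functions form the largest class of rapidly decreasing differentiable functions that
  is closed under partial derivatives.  Exhibiting any such class avoids formulas for iterated
  derivatives.
\<close>

lemma schwartz_coinduct [consumes 1, case_names differentiable bounded partial]:
  assumes "f \<in> S"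
    and "\<And>f x. f \<in> S \<Longrightarrow> f differentiable at x"
    and "\<And>f k. f \<in> S \<Longrightarrow> \<exists>C. \<forall>x. norm x ^ k * cmod (f x) \<le> C"
    and "\<And>f b. f \<in> S \<Longrightarrow> b \<in> Basis \<Longrightarrow> partial b f \<in> S"
  shows "schwartz f"
  unfolding schwartz_def
proof (intro ballI conjI allI)
  fix bs :: "'a list" assume "bs \<in> lists Basis"
  hence S: "foldr partial bs f \<in> S"
    by (induction bs) (auto simp: assms(1,4))
  show "foldr partial bs f differentiable at x" for x using S assms(2) by blast
  show "bounded (range (\<lambda>x. norm x ^ k * cmod (foldr partial bs f x)))" for k
    using assms(3)[OF S, of k] unfolding bounded_iff by auto
qed

lemma schwartz_differentiable: "schwartz f \<Longrightarrow> f differentiable at x"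
  unfolding schwartz_def by (metis foldr.simps(1) id_apply lists.Nil)

lemma schwartz_bounded: "schwartz f \<Longrightarrow> \<exists>C. \<forall>x. norm x ^ k * cmod (f x) \<le> C"
  unfolding schwartz_def
  by (drule bspec[of _ _ "[]"]) (auto simp: bounded_iff)

lemma schwartz_partial:
  assumes "schwartz f" "b \<in> Basis" shows "schwartz (partial b f)"
  unfolding schwartz_def
proof
  fix bs :: "'a list" assume "bs \<in> lists Basis"
  hence "bs @ [b] \<in> lists Basis" using assms by simp
  from bspec[OF assms(1)[unfolded schwartz_def] this]
  show "(\<forall>x. foldr partial bs (partial b f) differentiable at x) \<and>
      (\<forall>k. bounded (range (\<lambda>x. norm x ^ k * cmod (foldr partial bs (partial b f) x))))"
    by simp
qed

lemma partial_eqI: "(f has_derivative D) (at x) \<Longrightarrow> partial b f x = D b"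
  unfolding partial_def by (metis frechet_derivative_at)

lemma differentiable_has_derivative_partial:
  "f differentiable at x \<Longrightarrow> \<exists>D. (f has_derivative D) (at x) \<and> (\<forall>b. D b = partial b f x)"
  unfolding partial_def using frechet_derivative_works by blast

lemma partial_add:
  "f differentiable at x \<Longrightarrow> g differentiable at x \<Longrightarrow>
    partial b (\<lambda>x. f x + g x) x = partial b f x + partial b g x"
  unfolding partial_def
  by (subst frechet_derivative_at[symmetric, OF has_derivative_add]) (auto simp: frechet_derivative_works)

lemma differentiable_coord: "(\<lambda>x. complex_of_real (inner x c)) differentiable at x"
proof (rule differentiableI)
  show "((\<lambda>x. complex_of_real (inner x c)) has_derivative (\<lambda>t. complex_of_real (inner t c))) (at x)"
    by (intro has_derivative_of_real has_derivative_inner_left has_derivative_ident)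
qed

lemma partial_coord:
  fixes f :: "'a::euclidean_space \<Rightarrow> complex"
  assumes "f differentiable at x"
  shows "partial b (\<lambda>x. complex_of_real (inner x c) * f x) x
    = complex_of_real (inner b c) * f x + complex_of_real (inner x c) * partial b f x"
proof -
  obtain D where D: "(f has_derivative D) (at x)" "\<And>b. D b = partial b f x"
    using differentiable_has_derivative_partial[OF assms] by blast
  have "((\<lambda>x. complex_of_real (inner x c) * f x) has_derivative
      (\<lambda>t. complex_of_real (inner x c) * D t + complex_of_real (inner t c) * f x)) (at x)"
    by (intro has_derivative_mult D has_derivative_of_real has_derivative_inner_left has_derivative_ident)
  thus ?thesis by (simp add: partial_eqI D)
qed

lemma partial_scale:
  "f differentiable at x \<Longrightarrow> partial b (\<lambda>x. c * f x) x = c * partial b f x"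
  by (metis differentiable_has_derivative_partial has_derivative_mult_right partial_eqI)

lemma schwartz_add:
  assumes "schwartz f" "schwartz g" shows "schwartz (\<lambda>x. f x + g x)"
proof -
  have "(\<lambda>x. f x + g x) \<in> {\<lambda>x. f x + g x | f g. schwartz f \<and> schwartz g}" using assms by blast
  thus ?thesis
  proof (induct rule: schwartz_coinduct)
    case (differentiable f x)
    thus ?case using schwartz_differentiable by (auto intro!: differentiable_add)
  next
    case (bounded F k)
    then obtain f g where F: "F = (\<lambda>x. f x + g x)" "schwartz f" "schwartz g" by blast
    obtain C D where CD: "\<And>x. norm x ^ k * cmod (f x) \<le> C" "\<And>x. norm x ^ k * cmod (g x) \<le> D"
      using schwartz_bounded F by metis
    have "norm x ^ k * cmod (F x) \<le> C + D" for x
    proof -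
      have "norm x ^ k * cmod (F x) \<le> norm x ^ k * (cmod (f x) + cmod (g x))"
        unfolding F by (intro mult_left_mono norm_triangle_ineq) simp
      also have "\<dots> \<le> C + D" using CD[of x] by (simp add: distrib_left)
      finally show ?thesis .
    qed
    thus ?case by blast
  next
    case (partial F b)
    then obtain f g where F: "F = (\<lambda>x. f x + g x)" "schwartz f" "schwartz g" by blast
    hence "partial b F = (\<lambda>x. partial b f x + partial b g x)"
      by (auto simp: partial_add schwartz_differentiable)
    thus ?case using F schwartz_partial partial(2) by blast
  qed
qed

lemma schwartz_scale:
  assumes "schwartz f" shows "schwartz (\<lambda>x. c * f x)"
proof -
  have "(\<lambda>x. c * f x) \<in> {\<lambda>x. c * f x | f. schwartz f}" using assms by blast
  thus ?thesis
  proof (induct rule: schwartz_coinduct)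
    case (differentiable f x)
    thus ?case using schwartz_differentiable by (auto intro!: differentiable_mult)
  next
    case (bounded F k)
    then obtain f where F: "F = (\<lambda>x. c * f x)" "schwartz f" by blast
    obtain C where C: "\<And>x. norm x ^ k * cmod (f x) \<le> C"
      using schwartz_bounded F by metis
    have "norm x ^ k * cmod (F x) \<le> cmod c * C" for x
      using mult_left_mono[OF C[of x], of "cmod c"] by (simp add: F norm_mult mult_ac)
    thus ?case by blast
  next
    case (partial F b)
    then obtain f where F: "F = (\<lambda>x. c * f x)" "schwartz f" by blast
    hence "partial b F = (\<lambda>x. c * partial b f x)"
      by (auto simp: partial_scale schwartz_differentiable)
    thus ?case using F schwartz_partial partial(2) by blast
  qed
qed

text \<open>
  A class that contains the products \<open>x\<^sub>c f\<close> and is closed under differentiation must contain the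
  sums \<open>x\<^sub>c f + g\<close>, because of the term that the product rule adds.
\<close>

lemma schwartz_coord:
  fixes f :: "'a::euclidean_space \<Rightarrow> complex"
  assumes "schwartz f" shows "schwartz (\<lambda>x. complex_of_real (inner x c) * f x)"
proof -
  let ?S = "{\<lambda>x. complex_of_real (inner x c) * f x + g x | f g. schwartz f \<and> schwartz g}"
  have "schwartz (\<lambda>x::'a. 0)" using schwartz_scale[OF assms, of 0] by simp
  hence "(\<lambda>x. complex_of_real (inner x c) * f x) \<in> ?S"
    using assms by (intro CollectI exI[of _ f] exI[of _ "\<lambda>x. 0"]) simp
  thus ?thesis
  proof (induct rule: schwartz_coinduct)
    case (differentiable F x)
    then obtain f g where F: "F = (\<lambda>x. complex_of_real (inner x c) * f x + g x)" "schwartz f" "schwartz g"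
      by blast
    have "(\<lambda>x. complex_of_real (inner x c)) differentiable at x"
      by (rule differentiable_coord)
    thus ?case unfolding F using F schwartz_differentiable
      by (intro differentiable_add differentiable_mult) auto
  next
    case (bounded F k)
    then obtain f g where F: "F = (\<lambda>x. complex_of_real (inner x c) * f x + g x)" "schwartz f" "schwartz g"
      by blast
    obtain C D where CD: "\<And>x. norm x ^ Suc k * cmod (f x) \<le> C" "\<And>x. norm x ^ k * cmod (g x) \<le> D"
      using schwartz_bounded F by metis
    have "norm x ^ k * cmod (F x) \<le> norm c * C + D" for x
    proof -
      have "cmod (F x) \<le> \<bar>inner x c\<bar> * cmod (f x) + cmod (g x)"
        unfolding F by (rule norm_triangle_le) (simp add: norm_mult)
      also have "\<dots> \<le> norm x * norm c * cmod (f x) + cmod (g x)"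
        by (intro add_right_mono mult_right_mono Cauchy_Schwarz_ineq2) simp
      finally have "norm x ^ k * cmod (F x) \<le> norm x ^ k * (norm x * norm c * cmod (f x) + cmod (g x))"
        by (intro mult_left_mono) simp_all
      also have "\<dots> = norm c * (norm x ^ Suc k * cmod (f x)) + norm x ^ k * cmod (g x)"
        by (simp add: algebra_simps)
      also have "\<dots> \<le> norm c * C + D" by (intro add_mono mult_left_mono CD) simp
      finally show ?thesis .
    qed
    thus ?case by blast
  next
    case (partial F b)
    then obtain f g where F: "F = (\<lambda>x. complex_of_real (inner x c) * f x + g x)" "schwartz f" "schwartz g"
      by blast
    have coord: "(\<lambda>x. complex_of_real (inner x c) * f x) differentiable at x" for x
    proof -
      have "(\<lambda>x. complex_of_real (inner x c)) differentiable at x"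
        by (rule differentiable_coord)
      thus ?thesis using F schwartz_differentiable by (intro differentiable_mult) auto
    qed
    have "partial b F = (\<lambda>x. complex_of_real (inner x c) * partial b f x +
        (complex_of_real (inner b c) * f x + partial b g x))"
      by (simp add: F(1) fun_eq_iff add.assoc partial_add[OF coord schwartz_differentiable[OF F(3)]]
          partial_coord[OF schwartz_differentiable[OF F(2)]])
    moreover have "schwartz (\<lambda>x. complex_of_real (inner b c) * f x + partial b g x)"
      by (intro schwartz_add schwartz_scale schwartz_partial F partial)
    ultimately show ?case using schwartz_partial[OF F(2) partial(2)]
      by (intro CollectI exI[of _ "partial b f"]
          exI[of _ "\<lambda>x. complex_of_real (inner b c) * f x + partial b g x"] conjI)
  qed
qed

lemma schwartz_continuous: "schwartz f \<Longrightarrow> continuous_on A f"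
  by (meson continuous_at_imp_continuous_on differentiable_imp_continuous_within schwartz_differentiable)

lemma schwartz_measurable: "schwartz f \<Longrightarrow> f \<in> borel_measurable borel"
  by (intro borel_measurable_continuous_onI schwartz_continuous)

text \<open>
  The exponent 2 makes the weight dominate the product of two one-dimensional weights
  \<open>1 + x\<^sup>2\<close>, which is what square integrability on the plane needs.
\<close>

lemma schwartz_decay:
  assumes "schwartz f"
  shows "\<exists>C. \<forall>x. cmod (f x) * (1 + (norm x)\<^sup>2)\<^sup>2 \<le> C"
proof -
  obtain C0 C2 C4 where C: "\<And>x. norm x ^ 0 * cmod (f x) \<le> C0" "\<And>x. norm x ^ 2 * cmod (f x) \<le> C2"
      "\<And>x. norm x ^ 4 * cmod (f x) \<le> C4"
    using schwartz_bounded[OF assms] by metis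
  have "cmod (f x) * (1 + (norm x)\<^sup>2)\<^sup>2 \<le> C0 + 2 * C2 + C4" for x
  proof -
    have "cmod (f x) * (1 + (norm x)\<^sup>2)\<^sup>2
        = norm x ^ 0 * cmod (f x) + 2 * (norm x ^ 2 * cmod (f x)) + norm x ^ 4 * cmod (f x)"
      by (simp add: power2_eq_square power4_eq_xxxx algebra_simps)
    also have "\<dots> \<le> C0 + 2 * C2 + C4" by (intro add_mono mult_left_mono C) simp
    finally show ?thesis .
  qed
  thus ?thesis by blast
qed

lemma square_integrable_bound:
  assumes "square_integrable g" "f \<in> borel_measurable borel" "\<And>x. cmod (f x) \<le> C * cmod (g x)"
  shows "square_integrable f"
  unfolding square_integrable_def
proof
  have "integrable lborel (\<lambda>x. C\<^sup>2 * (cmod (g x))\<^sup>2)"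
    using assms(1) by (simp add: square_integrable_def)
  thus "integrable lborel (\<lambda>x. (cmod (f x))\<^sup>2)"
  proof (rule Bochner_Integration.integrable_bound)
    show "AE x in lborel. norm ((cmod (f x))\<^sup>2) \<le> norm (C\<^sup>2 * (cmod (g x))\<^sup>2)"
      using power_mono[OF assms(3), of _ 2] by (auto simp: power_mult_distrib)
  qed (use assms(2) in measurable)
qed (use assms in simp)

abbreviation cauchy_weight :: "real \<Rightarrow> complex"
  where "cauchy_weight u \<equiv> complex_of_real (inverse (1 + u\<^sup>2))"

lemma square_integrable_cauchy_weight: "square_integrable cauchy_weight"
  unfolding square_integrable_def
proof
  have "integrable lborel (\<lambda>x::real. inverse (1 + x\<^sup>2))"
    using integrable_inverse_1_plus_square by (simp add: set_integrable_def einterval_def)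
  thus "integrable lborel (\<lambda>x. (cmod (cauchy_weight x))\<^sup>2)"
  proof (rule Bochner_Integration.integrable_bound)
    show "AE x in lborel. norm ((cmod (cauchy_weight x))\<^sup>2) \<le> norm (inverse (1 + x\<^sup>2))"
    proof (rule AE_I2)
      fix x :: real
      have "inverse (1 + x\<^sup>2) \<le> 1" "0 \<le> inverse (1 + x\<^sup>2)"
        by (auto intro!: inverse_le_1_iff[THEN iffD2])
      hence "(inverse (1 + x\<^sup>2))\<^sup>2 \<le> inverse (1 + x\<^sup>2)"
        by (simp add: power2_eq_square mult_left_le)
      thus "norm ((cmod (cauchy_weight x))\<^sup>2) \<le> norm (inverse (1 + x\<^sup>2))"
        by (simp only: norm_of_real real_norm_def power2_abs abs_of_nonneg[OF \<open>0 \<le> inverse (1 + x\<^sup>2)\<close>]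
            abs_of_nonneg[OF zero_le_power2])
    qed
  qed measurable
qed measurable

lemma square_integrable_tensor:
  assumes "square_integrable f" "square_integrable g"
  shows "square_integrable (\<lambda>p. f (fst p) * g (snd p))"
proof -
  have "\<And>f f' g g'. L2_rel f f' \<Longrightarrow> L2_rel g g' \<Longrightarrow>
      L2_rel (\<lambda>p. f (fst p) * g (snd p)) (\<lambda>p. f' (fst p) * g' (snd p))"
    using tensor.rsp unfolding rel_fun_def by blast
  from this[OF L2_rel_refl[OF assms(1)] L2_rel_refl[OF assms(2)]] show ?thesis
    by (simp add: L2_rel_def)
qed

lemma schwartz_square_integrable_real:
  fixes f :: "real \<Rightarrow> complex"
  assumes "schwartz f" shows "square_integrable f"
proof -
  obtain C where C: "\<And>x. cmod (f x) * (1 + (norm x)\<^sup>2)\<^sup>2 \<le> C" using schwartz_decay[OF assms] by blast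
  have "cmod (f x) \<le> C * cmod (cauchy_weight x)" for x
  proof -
    have "cmod (f x) * (1 + x\<^sup>2) \<le> cmod (f x) * (1 + x\<^sup>2)\<^sup>2"
      by (intro mult_left_mono self_le_power[of "1 + x\<^sup>2" 2, simplified]) auto
    also have "\<dots> \<le> C" using C[of x] by simp
    finally have "cmod (f x) * (1 + x\<^sup>2) \<le> C" .
    moreover have "0 < 1 + x\<^sup>2" by (simp add: add_pos_nonneg)
    ultimately have "cmod (f x) \<le> C / (1 + x\<^sup>2)" by (simp only: pos_le_divide_eq)
    also have "\<dots> = C * cmod (cauchy_weight x)"
      by (simp only: norm_of_real abs_of_pos[OF positive_imp_inverse_positive[OF \<open>0 < 1 + x\<^sup>2\<close>]] divide_inverse)
    finally show ?thesis .
  qed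
  thus ?thesis
    by (rule square_integrable_bound[OF square_integrable_cauchy_weight schwartz_measurable[OF assms]])
qed

lemma schwartz_square_integrable_plane:
  fixes f :: "plane \<Rightarrow> complex"
  assumes "schwartz f" shows "square_integrable f"
proof -
  obtain C where C: "\<And>x. cmod (f x) * (1 + (norm x)\<^sup>2)\<^sup>2 \<le> C" using schwartz_decay[OF assms] by blast
  have "cmod (f p) \<le> C * cmod (cauchy_weight (fst p) * cauchy_weight (snd p))" for p
  proof -
    have "(1 + (fst p)\<^sup>2) * (1 + (snd p)\<^sup>2) \<le> (1 + (norm p)\<^sup>2) * (1 + (norm p)\<^sup>2)"
      by (intro mult_mono) (auto simp: norm_prod_def)
    hence "cmod (f p) * ((1 + (fst p)\<^sup>2) * (1 + (snd p)\<^sup>2)) \<le> cmod (f p) * (1 + (norm p)\<^sup>2)\<^sup>2"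
      by (intro mult_left_mono) (auto simp: power2_eq_square)
    also note C[of p]
    finally have "cmod (f p) * ((1 + (fst p)\<^sup>2) * (1 + (snd p)\<^sup>2)) \<le> C" .
    moreover have "0 < (1 + (fst p)\<^sup>2) * (1 + (snd p)\<^sup>2)"
      by (intro mult_pos_pos) (auto simp: add_pos_nonneg)
    ultimately have "cmod (f p) \<le> C / ((1 + (fst p)\<^sup>2) * (1 + (snd p)\<^sup>2))"
      by (simp add: pos_le_divide_eq)
    also have "\<dots> = C * cmod (cauchy_weight (fst p) * cauchy_weight (snd p))"
      by (simp add: norm_mult norm_inverse divide_inverse del: of_real_add)
    finally show ?thesis .
  qed
  thus ?thesis
    by (rule square_integrable_bound[OF square_integrable_tensor[OF square_integrable_cauchy_weight
        square_integrable_cauchy_weight] schwartz_measurable[OF assms]])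
qed

section \<open>Integration by parts\<close>

lemma integral_derivative_eq_0:
  fixes F f :: "real \<Rightarrow> complex"
  assumes F: "\<And>x. (F has_vector_derivative f x) (at x)" and cont: "continuous_on UNIV f"
    and int: "integrable lborel f" and lim: "(F \<longlongrightarrow> 0) at_top" "(F \<longlongrightarrow> 0) at_bot"
  shows "(LINT x|lborel. f x) = 0"
proof -
  have "(LBINT x=-\<infinity>..\<infinity>. f x) = 0 - 0"
  proof (rule interval_integral_FTC_integrable[where F = F])
    show "isCont f x" for x using cont by (simp add: continuous_on_eq_continuous_at)
    show "set_integrable lborel (einterval (-\<infinity>) \<infinity>) f"
      using int by (simp add: set_integrable_def einterval_def)
  qed (use F lim in \<open>auto simp: ereal_tendsto_simps\<close>)
  thus ?thesis
    by (simp add: interval_lebesgue_integral_def einterval_def set_lebesgue_integral_def)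
qed

lemma decay_lims:
  "((\<lambda>x::real. C / (1 + x\<^sup>2)) \<longlongrightarrow> 0) at_top" "((\<lambda>x::real. C / (1 + x\<^sup>2)) \<longlongrightarrow> 0) at_bot"
  by real_asymp+

lemma schwartz_line_decay:
  fixes f :: "'a::euclidean_space \<Rightarrow> complex"
  assumes "schwartz f" "\<And>t. \<bar>t\<bar> \<le> norm (c t)"
  shows "\<exists>C. \<forall>t. cmod (f (c t)) \<le> C / (1 + t\<^sup>2)"
proof -
  obtain C where C: "\<And>x. cmod (f x) * (1 + (norm x)\<^sup>2)\<^sup>2 \<le> C" using schwartz_decay[OF assms(1)] by blast
  have "cmod (f (c t)) \<le> C / (1 + t\<^sup>2)" for t
  proof -
    have "1 + t\<^sup>2 \<le> 1 + (norm (c t))\<^sup>2"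
      using power_mono[OF assms(2)[of t], of 2] by simp
    also have "\<dots> \<le> (1 + (norm (c t))\<^sup>2)\<^sup>2" by (rule self_le_power) auto
    finally have "cmod (f (c t)) * (1 + t\<^sup>2) \<le> cmod (f (c t)) * (1 + (norm (c t))\<^sup>2)\<^sup>2"
      by (rule mult_left_mono) simp
    also have "\<dots> \<le> C" by (rule C)
    finally show ?thesis by (simp add: pos_le_divide_eq add_pos_nonneg)
  qed
  thus ?thesis by blast
qed

text \<open>
  The integrand is the derivative of \<open>f (c t) * cnj (g (c t))\<close>, which decays at both ends.  On the
  line \<open>c\<close> is the identity; on the plane it parametrizes the lines parallel to an axis, so that
  Fubini reduces integration by parts there to this lemma.
\<close>

lemma schwartz_product_line:
  fixes f g :: "'a::euclidean_space \<Rightarrow> complex"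
  assumes f: "schwartz f" and g: "schwartz g" and b: "b \<in> Basis"
    and c: "\<And>t. \<bar>t\<bar> \<le> norm (c t)" "\<And>t. (c has_derivative (\<lambda>s. s *\<^sub>R b)) (at t)"
    and int: "integrable lborel (\<lambda>t. partial b f (c t) * cnj (g (c t)) + f (c t) * cnj (partial b g (c t)))"
  shows "(LINT t|lborel. partial b f (c t) * cnj (g (c t)) + f (c t) * cnj (partial b g (c t))) = 0"
proof (rule integral_derivative_eq_0[OF _ _ int])
  fix t
  obtain D E where D: "(f has_derivative D) (at (c t))" "\<And>b. D b = partial b f (c t)"
      and E: "(g has_derivative E) (at (c t))" "\<And>b. E b = partial b g (c t)"
    using differentiable_has_derivative_partial schwartz_differentiable f g by metis
  have "((\<lambda>t. f (c t) * cnj (g (c t))) has_derivative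
      (\<lambda>s. f (c t) * cnj (E (s *\<^sub>R b)) + D (s *\<^sub>R b) * cnj (g (c t)))) (at t)"
    by (intro has_derivative_mult has_derivative_cnj has_derivative_compose[OF c(2) D(1)]
        has_derivative_compose[OF c(2) E(1)])
  thus "((\<lambda>t. f (c t) * cnj (g (c t))) has_vector_derivative
      partial b f (c t) * cnj (g (c t)) + f (c t) * cnj (partial b g (c t))) (at t)"
    unfolding has_vector_derivative_def
    by (rule has_derivative_eq_rhs)
      (use linear_scale[OF has_derivative_linear[OF D(1)]] linear_scale[OF has_derivative_linear[OF E(1)]]
        D(2) E(2) in \<open>auto simp: fun_eq_iff algebra_simps scaleR_conv_of_real\<close>)
next
  have "continuous_on UNIV c"
    using c(2) by (meson continuous_at_imp_continuous_on has_derivative_continuous)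
  hence "continuous_on UNIV (\<lambda>t. h (c t))" if "schwartz h" for h :: "'a \<Rightarrow> complex"
    by (rule continuous_on_compose2[OF schwartz_continuous[OF that, of UNIV]]) auto
  thus "continuous_on UNIV (\<lambda>t. partial b f (c t) * cnj (g (c t)) + f (c t) * cnj (partial b g (c t)))"
    by (intro continuous_intros) (auto intro: f g schwartz_partial b)
next
  obtain C where C: "\<And>t. cmod (f (c t)) \<le> C / (1 + t\<^sup>2)"
    using schwartz_line_decay[OF f c(1)] by blast
  obtain C' where C': "\<And>x. norm x ^ 0 * cmod (g x) \<le> C'" using schwartz_bounded[OF g] by metis
  have bound: "norm (f (c t) * cnj (g (c t))) \<le> (C * C') / (1 + t\<^sup>2)" for t
  proof -
    have "norm (f (c t) * cnj (g (c t))) \<le> (C / (1 + t\<^sup>2)) * C'"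
      unfolding norm_mult complex_mod_cnj using C[of t] C'[of "c t"] by (intro mult_mono) (auto intro: order_trans[OF _ C])
    thus ?thesis by simp
  qed
  show "((\<lambda>t. f (c t) * cnj (g (c t))) \<longlongrightarrow> 0) at_top" "((\<lambda>t. f (c t) * cnj (g (c t))) \<longlongrightarrow> 0) at_bot"
    by (rule Lim_null_comparison[OF always_eventually decay_lims(1)], use bound in blast)
       (rule Lim_null_comparison[OF always_eventually decay_lims(2)], use bound in blast)
qed

lemma integrable_product:
  assumes "square_integrable f" "square_integrable f'" "square_integrable g" "square_integrable g'"
  shows "integrable lborel (\<lambda>x. f' x * cnj (g x) + f x * cnj (g' x))"
  by (intro Bochner_Integration.integrable_add square_integrable_mult_cnj assms)

lemma integration_by_parts_real:
  fixes f g :: "real \<Rightarrow> complex"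
  assumes f: "schwartz f" and g: "schwartz g"
  shows "cinner (abs_L2 (partial 1 f)) (abs_L2 g) = - cinner (abs_L2 f) (abs_L2 (partial 1 g))"
proof -
  note sq = schwartz_square_integrable_real
  have p: "schwartz (partial 1 f)" "schwartz (partial 1 g)" by (auto intro!: schwartz_partial f g)
  have "(LINT t|lborel. partial 1 f t * cnj (g t) + f t * cnj (partial 1 g t)) = 0"
    by (rule schwartz_product_line[OF f g, where c = "\<lambda>t. t"])
      (auto intro!: integrable_product sq f g p derivative_eq_intros)
  moreover have "(LINT t|lborel. partial 1 f t * cnj (g t) + f t * cnj (partial 1 g t))
      = (LINT t|lborel. partial 1 f t * cnj (g t)) + (LINT t|lborel. f t * cnj (partial 1 g t))"
    by (intro Bochner_Integration.integral_add square_integrable_mult_cnj sq f g p)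
  ultimately show ?thesis
    by (simp add: cinner_abs_L2 sq f g p eq_neg_iff_add_eq_0)
qed

lemma integration_by_parts_plane:
  fixes f g :: "plane \<Rightarrow> complex"
  assumes f: "schwartz f" and g: "schwartz g" and b: "b \<in> Basis"
  shows "cinner (abs_L2 (partial b f)) (abs_L2 g) = - cinner (abs_L2 f) (abs_L2 (partial b g))"
proof -
  note sq = schwartz_square_integrable_plane
  have p: "schwartz (partial b f)" "schwartz (partial b g)" by (auto intro!: schwartz_partial f g b)
  define D where "D = (\<lambda>p. partial b f p * cnj (g p) + f p * cnj (partial b g p))"
  have "integrable lborel D"
    unfolding D_def by (intro integrable_product sq f g p)
  hence int: "integrable (lborel \<Otimes>\<^sub>M lborel) (\<lambda>(x, y). D (x, y))" by (simp add: lborel_prod)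
  have eq: "(LINT p|lborel. D p) = (LINT p|(lborel \<Otimes>\<^sub>M lborel). (case p of (x, y) \<Rightarrow> D (x, y)))"
    by (simp add: lborel_prod)
  consider "b = e1" | "b = e2" using b by (auto simp: Basis_prod_def)
  hence "(LINT p|lborel. D p) = 0"
  proof cases
    case 1
    have "(LINT p|lborel. D p) = (LINT y|lborel. LINT x|lborel. D (x, y))"
      unfolding eq by (rule lborel_pair.integral_snd[OF int, symmetric])
    also have "\<dots> = 0"
    proof (rule integral_eq_zero_AE)
      show "AE y in lborel. (LINT x|lborel. D (x, y)) = 0"
        using lborel_pair.AE_integrable_snd[OF int]
      proof eventually_elim
        case (elim y)
        show ?case
          unfolding D_def
          by (rule schwartz_product_line[OF f g b, where c = "\<lambda>x. (x, y)"])
            (use elim in \<open>auto simp: D_def 1 norm_prod_def real_le_rsqrt intro!: derivative_eq_intros\<close>)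
      qed
    qed
    finally show ?thesis .
  next
    case 2
    have "(LINT p|lborel. D p) = (LINT x|lborel. LINT y|lborel. D (x, y))"
      unfolding eq by (rule lborel_pair.integral_fst[OF int, symmetric])
    also have "\<dots> = 0"
    proof (rule integral_eq_zero_AE)
      show "AE x in lborel. (LINT y|lborel. D (x, y)) = 0"
        using lborel_pair.AE_integrable_fst[OF int]
      proof eventually_elim
        case (elim x)
        show ?case
          unfolding D_def
          by (rule schwartz_product_line[OF f g b, where c = "\<lambda>y. (x, y)"])
            (use elim in \<open>auto simp: D_def 2 norm_prod_def real_le_rsqrt intro!: derivative_eq_intros\<close>)
      qed
    qed
    finally show ?thesis .
  qed
  moreover have "(LINT p|lborel. D p)
      = (LINT p|lborel. partial b f p * cnj (g p)) + (LINT p|lborel. f p * cnj (partial b g p))"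
    unfolding D_def by (intro Bochner_Integration.integral_add square_integrable_mult_cnj sq f g p)
  ultimately show ?thesis
    by (simp add: cinner_abs_L2 sq f g p eq_neg_iff_add_eq_0)
qed

section \<open>Symmetry of the differential operators\<close>

definition coord_mult :: "'a::euclidean_space \<Rightarrow> ('a \<Rightarrow> complex) \<Rightarrow> 'a \<Rightarrow> complex"
  where "coord_mult c f x = complex_of_real (inner x c) * f x"

lemma schwartz_coord_mult: "schwartz f \<Longrightarrow> schwartz (coord_mult c f)"
  unfolding coord_mult_def[abs_def] by (rule schwartz_coord)

lemma cinner_coord_mult:
  assumes "square_integrable f" "square_integrable g"
    "square_integrable (coord_mult c f)" "square_integrable (coord_mult c g)"
  shows "cinner (abs_L2 (coord_mult c f)) (abs_L2 g) = cinner (abs_L2 f) (abs_L2 (coord_mult c g))"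
  using assms by (simp add: cinner_abs_L2 coord_mult_def mult_ac)

lemma abs_L2_lin_comb:
  assumes "square_integrable f" "square_integrable g"
  shows "abs_L2 (\<lambda>x. a * f x + b * g x) = a *\<^sub>C abs_L2 f + b *\<^sub>C abs_L2 g"
  using assms by (simp add: abs_L2_scaleC abs_L2_add square_integrable_scale)

lemma schwartz_lin_comb: "schwartz f \<Longrightarrow> schwartz g \<Longrightarrow> schwartz (\<lambda>x. a * f x + b * g x)"
  by (intro schwartz_add schwartz_scale)

lemma symmetric_schwartz_op:
  assumes "\<And>f g. schwartz f \<Longrightarrow> schwartz g \<Longrightarrow>
    cinner (abs_L2 (D f)) (abs_L2 g) = cinner (abs_L2 f) (abs_L2 (D g))"
  shows "symmetric_operator (schwartz_op D)"
  using assms by (auto simp: symmetric_operator_def schwartz_op_def)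

lemma schwartz_partial_real: "schwartz f \<Longrightarrow> schwartz (partial (1::real) f)"
  by (rule schwartz_partial) auto

lemma oscillator_diff_altdef:
  "oscillator_diff h f = (\<lambda>u. - complex_of_real (h\<^sup>2 / 2) * partial 1 (partial 1 f) u
    + (1/2) * coord_mult 1 (coord_mult 1 f) u)"
  by (rule ext) (simp add: oscillator_diff_def coord_mult_def power2_eq_square)

lemma position_diff_altdef: "position_diff f = coord_mult 1 f"
  by (rule ext) (simp add: position_diff_def coord_mult_def)

lemma momentum_diff_altdef: "momentum_diff h f = (\<lambda>u. (complex_of_real h / \<i>) * partial 1 f u)"
  by (rule ext) (simp add: momentum_diff_def)

text \<open>
  Each derivative and each multiplication moves to the other argument, the former with a sign that
  cancels in pairs.
\<close>

lemma symmetric_oscillator: "symmetric_operator (schwartz_op (oscillator_diff h))"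
proof (rule symmetric_schwartz_op)
  fix f g :: "real \<Rightarrow> complex" assume fg: "schwartz f" "schwartz g"
  note s = schwartz_coord_mult schwartz_partial_real schwartz_square_integrable_real
  have osc: "abs_L2 (oscillator_diff h f) = (- complex_of_real (h\<^sup>2 / 2)) *\<^sub>C abs_L2 (partial 1 (partial 1 f))
      + (1/2) *\<^sub>C abs_L2 (coord_mult 1 (coord_mult 1 f))" if "schwartz f" for f :: "real \<Rightarrow> complex"
    unfolding oscillator_diff_altdef by (intro abs_L2_lin_comb s that)
  show "cinner (abs_L2 (oscillator_diff h f)) (abs_L2 g) = cinner (abs_L2 f) (abs_L2 (oscillator_diff h g))"
    by (simp add: osc fg cinner_simps
        integration_by_parts_real cinner_coord_mult s del: of_real_power of_real_divide)
qed

lemma symmetric_position: "symmetric_operator (schwartz_op position_diff)"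
  by (rule symmetric_schwartz_op) (simp add: position_diff_altdef cinner_coord_mult
      schwartz_coord_mult schwartz_square_integrable_real)

lemma abs_L2_momentum_diff:
  "schwartz f \<Longrightarrow> abs_L2 (momentum_diff h f) = (complex_of_real h / \<i>) *\<^sub>C abs_L2 (partial 1 f)"
  unfolding momentum_diff_altdef
  by (intro abs_L2_scaleC[symmetric] schwartz_square_integrable_real schwartz_partial_real)

lemma symmetric_momentum: "symmetric_operator (schwartz_op (momentum_diff h))"
  by (rule symmetric_schwartz_op)
    (simp add: abs_L2_momentum_diff cinner_simps integration_by_parts_real)

lemma e_Basis: "e1 \<in> Basis" "e2 \<in> Basis"
  by (auto simp: Basis_prod_def)

lemma a_op_altdef: "a_op h b f = (\<lambda>x. complex_of_real (h / sqrt (2 * h)) * partial b f x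
    + complex_of_real (1 / sqrt (2 * h)) * coord_mult b f x)"
  by (rule ext) (simp add: a_op_def coord_mult_def add_divide_distrib)

lemma a_adj_altdef: "a_adj h b f = (\<lambda>x. complex_of_real (- h / sqrt (2 * h)) * partial b f x
    + complex_of_real (1 / sqrt (2 * h)) * coord_mult b f x)"
  by (rule ext) (simp add: a_adj_def coord_mult_def diff_divide_distrib)

lemma schwartz_a: 
  assumes "schwartz f" "b \<in> Basis"
  shows "schwartz (a_op h b f)" "schwartz (a_adj h b f)"
  unfolding a_op_altdef a_adj_altdef
  by (intro schwartz_lin_comb schwartz_partial schwartz_coord_mult assms)+

lemma cinner_a_op:
  assumes fg: "schwartz f" "schwartz g" and b: "b \<in> Basis"
  shows "cinner (abs_L2 (a_op h b f)) (abs_L2 g) = cinner (abs_L2 f) (abs_L2 (a_adj h b g))"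
proof -
  have sq: "square_integrable f" "square_integrable (partial b f)" "square_integrable (coord_mult b f)"
    if "schwartz f" for f
    by (intro schwartz_square_integrable_plane schwartz_partial schwartz_coord_mult that b)+
  have a: "abs_L2 (a_op h b f) = complex_of_real (h / sqrt (2 * h)) *\<^sub>C abs_L2 (partial b f)
      + complex_of_real (1 / sqrt (2 * h)) *\<^sub>C abs_L2 (coord_mult b f)"
    "abs_L2 (a_adj h b f) = complex_of_real (- h / sqrt (2 * h)) *\<^sub>C abs_L2 (partial b f)
      + complex_of_real (1 / sqrt (2 * h)) *\<^sub>C abs_L2 (coord_mult b f)" if "schwartz f" for f
    unfolding a_op_altdef a_adj_altdef by (intro abs_L2_lin_comb sq that)+
  show ?thesis
    by (simp add: a fg b sq cinner_simps integration_by_parts_plane cinner_coord_mult del: of_real_divide)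
qed

lemma cinner_a_adj:
  assumes "schwartz f" "schwartz g" "b \<in> Basis"
  shows "cinner (abs_L2 (a_adj h b f)) (abs_L2 g) = cinner (abs_L2 f) (abs_L2 (a_op h b g))"
  by (metis assms cinner_a_op cinner_commute)

lemma cinner_a_op_a_adj:
  assumes "schwartz f" "schwartz g" "b \<in> Basis" "c \<in> Basis"
  shows "cinner (abs_L2 (a_op h b (a_adj h c f))) (abs_L2 g) = cinner (abs_L2 f) (abs_L2 (a_op h c (a_adj h b g)))"
  by (simp add: assms cinner_a_op cinner_a_adj schwartz_a)

lemma sphere_diff_altdef:
  "x_diff h f = (\<lambda>x. complex_of_real (h / 2) * a_op h e1 (a_adj h e2 f) x
    + complex_of_real (h / 2) * a_op h e2 (a_adj h e1 f) x)"
  "y_diff h f = (\<lambda>x. (complex_of_real h / (2 * \<i>)) * a_op h e1 (a_adj h e2 f) x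
    + (- complex_of_real h / (2 * \<i>)) * a_op h e2 (a_adj h e1 f) x)"
  "z_diff h f = (\<lambda>x. complex_of_real (h / 2) * a_op h e1 (a_adj h e1 f) x
    + (- complex_of_real (h / 2)) * a_op h e2 (a_adj h e2 f) x)"
  by (auto simp: fun_eq_iff x_diff_def y_diff_def z_diff_def algebra_simps)

lemma abs_L2_sphere_diff:
  assumes "schwartz f"
  shows "abs_L2 (x_diff h f) = complex_of_real (h / 2) *\<^sub>C abs_L2 (a_op h e1 (a_adj h e2 f))
      + complex_of_real (h / 2) *\<^sub>C abs_L2 (a_op h e2 (a_adj h e1 f))"
    "abs_L2 (y_diff h f) = (complex_of_real h / (2 * \<i>)) *\<^sub>C abs_L2 (a_op h e1 (a_adj h e2 f))
      + (- complex_of_real h / (2 * \<i>)) *\<^sub>C abs_L2 (a_op h e2 (a_adj h e1 f))"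
    "abs_L2 (z_diff h f) = complex_of_real (h / 2) *\<^sub>C abs_L2 (a_op h e1 (a_adj h e1 f))
      + (- complex_of_real (h / 2)) *\<^sub>C abs_L2 (a_op h e2 (a_adj h e2 f))"
  unfolding sphere_diff_altdef
  by (intro abs_L2_lin_comb schwartz_square_integrable_plane schwartz_a assms e_Basis)+

lemma symmetric_x_diff: "symmetric_operator (schwartz_op (x_diff h))"
  by (rule symmetric_schwartz_op)
    (simp add: abs_L2_sphere_diff cinner_simps cinner_a_op_a_adj e_Basis)

lemma symmetric_y_diff: "symmetric_operator (schwartz_op (y_diff h))"
  by (rule symmetric_schwartz_op)
    (simp add: abs_L2_sphere_diff cinner_simps cinner_a_op_a_adj e_Basis)

lemma symmetric_z_diff: "symmetric_operator (schwartz_op (z_diff h))"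
  by (rule symmetric_schwartz_op)
    (simp add: abs_L2_sphere_diff cinner_simps cinner_a_op_a_adj e_Basis)

lemma L_diff_altdef:
  "L_diff h f = (\<lambda>x. (- complex_of_real (h\<^sup>2 / 2)) * (partial e1 (partial e1 f) x + partial e2 (partial e2 f) x)
    + (1/2) * (coord_mult e1 (coord_mult e1 f) x + coord_mult e2 (coord_mult e2 f) x))"
  by (rule ext) (simp add: L_diff_def coord_mult_def inner_prod_def power2_eq_square field_simps)

lemma symmetric_L_diff: "symmetric_operator (schwartz_op (L_diff h))"
proof (rule symmetric_schwartz_op)
  fix f g :: "plane \<Rightarrow> complex" assume fg: "schwartz f" "schwartz g"
  have sq: "square_integrable f" if "schwartz f" for f :: "plane \<Rightarrow> complex"
    by (rule schwartz_square_integrable_plane[OF that])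
  have s: "schwartz (partial e1 f)" "schwartz (partial e2 f)" "schwartz (coord_mult c f)"
    if "schwartz f" for c and f :: "plane \<Rightarrow> complex"
    by (intro schwartz_partial schwartz_coord_mult that e_Basis)+
  have L: "abs_L2 (L_diff h f) = (- complex_of_real (h\<^sup>2 / 2)) *\<^sub>C
        (abs_L2 (partial e1 (partial e1 f)) + abs_L2 (partial e2 (partial e2 f)))
      + (1/2) *\<^sub>C (abs_L2 (coord_mult e1 (coord_mult e1 f)) + abs_L2 (coord_mult e2 (coord_mult e2 f)))"
    if "schwartz f" for f
    unfolding L_diff_altdef
    by (simp only: abs_L2_lin_comb abs_L2_add square_integrable_add sq s that)
  show "cinner (abs_L2 (L_diff h f)) (abs_L2 g) = cinner (abs_L2 f) (abs_L2 (L_diff h g))"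
    by (simp add: L fg cinner_simps
        integration_by_parts_plane cinner_coord_mult s sq e_Basis del: of_real_power of_real_divide)
qed

section \<open>Hermite functions\<close>

definition gauss :: "real \<Rightarrow> real poly \<Rightarrow> real \<Rightarrow> complex"
  where "gauss h p u = complex_of_real (poly p u * exp (- u\<^sup>2 / (2 * h)))"

lemma gauss_add: "gauss h (p + q) u = gauss h p u + gauss h q u"
  by (simp add: gauss_def algebra_simps)

lemma gauss_diff: "gauss h (p - q) u = gauss h p u - gauss h q u"
  by (simp add: gauss_def algebra_simps)

lemma gauss_smult: "gauss h (smult c p) u = complex_of_real c * gauss h p u"
  by (simp add: gauss_def)

lemma coord_mult_gauss: "coord_mult 1 (gauss h p) = gauss h (pCons 0 p)"
  by (rule ext) (simp add: coord_mult_def gauss_def)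

definition gauss_deriv :: "real \<Rightarrow> real poly \<Rightarrow> real poly"
  where "gauss_deriv h p = pderiv p - smult (1 / h) (pCons 0 p)"

lemma has_derivative_gauss:
  assumes "h > 0"
  shows "(gauss h p has_derivative (\<lambda>t. t *\<^sub>R gauss h (gauss_deriv h p) u)) (at u)"
proof -
  have "((\<lambda>u. poly p u * exp (- u\<^sup>2 / (2 * h))) has_real_derivative
      poly (gauss_deriv h p) u * exp (- u\<^sup>2 / (2 * h))) (at u)"
    using assms
    by (auto intro!: derivative_eq_intros poly_DERIV simp: gauss_deriv_def algebra_simps divide_simps)
  hence "((\<lambda>u. poly p u * exp (- u\<^sup>2 / (2 * h))) has_derivative
      (\<lambda>t. poly (gauss_deriv h p) u * exp (- u\<^sup>2 / (2 * h)) * t)) (at u)"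
    by (simp add: has_field_derivative_def)
  from has_derivative_of_real[OF this] show ?thesis
    unfolding gauss_def[abs_def] by (simp add: scaleR_conv_of_real mult_ac)
qed

lemma partial_gauss:
  assumes "h > 0" shows "partial 1 (gauss h p) = gauss h (gauss_deriv h p)"
  by (rule ext) (simp add: partial_eqI[OF has_derivative_gauss[OF assms]])

lemma exp_partial_sum_le:
  fixes y :: real
  assumes "y \<ge> 0" shows "(\<Sum>k<N. y ^ k /\<^sub>R fact k) \<le> exp y"
proof -
  have "(\<Sum>k<N. y ^ k /\<^sub>R fact k) \<le> (\<Sum>k. y ^ k /\<^sub>R fact k)"
    by (rule sum_le_suminf[OF sums_summable[OF exp_converges]]) (use assms in auto)
  thus ?thesis by (simp only: sums_unique[OF exp_converges[of y]])
qed

lemma power_div_fact_le_exp: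
  fixes y :: real
  assumes "y \<ge> 0" shows "y ^ k / fact k \<le> exp y"
proof -
  have "y ^ k /\<^sub>R fact k \<le> (\<Sum>i<Suc k. y ^ i /\<^sub>R fact i)"
    by (rule member_le_sum) (use assms in auto)
  also have "\<dots> \<le> exp y" by (rule exp_partial_sum_le[OF assms])
  finally show ?thesis by (simp add: divide_inverse mult.commute)
qed

lemma power_gauss_bounded:
  fixes h :: real
  assumes "h > 0"
  shows "\<exists>C. \<forall>u. \<bar>u\<bar> ^ k * exp (- u\<^sup>2 / (2 * h)) \<le> C"
proof (intro exI allI)
  fix u :: real
  define E where "E = exp (u\<^sup>2 / (2 * h))"
  have E: "E \<ge> 1" using assms by (simp add: E_def)
  have "(u\<^sup>2 / (2 * h)) ^ k / fact k \<le> E"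
    unfolding E_def using assms by (intro power_div_fact_le_exp) simp
  moreover have "0 < (2 * h) ^ k" "(0::real) < fact k" using assms by simp_all
  ultimately have "(u\<^sup>2) ^ k \<le> fact k * (2 * h) ^ k * E"
    by (simp only: power_divide pos_divide_le_eq mult_ac)
  moreover have "\<bar>u\<bar> ^ k \<le> 1 + (u\<^sup>2) ^ k"
  proof -
    have "0 \<le> (\<bar>u\<bar> ^ k - 1)\<^sup>2" "0 \<le> \<bar>u\<bar> ^ k" by simp_all
    moreover have "(\<bar>u\<bar> ^ k - 1)\<^sup>2 = (\<bar>u\<bar> ^ k)\<^sup>2 - 2 * \<bar>u\<bar> ^ k + 1"
      by (simp add: power2_diff)
    ultimately have "\<bar>u\<bar> ^ k \<le> 1 + (\<bar>u\<bar> ^ k)\<^sup>2" by linarith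
    also have "(\<bar>u\<bar> ^ k)\<^sup>2 = (\<bar>u\<bar>\<^sup>2) ^ k"
      by (simp only: power_mult[symmetric] mult.commute[of k])
    also have "\<dots> = (u\<^sup>2) ^ k" by simp
    finally show ?thesis .
  qed
  ultimately have "\<bar>u\<bar> ^ k \<le> (1 + fact k * (2 * h) ^ k) * E"
    using E unfolding distrib_right by linarith
  moreover have "exp (- u\<^sup>2 / (2 * h)) = 1 / E" by (simp add: E_def exp_minus inverse_eq_divide)
  ultimately show "\<bar>u\<bar> ^ k * exp (- u\<^sup>2 / (2 * h)) \<le> 1 + fact k * (2 * h) ^ k"
    using E by (simp add: pos_divide_le_eq)
qed

lemma gauss_bounded:
  assumes "h > 0"
  shows "\<exists>C. \<forall>u. \<bar>u\<bar> ^ k * cmod (gauss h p u) \<le> C"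
proof -
  obtain M where M: "\<And>m u. \<bar>u\<bar> ^ m * exp (- u\<^sup>2 / (2 * h)) \<le> M m"
    using power_gauss_bounded[OF assms] by metis
  have "\<bar>u\<bar> ^ k * cmod (gauss h p u) \<le> (\<Sum>i\<le>degree p. \<bar>coeff p i\<bar> * M (k + i))" for u
  proof -
    have "\<bar>poly p u\<bar> \<le> (\<Sum>i\<le>degree p. \<bar>coeff p i\<bar> * \<bar>u\<bar> ^ i)"
      unfolding poly_altdef by (rule order.trans[OF sum_abs]) (simp add: abs_mult power_abs)
    hence "\<bar>u\<bar> ^ k * cmod (gauss h p u)
        \<le> \<bar>u\<bar> ^ k * ((\<Sum>i\<le>degree p. \<bar>coeff p i\<bar> * \<bar>u\<bar> ^ i) * exp (- u\<^sup>2 / (2 * h)))"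
      by (simp add: gauss_def norm_mult mult_left_mono mult_right_mono)
    also have "\<dots> = (\<Sum>i\<le>degree p. \<bar>coeff p i\<bar> * (\<bar>u\<bar> ^ (k + i) * exp (- u\<^sup>2 / (2 * h))))"
      by (simp add: sum_distrib_left sum_distrib_right power_add mult_ac)
    also have "\<dots> \<le> (\<Sum>i\<le>degree p. \<bar>coeff p i\<bar> * M (k + i))"
      by (intro sum_mono mult_left_mono M) simp
    finally show ?thesis .
  qed
  thus ?thesis by blast
qed

lemma schwartz_gauss:
  assumes "h > 0" shows "schwartz (gauss h p)"
proof -
  have "gauss h p \<in> range (gauss h)" by blast
  thus ?thesis
  proof (induct rule: schwartz_coinduct)
    case (differentiable f x)
    thus ?case using has_derivative_gauss[OF assms] by (auto intro: differentiableI)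
  next
    case (bounded f k)
    thus ?case using gauss_bounded[OF assms] by auto
  next
    case (partial f b)
    thus ?case using partial_gauss[OF assms] by auto
  qed
qed

text \<open>
  The operators \<open>a = (h d/du + u) / sqrt (2 h)\<close> and \<open>a\<^sup>* = (- h d/du + u) / sqrt (2 h)\<close> map
  \<open>gauss h p\<close> to \<open>gauss h (lower h p)\<close> and \<open>gauss h (raise h p)\<close>.
\<close>

definition lower :: "real \<Rightarrow> real poly \<Rightarrow> real poly"
  where "lower h p = smult (sqrt (h / 2)) (pderiv p)"

definition raise :: "real \<Rightarrow> real poly \<Rightarrow> real poly"
  where "raise h p = smult (1 / sqrt (2 * h)) (smult 2 (pCons 0 p) - smult h (pderiv p))"

lemma sqrt_h_simps:
  assumes "h > 0"
  shows "sqrt (2 * h) = 2 * sqrt (h / 2)" "sqrt (h / 2) * sqrt (h / 2) = h / 2"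
    "sqrt (h / 2) \<noteq> 0"
proof -
  have "sqrt (2 * h) = sqrt (4 * (h / 2))" by simp
  also have "\<dots> = 2 * sqrt (h / 2)" by (subst real_sqrt_mult) simp
  finally show "sqrt (2 * h) = 2 * sqrt (h / 2)" .
qed (use assms in auto)

lemma lower_raise:
  assumes "h > 0" shows "lower h (raise h p) = raise h (lower h p) + p"
proof (rule poly_ext)
  fix x
  define s where "s = sqrt (h / 2)"
  have s: "s * s = h / 2" "s \<noteq> 0" "h = 2 * (s * s)" using sqrt_h_simps(2,3)[OF assms] by (auto simp: s_def)
  show "poly (lower h (raise h p)) x = poly (raise h (lower h p) + p) x"
    unfolding lower_def raise_def sqrt_h_simps(1)[OF assms] s_def[symmetric]
    using s(2) by (simp add: pderiv_smult pderiv_diff pderiv_pCons field_simps)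
qed

lemma mult_x_ladder:
  assumes "h > 0" shows "pCons 0 p = smult (sqrt (h / 2)) (lower h p + raise h p)"
proof (rule poly_ext)
  fix x
  define s where "s = sqrt (h / 2)"
  have s: "s \<noteq> 0" "h = 2 * (s * s)" using sqrt_h_simps(2,3)[OF assms] by (auto simp: s_def)
  show "poly (pCons 0 p) x = poly (smult (sqrt (h / 2)) (lower h p + raise h p)) x"
    unfolding lower_def raise_def sqrt_h_simps(1)[OF assms] s_def[symmetric]
    using s(1) by (subst s(2)) (simp add: field_simps)
qed

lemma gauss_deriv_ladder:
  assumes "h > 0" shows "gauss_deriv h p = smult (1 / sqrt (2 * h)) (lower h p - raise h p)"
proof (rule poly_ext)
  fix x
  define s where "s = sqrt (h / 2)"
  have s: "s \<noteq> 0" "h = 2 * (s * s)" using sqrt_h_simps(2,3)[OF assms] by (auto simp: s_def)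
  show "poly (gauss_deriv h p) x = poly (smult (1 / sqrt (2 * h)) (lower h p - raise h p)) x"
    unfolding lower_def raise_def gauss_deriv_def sqrt_h_simps(1)[OF assms] s_def[symmetric]
    using s(1) by (subst (1 2) s(2)) (simp add: field_simps)
qed

lemma oscillator_poly:
  assumes "h > 0"
  shows "smult (- (h\<^sup>2 / 2)) (gauss_deriv h (gauss_deriv h p)) + smult (1 / 2) (pCons 0 (pCons 0 p))
    = smult h (raise h (lower h p)) + smult (h / 2) p"
proof (rule poly_ext)
  fix x
  define s where "s = sqrt (h / 2)"
  have s: "s \<noteq> 0" using sqrt_h_simps(2,3)[OF assms] by (auto simp: s_def)
  show "poly (smult (- (h\<^sup>2 / 2)) (gauss_deriv h (gauss_deriv h p)) + smult (1 / 2) (pCons 0 (pCons 0 p))) x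
    = poly (smult h (raise h (lower h p)) + smult (h / 2) p) x"
    unfolding lower_def raise_def gauss_deriv_def sqrt_h_simps(1)[OF assms] s_def[symmetric]
    using s assms
    by (simp add: pderiv_smult pderiv_diff pderiv_pCons field_simps power2_eq_square)
qed

text \<open>
  The normalized Hermite functions are \<open>(a\<^sup>*)^j / sqrt (fact j)\<close> applied to a Gaussian of norm 1.
\<close>

primrec hermite :: "real \<Rightarrow> nat \<Rightarrow> real poly"
  where "hermite h 0 = [:1 / norm (abs_L2 (gauss h 1)):]"
  | "hermite h (Suc j) = smult (1 / sqrt (real (Suc j))) (raise h (hermite h j))"

lemma raise_hermite: "raise h (hermite h j) = smult (sqrt (real (Suc j))) (hermite h (Suc j))"
  by (simp del: of_nat_Suc)

lemma raise_smult: "raise h (smult c p) = smult c (raise h p)"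
  by (simp add: raise_def pderiv_smult smult_diff_right mult_ac)

lemma raise_0: "raise h 0 = 0"
  by (simp add: raise_def)

lemma lower_smult: "lower h (smult c p) = smult c (lower h p)"
  by (simp add: lower_def pderiv_smult mult_ac)

lemma lower_hermite:
  assumes "h > 0"
  shows "lower h (hermite h j) = smult (sqrt (real j)) (hermite h (j - 1))"
proof (induction j)
  case 0
  show ?case by (simp add: lower_def pderiv_pCons)
next
  case (Suc j)
  have "raise h (lower h (hermite h j)) = smult (real j) (hermite h j)"
    using Suc raise_hermite[of h "j - 1"] by (cases j) (auto simp: raise_smult raise_0 simp del: hermite.simps of_nat_Suc)
  hence "lower h (hermite h (Suc j)) = smult (1 / sqrt (real (Suc j))) (smult (real j + 1) (hermite h j))"
    by (simp add: lower_smult lower_raise[OF assms] smult_add_left del: of_nat_Suc)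
  also have "\<dots> = smult (sqrt (real (Suc j))) (hermite h j)"
    by (simp add: real_div_sqrt add_ac)
  finally show ?case by simp
qed

lemma number_hermite:
  assumes "h > 0" shows "raise h (lower h (hermite h j)) = smult (real j) (hermite h j)"
  using raise_hermite[of h "j - 1"]
  by (cases j) (auto simp: lower_hermite[OF assms] raise_smult raise_0 simp del: hermite.simps of_nat_Suc)

lemma oscillator_hermite:
  assumes "h > 0"
  shows "smult (- (h\<^sup>2 / 2)) (gauss_deriv h (gauss_deriv h (hermite h j)))
      + smult (1 / 2) (pCons 0 (pCons 0 (hermite h j))) = smult (h * (real j + 1 / 2)) (hermite h j)"
  by (simp only: oscillator_poly[OF assms] number_hermite[OF assms] smult_smult smult_add_left[symmetric])
    (simp add: algebra_simps)

definition hvec :: "real \<Rightarrow> nat \<Rightarrow> real L2"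
  where "hvec h j = abs_L2 (gauss h (hermite h j))"

lemma square_integrable_gauss: "h > 0 \<Longrightarrow> square_integrable (gauss h p)"
  by (intro schwartz_square_integrable_real schwartz_gauss)

lemma abs_L2_gauss_smult: "h > 0 \<Longrightarrow> abs_L2 (gauss h (smult c p)) = complex_of_real c *\<^sub>C abs_L2 (gauss h p)"
  by (simp add: abs_L2_scaleC square_integrable_gauss gauss_smult[abs_def])

lemma abs_L2_gauss_add: "h > 0 \<Longrightarrow> abs_L2 (gauss h (p + q)) = abs_L2 (gauss h p) + abs_L2 (gauss h q)"
  by (simp add: abs_L2_add square_integrable_gauss gauss_add[abs_def])

lemma abs_L2_gauss_diff: "h > 0 \<Longrightarrow> abs_L2 (gauss h (p - q)) = abs_L2 (gauss h p) - abs_L2 (gauss h q)"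
  by (simp add: abs_L2_diff square_integrable_gauss gauss_diff[abs_def])

lemma oscillator_hvec:
  assumes "h > 0"
  shows "(hvec h j, complex_of_real (h * (real j + 1 / 2)) *\<^sub>C hvec h j) \<in> schwartz_op (oscillator_diff h)"
proof -
  have "oscillator_diff h (gauss h (hermite h j)) = gauss h (smult (- (h\<^sup>2 / 2)) (gauss_deriv h (gauss_deriv h (hermite h j)))
      + smult (1 / 2) (pCons 0 (pCons 0 (hermite h j))))"
    unfolding oscillator_diff_altdef
    by (rule ext) (simp only: partial_gauss[OF assms] coord_mult_gauss gauss_add gauss_smult, simp)
  also have "\<dots> = gauss h (smult (h * (real j + 1 / 2)) (hermite h j))"
    by (simp only: oscillator_hermite[OF assms])
  finally have "abs_L2 (oscillator_diff h (gauss h (hermite h j)))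
      = complex_of_real (h * (real j + 1 / 2)) *\<^sub>C hvec h j"
    by (simp only: abs_L2_gauss_smult[OF assms] hvec_def)
  thus ?thesis
    unfolding schwartz_op_def hvec_def using schwartz_gauss[OF assms] by force
qed

lemma position_hvec:
  assumes "h > 0"
  shows "(hvec h j, complex_of_real (sqrt (h / 2)) *\<^sub>C (complex_of_real (sqrt (real j)) *\<^sub>C hvec h (j - 1)
    + complex_of_real (sqrt (real (Suc j))) *\<^sub>C hvec h (Suc j))) \<in> schwartz_op position_diff"
proof -
  have "position_diff (gauss h (hermite h j)) = gauss h (smult (sqrt (h / 2)) (smult (sqrt (real j)) (hermite h (j - 1))
      + smult (sqrt (real (Suc j))) (hermite h (Suc j))))"
    by (simp only: position_diff_altdef coord_mult_gauss mult_x_ladder[OF assms] lower_hermite[OF assms] raise_hermite)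
  hence "abs_L2 (position_diff (gauss h (hermite h j))) = complex_of_real (sqrt (h / 2)) *\<^sub>C
      (complex_of_real (sqrt (real j)) *\<^sub>C hvec h (j - 1)
      + complex_of_real (sqrt (real (Suc j))) *\<^sub>C hvec h (Suc j))"
    by (simp only: abs_L2_gauss_smult[OF assms] abs_L2_gauss_add[OF assms] hvec_def)
  thus ?thesis
    unfolding schwartz_op_def hvec_def using schwartz_gauss[OF assms] by force
qed

lemma momentum_hvec:
  assumes "h > 0"
  shows "(hvec h j, (complex_of_real (sqrt (h / 2)) / \<i>) *\<^sub>C (complex_of_real (sqrt (real j)) *\<^sub>C hvec h (j - 1)
    - complex_of_real (sqrt (real (Suc j))) *\<^sub>C hvec h (Suc j))) \<in> schwartz_op (momentum_diff h)"
proof -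
  have c: "complex_of_real h / \<i> * complex_of_real (1 / sqrt (2 * h)) = complex_of_real (sqrt (h / 2)) / \<i>"
  proof -
    have "h * (1 / sqrt (2 * h)) = sqrt (h / 2)"
      using sqrt_h_simps[OF assms] by (simp add: field_simps)
    thus ?thesis by (metis of_real_mult times_divide_eq_left)
  qed
  have "abs_L2 (momentum_diff h (gauss h (hermite h j))) = (complex_of_real h / \<i>) *\<^sub>C
      abs_L2 (gauss h (smult (1 / sqrt (2 * h)) (smult (sqrt (real j)) (hermite h (j - 1))
      - smult (sqrt (real (Suc j))) (hermite h (Suc j)))))"
    by (simp only: abs_L2_momentum_diff[OF schwartz_gauss[OF assms]] partial_gauss[OF assms]
        gauss_deriv_ladder[OF assms] lower_hermite[OF assms] raise_hermite)
  also have "\<dots> = (complex_of_real (sqrt (h / 2)) / \<i>) *\<^sub>C (complex_of_real (sqrt (real j)) *\<^sub>C hvec h (j - 1)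
    - complex_of_real (sqrt (real (Suc j))) *\<^sub>C hvec h (Suc j))"
    by (simp only: abs_L2_gauss_smult[OF assms] abs_L2_gauss_diff[OF assms] hvec_def scaleC_scaleC c)
  finally show ?thesis
    unfolding schwartz_op_def hvec_def using schwartz_gauss[OF assms] by force
qed

lemma abs_L2_gauss_1_nonzero:
  assumes "h > 0" shows "abs_L2 (gauss h 1) \<noteq> 0"
proof
  assume "abs_L2 (gauss h 1) = 0"
  also have "0 = abs_L2 (gauss h 0)"
    using abs_L2_gauss_diff[OF assms, of 1 1] by simp
  finally have "AE x in lborel. gauss h 1 x = gauss h 0 x"
    by (simp add: abs_L2_eq_iff square_integrable_gauss assms)
  hence "AE x::real in lborel. False" by (simp add: gauss_def)
  thus False by (simp add: eventually_False ae_filter_eq_bot_iff)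
qed

lemma hvec_0_norm:
  assumes "h > 0" shows "cinner (hvec h 0) (hvec h 0) = 1"
proof -
  note abs_L2_gauss_1_nonzero[OF assms]
  moreover have "hvec h 0 = complex_of_real (1 / norm (abs_L2 (gauss h 1))) *\<^sub>C abs_L2 (gauss h 1)"
    unfolding hvec_def hermite.simps abs_L2_gauss_smult[OF assms, symmetric] by simp
  ultimately show ?thesis
    by (simp add: cinner_self_norm norm_scaleC norm_divide)
qed

lemma hvec_orthogonal:
  assumes h: "h > 0" and "j \<noteq> k" shows "cinner (hvec h j) (hvec h k) = 0"
proof -
  have "complex_of_real (h * (real j + 1 / 2)) * cinner (hvec h j) (hvec h k)
      = complex_of_real (h * (real k + 1 / 2)) * cinner (hvec h j) (hvec h k)"
    using symmetric_operatorD[OF symmetric_oscillator oscillator_hvec[OF h] oscillator_hvec[OF h], of j k]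
    by (simp only: cinner_scaleC_left cinner_scaleC_right complex_cnj_complex_of_real)
  moreover have "complex_of_real (h * (real j + 1 / 2)) \<noteq> complex_of_real (h * (real k + 1 / 2))"
    unfolding of_real_eq_iff using assms by simp
  ultimately show ?thesis by (metis mult_cancel_right)
qed

text \<open>
  Since \<open>u\<close> times \<open>hvec h j\<close> is a combination of the two neighbours with symmetric coefficients,
  symmetry of the position operator and orthogonality force consecutive norms to agree.
\<close>

lemma hvec_norm:
  assumes h: "h > 0" shows "cinner (hvec h j) (hvec h j) = 1"
proof (induction j)
  case 0
  show ?case by (rule hvec_0_norm[OF h])
next
  case (Suc j)
  have "j - Suc 0 \<noteq> Suc j" by simp
  note orth = hvec_orthogonal[OF h \<open>j - Suc 0 \<noteq> Suc j\<close>] hvec_orthogonal[OF h, of j "Suc (Suc j)"]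
  have "complex_of_real (sqrt (h / 2)) * (complex_of_real (sqrt (real (Suc j))) * cinner (hvec h (Suc j)) (hvec h (Suc j)))
      = complex_of_real (sqrt (h / 2)) * (complex_of_real (sqrt (real (Suc j))) * cinner (hvec h j) (hvec h j))"
    using symmetric_operatorD[OF symmetric_position position_hvec[OF h, of j] position_hvec[OF h, of "Suc j"]]
    by (simp add: cinner_simps orth del: of_nat_Suc)
  thus ?case using Suc h by (simp del: of_nat_Suc)
qed

lemma cinner_hvec: "h > 0 \<Longrightarrow> cinner (hvec h j) (hvec h k) = (if j = k then 1 else 0)"
  by (simp add: hvec_norm hvec_orthogonal)

section \<open>Completeness of the Hermite functions\<close>

text \<open>
  Expand \<open>iexp (t * x)\<close> into its power series.  The partial sums are dominated by
  \<open>exp (|t| |x|)\<close>, so the integral is the limit of combinations of moments.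
\<close>

lemma fourier_transform_zero_if_moments_zero:
  fixes g :: "real \<Rightarrow> real"
  assumes [measurable]: "g \<in> borel_measurable borel"
    and int: "\<And>t. integrable lborel (\<lambda>x. \<bar>g x\<bar> * exp (t * \<bar>x\<bar>))"
    and moments: "\<And>k. (LINT x|lborel. g x * x ^ k) = 0"
  shows "(CLINT x|lborel. complex_of_real (g x) * iexp (t * x)) = 0"
proof -
  define s where "s = (\<lambda>N x. \<Sum>k<N. complex_of_real (g x) * ((\<i> * complex_of_real (t * x)) ^ k /\<^sub>R fact k))"
  have g_int: "integrable lborel (\<lambda>x. g x * x ^ k)" for k
  proof (rule Bochner_Integration.integrable_bound[OF integrable_mult_right[OF int[of 1], of "fact k"]])
    show "AE x in lborel. norm (g x * x ^ k) \<le> norm (fact k * (\<bar>g x\<bar> * exp (1 * \<bar>x\<bar>)))"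
    proof (rule AE_I2)
      fix x :: real
      have "\<bar>x\<bar> ^ k \<le> fact k * exp \<bar>x\<bar>"
        using power_div_fact_le_exp[of "\<bar>x\<bar>" k] by (simp add: field_simps)
      from mult_left_mono[OF this, of "\<bar>g x\<bar>"]
      show "norm (g x * x ^ k) \<le> norm (fact k * (\<bar>g x\<bar> * exp (1 * \<bar>x\<bar>)))"
        by (simp add: abs_mult power_abs mult_ac)
    qed
  qed measurable
  have "(\<lambda>N. CLINT x|lborel. s N x) \<longlonglongrightarrow> (CLINT x|lborel. complex_of_real (g x) * iexp (t * x))"
  proof (rule integral_dominated_convergence[OF _ _ int[of "\<bar>t\<bar>"]])
    show "AE x in lborel. (\<lambda>N. s N x) \<longlonglongrightarrow> complex_of_real (g x) * iexp (t * x)"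
      unfolding s_def sum_distrib_left[symmetric]
      using exp_converges unfolding sums_def by (intro AE_I2 tendsto_mult tendsto_const) auto
    show "AE x in lborel. norm (s N x) \<le> \<bar>g x\<bar> * exp (\<bar>t\<bar> * \<bar>x\<bar>)" for N
    proof (rule AE_I2)
      fix x :: real
      have "norm (s N x) \<le> (\<Sum>k<N. \<bar>g x\<bar> * (\<bar>t * x\<bar> ^ k /\<^sub>R fact k))"
        unfolding s_def
        by (rule order.trans[OF norm_sum]) (simp add: norm_mult norm_power abs_mult power_mult_distrib divide_inverse mult_ac)
      also have "\<dots> \<le> \<bar>g x\<bar> * exp \<bar>t * x\<bar>"
        unfolding sum_distrib_left[symmetric] by (intro mult_left_mono exp_partial_sum_le) auto
      finally show "norm (s N x) \<le> \<bar>g x\<bar> * exp (\<bar>t\<bar> * \<bar>x\<bar>)" by (simp add: abs_mult)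
    qed
  qed (unfold s_def, measurable)
  moreover have "(CLINT x|lborel. s N x) = 0" for N
  proof -
    have s: "s N x = (\<Sum>k<N. ((\<i> * complex_of_real t) ^ k /\<^sub>R fact k) * complex_of_real (g x * x ^ k))" for x
      unfolding s_def by (intro sum.cong) (auto simp: power_mult_distrib scaleR_conv_of_real mult_ac)
    have "(CLINT x|lborel. s N x)
        = (\<Sum>k<N. CLINT x|lborel. ((\<i> * complex_of_real t) ^ k /\<^sub>R fact k) * complex_of_real (g x * x ^ k))"
      unfolding s
      by (intro Bochner_Integration.integral_sum integrable_mult_right integrable_of_real g_int)
    also have "\<dots> = 0"
      by (simp only: integral_mult_right_zero integral_complex_of_real moments) simp
    finally show ?thesis .
  qed
  ultimately show ?thesis by (simp add: LIMSEQ_const_iff)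
qed

text \<open>
  The positive and the negative part of \<open>g\<close> have equal integral, and after normalization they are
  densities of probability measures with the same characteristic function; Levy's uniqueness
  theorem makes them equal.
\<close>

lemma zero_if_fourier_transform_zero:
  fixes g :: "real \<Rightarrow> real"
  assumes g: "integrable lborel g"
    and ft: "\<And>t. (CLINT x|lborel. complex_of_real (g x) * iexp (t * x)) = 0"
  shows "AE x in lborel. g x = 0"
proof -
  have [measurable]: "g \<in> borel_measurable borel" using g by auto
  define P where "P = (\<lambda>x. max 0 (g x))"
  define Q where "Q = (\<lambda>x. max 0 (- g x))"
  have [measurable]: "P \<in> borel_measurable borel" "Q \<in> borel_measurable borel"
    unfolding P_def Q_def by measurable
  have PQ: "integrable lborel P" "integrable lborel Q" "\<And>x. P x \<ge> 0" "\<And>x. Q x \<ge> 0" "\<And>x. g x = P x - Q x"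
    using g by (auto simp: P_def Q_def)
  have phase: "integrable lborel (\<lambda>x. complex_of_real (R x) * iexp (t * x))"
    if "integrable lborel R" for R :: "real \<Rightarrow> real" and t
  proof (rule Bochner_Integration.integrable_bound[OF that])
    show "(\<lambda>x. complex_of_real (R x) * iexp (t * x)) \<in> borel_measurable lborel"
      using that by measurable
  qed (auto simp: norm_mult)
  have eq: "(CLINT x|lborel. complex_of_real (P x) * iexp (t * x)) = (CLINT x|lborel. complex_of_real (Q x) * iexp (t * x))" for t
    using ft[of t] unfolding PQ(5) of_real_diff left_diff_distrib
    by (subst (asm) Bochner_Integration.integral_diff[OF phase[OF PQ(1)] phase[OF PQ(2)]]) simp
  define m where "m = (LINT x|lborel. P x)"
  have m: "m = (LINT x|lborel. Q x)"
    using eq[of 0] by (simp add: m_def)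
  have "m \<ge> 0" unfolding m_def by (intro integral_nonneg_AE) (auto simp: PQ)
  show ?thesis
  proof (cases "m = 0")
    case True
    hence "AE x in lborel. P x = 0" "AE x in lborel. Q x = 0"
      using m integral_nonneg_eq_0_iff_AE[OF PQ(1)] integral_nonneg_eq_0_iff_AE[OF PQ(2)] PQ(3,4)
      by (auto simp: m_def)
    thus ?thesis by eventually_elim (simp add: PQ(5))
  next
    case False
    with \<open>m \<ge> 0\<close> have "m > 0" by simp
    \<comment> \<open>The normalization is common to both parts, so equality of the measures gives equality of the parts.\<close>
    define M where "M = (\<lambda>R :: real \<Rightarrow> real. density lborel (\<lambda>x. ennreal (R x / m)))"
    have dist: "real_distribution (M R)"
      if R: "integrable lborel R" "\<And>x. R x \<ge> 0" "(LINT x|lborel. R x) = m" for R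
    proof -
      have [measurable]: "R \<in> borel_measurable borel" using R by auto
      have "emeasure (M R) (space (M R)) = (\<integral>\<^sup>+x. ennreal (R x / m) \<partial>lborel)"
        unfolding M_def by (subst emeasure_density) auto
      also have "\<dots> = ennreal (LINT x|lborel. R x / m)"
        using R \<open>m > 0\<close> by (intro nn_integral_eq_integral) auto
      also have "\<dots> = 1" using R \<open>m > 0\<close> by simp
      finally have "prob_space (M R)" by (rule prob_spaceI)
      thus ?thesis
        by (auto simp: real_distribution_def real_distribution_axioms_def M_def)
    qed
    have char: "char (M R) t = (CLINT x|lborel. complex_of_real (R x) * iexp (t * x)) / complex_of_real m"
      if R: "integrable lborel R" "\<And>x. R x \<ge> 0" for R t
    proof -
      have [measurable]: "R \<in> borel_measurable borel" using R by auto
      have "char (M R) t = (CLINT x|lborel. (R x / m) *\<^sub>R iexp (t * x))"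
        unfolding char_def M_def by (subst integral_density) (use R \<open>m > 0\<close> in auto)
      also have "\<dots> = (CLINT x|lborel. (complex_of_real (R x) * iexp (t * x)) / complex_of_real m)"
        by (intro Bochner_Integration.integral_cong) (auto simp: scaleR_conv_of_real)
      also have "\<dots> = (CLINT x|lborel. complex_of_real (R x) * iexp (t * x)) / complex_of_real m"
        by (rule integral_divide_zero)
      finally show ?thesis .
    qed
    have "M P = M Q"
    proof (rule Levy_uniqueness)
      show "real_distribution (M P)" "real_distribution (M Q)"
        using dist[of P] dist[of Q] PQ m m_def by auto
      show "char (M P) = char (M Q)"
        by (rule ext) (simp only: char[OF PQ(1,3)] char[OF PQ(2,4)] eq)
    qed
    hence "AE x in lborel. ennreal (P x / m) = ennreal (Q x / m)"
      unfolding M_def by (subst (asm) sigma_finite_measure.density_unique_iff[OF sigma_finite_lborel]) auto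
    thus ?thesis
    proof eventually_elim
      case (elim x)
      hence "P x / m = Q x / m" using PQ \<open>m > 0\<close> by (subst (asm) ennreal_inj) auto
      thus ?case using \<open>m > 0\<close> by (simp add: PQ(5))
    qed
  qed
qed

lemma square_integrable_gauss_exp:
  assumes h: "h > 0"
  shows "square_integrable (\<lambda>x. complex_of_real (exp (- x\<^sup>2 / (2 * h)) * exp (t * \<bar>x\<bar>)))"
proof (rule square_integrable_bound[OF square_integrable_gauss[of "2 * h" 1]])
  fix x :: real
  \<comment> \<open>Completing the square trades half of the Gaussian exponent for the factor \<open>exp (t * \<bar>x\<bar>)\<close>.\<close>
  have "0 \<le> (\<bar>x\<bar> - 2 * t * h)\<^sup>2 / (4 * h)" using h by simp
  moreover have "(\<bar>x\<bar> - 2 * t * h)\<^sup>2 / (4 * h) = x\<^sup>2 / (4 * h) - t * \<bar>x\<bar> + t\<^sup>2 * h"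
    using h by (simp add: power2_diff power_mult_distrib field_simps) (simp add: power2_eq_square)
  moreover have half: "x\<^sup>2 / (2 * h) = 2 * (x\<^sup>2 / (4 * h))" "x\<^sup>2 / (2 * (2 * h)) = x\<^sup>2 / (4 * h)"
    by simp_all
  ultimately have "- x\<^sup>2 / (2 * h) + t * \<bar>x\<bar> \<le> t\<^sup>2 * h + (- x\<^sup>2 / (2 * (2 * h)))"
    unfolding minus_divide_left[symmetric] by linarith
  hence "exp (- x\<^sup>2 / (2 * h)) * exp (t * \<bar>x\<bar>) \<le> exp (t\<^sup>2 * h) * exp (- x\<^sup>2 / (2 * (2 * h)))"
    by (simp only: exp_add[symmetric] exp_le_cancel_iff)
  thus "cmod (complex_of_real (exp (- x\<^sup>2 / (2 * h)) * exp (t * \<bar>x\<bar>))) \<le> exp (t\<^sup>2 * h) * cmod (gauss (2 * h) 1 x)"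
    by (simp add: gauss_def norm_mult)
qed (use h in auto)

text \<open>
  Real and imaginary part of \<open>f\<close> are treated alike: \<open>R\<close> stands for \<open>Re\<close> or \<open>Im\<close>.  The Gaussian
  factor makes all exponential moments finite.
\<close>

lemma gauss_moments_determine:
  assumes h: "h > 0" and f: "square_integrable f"
    and moments: "\<And>k. (LINT x|lborel. f x * cnj (gauss h (monom 1 k) x)) = 0"
  shows "AE x in lborel. f x = 0"
proof -
  have int: "integrable lborel (\<lambda>x. f x * complex_of_real (exp (- x\<^sup>2 / (2 * h)) * exp (t * \<bar>x\<bar>)))" for t
    using square_integrable_mult_cnj[OF f square_integrable_gauss_exp[OF h, of t]] by simp
  have [measurable]: "f \<in> borel_measurable borel" using f by (rule square_integrable_measurable)
  have moment: "(CLINT x|lborel. f x * complex_of_real (x ^ k * exp (- x\<^sup>2 / (2 * h)))) = 0" for k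
    using moments[of k] by (simp add: gauss_def poly_monom)
  have mom_int: "integrable lborel (\<lambda>x. f x * complex_of_real (x ^ k * exp (- x\<^sup>2 / (2 * h))))" for k
    using square_integrable_mult_cnj[OF f square_integrable_gauss[OF h, of "monom 1 k"]]
    by (simp add: gauss_def poly_monom)
  have main: "AE x in lborel. R (f x) * exp (- x\<^sup>2 / (2 * h)) = 0"
    if R: "bounded_linear R" "\<And>z. \<bar>R z\<bar> \<le> cmod z" "\<And>z r. R (z * complex_of_real r) = R z * r"
      "R \<in> borel_measurable borel" for R :: "complex \<Rightarrow> real"
  proof (rule zero_if_fourier_transform_zero)
    have [measurable]: "(\<lambda>x. R (f x)) \<in> borel_measurable borel"
      using measurable_compose[OF _ R(4)] by measurable
    have i: "integrable lborel (\<lambda>x. \<bar>R (f x) * exp (- x\<^sup>2 / (2 * h))\<bar> * exp (t * \<bar>x\<bar>))" for t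
      by (rule Bochner_Integration.integrable_bound[OF int[of t]])
        (use R(2) in \<open>auto simp: norm_mult abs_mult intro!: mult_right_mono\<close>)
    show "integrable lborel (\<lambda>x. R (f x) * exp (- x\<^sup>2 / (2 * h)))"
      by (rule Bochner_Integration.integrable_bound[OF i[of 0]]) auto
    fix t
    show "(CLINT x|lborel. complex_of_real (R (f x) * exp (- x\<^sup>2 / (2 * h))) * iexp (t * x)) = 0"
    proof (rule fourier_transform_zero_if_moments_zero[OF _ i])
      fix k
      have "(LINT x|lborel. R (f x) * exp (- x\<^sup>2 / (2 * h)) * x ^ k)
          = (LINT x|lborel. R (f x * complex_of_real (x ^ k * exp (- x\<^sup>2 / (2 * h)))))"
        by (simp only: R(3) mult_ac)
      also have "\<dots> = R (CLINT x|lborel. f x * complex_of_real (x ^ k * exp (- x\<^sup>2 / (2 * h))))"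
        by (rule integral_bounded_linear[OF R(1) mom_int])
      finally show "(LINT x|lborel. R (f x) * exp (- x\<^sup>2 / (2 * h)) * x ^ k) = 0"
        by (simp only: moment linear_0[OF bounded_linear.linear[OF R(1)]])
    qed measurable
  qed
  have "AE x in lborel. Re (f x) * exp (- x\<^sup>2 / (2 * h)) = 0"
    by (rule main) (auto simp: bounded_linear_Re abs_Re_le_cmod)
  moreover have "AE x in lborel. Im (f x) * exp (- x\<^sup>2 / (2 * h)) = 0"
    by (rule main) (auto simp: bounded_linear_Im abs_Im_le_cmod)
  ultimately show ?thesis
    by eventually_elim (simp add: complex_eq_iff)
qed

text \<open>
  Multiplication by \<open>u\<close> maps each Hermite function into the span of its neighbours, so a vector
  orthogonal to all of them is orthogonal to every monomial times the Gaussian.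
\<close>

theorem hvec_complete:
  assumes h: "h > 0" and u: "\<And>j. cinner u (hvec h j) = 0"
  shows "u = 0"
proof -
  obtain f where f: "square_integrable f" "u = abs_L2 f" by (rule L2_cases)
  define G where "G = (\<lambda>p. cinner u (abs_L2 (gauss h p)))"
  have add: "G (p + q) = G p + G q" for p q
    by (simp add: G_def abs_L2_gauss_add[OF h] cinner_add_right)
  have smult: "G (smult c p) = complex_of_real c * G p" for c p
    by (simp add: G_def abs_L2_gauss_smult[OF h] cinner_scaleC_right)
  have "G (monom 1 k * hermite h j) = 0" for k j
  proof (induction k arbitrary: j)
    case 0
    show ?case using u by (simp add: G_def hvec_def monom_0 one_pCons[symmetric])
  next
    case (Suc k)
    have "monom 1 (Suc k) * hermite h j = monom 1 k * pCons 0 (hermite h j)"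
      by (simp add: monom_Suc)
    also have "pCons 0 (hermite h j) = smult (sqrt (h / 2)) (smult (sqrt (real j)) (hermite h (j - 1))
        + smult (sqrt (real (Suc j))) (hermite h (Suc j)))"
      by (simp only: mult_x_ladder[OF h] lower_hermite[OF h] raise_hermite)
    finally show ?case
      by (simp only: mult_smult_right distrib_left add smult Suc.IH) simp
  qed
  from this[of _ 0] have "G (smult (1 / norm (abs_L2 (gauss h 1))) (monom 1 k)) = 0" for k
    by (simp add: mult.commute[of "monom 1 k"])
  moreover have "norm (abs_L2 (gauss h 1)) \<noteq> 0"
    using abs_L2_gauss_1_nonzero[OF h] by simp
  ultimately have "G (monom 1 k) = 0" for k by (simp add: smult)
  hence "AE x in lborel. f x = 0"
    by (intro gauss_moments_determine[OF h f(1)])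
      (simp add: G_def f cinner_abs_L2 square_integrable_gauss[OF h])
  hence "abs_L2 f = abs_L2 (\<lambda>x. 0)"
    by (simp add: abs_L2_eq_iff f square_integrable_zero)
  also have "\<dots> = 0" by (simp add: zero_L2_def)
  finally show ?thesis using f by simp
qed

section \<open>Tensor products\<close>

lemma tensor_abs_L2:
  assumes "square_integrable f" "square_integrable g"
  shows "abs_L2 f \<otimes>\<^sub>2 abs_L2 g = abs_L2 (\<lambda>p. f (fst p) * g (snd p))"
  by (intro tensor.abs_eq L2_rel_refl assms)

lemma tensor_add_left: "(u + v) \<otimes>\<^sub>2 w = u \<otimes>\<^sub>2 w + v \<otimes>\<^sub>2 w"
proof -
  obtain f g k where "square_integrable f" "u = abs_L2 f" "square_integrable g" "v = abs_L2 g"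
      "square_integrable k" "w = abs_L2 k"
    by (metis L2_cases)
  thus ?thesis
    by (simp add: tensor_abs_L2 abs_L2_add square_integrable_add square_integrable_tensor distrib_right)
qed

lemma tensor_add_right: "w \<otimes>\<^sub>2 (u + v) = w \<otimes>\<^sub>2 u + w \<otimes>\<^sub>2 v"
proof -
  obtain f g k where "square_integrable f" "u = abs_L2 f" "square_integrable g" "v = abs_L2 g"
      "square_integrable k" "w = abs_L2 k"
    by (metis L2_cases)
  thus ?thesis
    by (simp add: tensor_abs_L2 abs_L2_add square_integrable_add square_integrable_tensor distrib_left)
qed

lemma tensor_scaleC_left: "(c *\<^sub>C u) \<otimes>\<^sub>2 w = c *\<^sub>C (u \<otimes>\<^sub>2 w)"
proof -
  obtain f k where "square_integrable f" "u = abs_L2 f" "square_integrable k" "w = abs_L2 k"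
    by (metis L2_cases)
  thus ?thesis
    by (simp add: tensor_abs_L2 abs_L2_scaleC square_integrable_scale square_integrable_tensor mult.assoc)
qed

lemma tensor_scaleC_right: "w \<otimes>\<^sub>2 (c *\<^sub>C u) = c *\<^sub>C (w \<otimes>\<^sub>2 u)"
proof -
  obtain f k where "square_integrable f" "u = abs_L2 f" "square_integrable k" "w = abs_L2 k"
    by (metis L2_cases)
  thus ?thesis
    by (simp add: tensor_abs_L2 abs_L2_scaleC square_integrable_scale square_integrable_tensor mult.left_commute)
qed

lemma tensor_minus_left: "(- u) \<otimes>\<^sub>2 w = - (u \<otimes>\<^sub>2 w)"
  using tensor_scaleC_left[of "-1" u w] by (simp add: scaleC_minus1)

lemma tensor_minus_right: "w \<otimes>\<^sub>2 (- u) = - (w \<otimes>\<^sub>2 u)"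
  using tensor_scaleC_right[of w "-1" u] by (simp add: scaleC_minus1)

lemma tensor_diff_left: "(u - v) \<otimes>\<^sub>2 w = u \<otimes>\<^sub>2 w - v \<otimes>\<^sub>2 w"
  using tensor_add_left[of u "- v" w] by (simp add: tensor_minus_left)

lemma tensor_diff_right: "w \<otimes>\<^sub>2 (u - v) = w \<otimes>\<^sub>2 u - w \<otimes>\<^sub>2 v"
  using tensor_add_right[of w u "- v"] by (simp add: tensor_minus_right)

lemma tensor_zero_left: "0 \<otimes>\<^sub>2 w = 0"
  using tensor_scaleC_left[of 0 0 w] by simp

lemma tensor_zero_right: "w \<otimes>\<^sub>2 0 = 0"
  using tensor_scaleC_right[of w 0 0] by simp

lemmas tensor_simps = tensor_add_left tensor_add_right tensor_scaleC_left tensor_scaleC_right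
  tensor_minus_left tensor_minus_right tensor_diff_left tensor_diff_right tensor_zero_left tensor_zero_right

lemma cinner_tensor:
  fixes u u' :: "'a::euclidean_space L2" and v v' :: "'b::euclidean_space L2"
  shows "cinner (u \<otimes>\<^sub>2 v) (u' \<otimes>\<^sub>2 v') = cinner u u' * cinner v v'"
proof -
  obtain f f' g g' where sq: "square_integrable f" "square_integrable f'" "square_integrable g" "square_integrable g'"
    and eq: "u = abs_L2 f" "u' = abs_L2 f'" "v = abs_L2 g" "v' = abs_L2 g'"
    by (metis L2_cases)
  let ?h = "\<lambda>p. (f (fst p) * g (snd p)) * cnj (f' (fst p) * g' (snd p))"
  have int: "integrable (lborel \<Otimes>\<^sub>M lborel) ?h"
    unfolding lborel_prod by (intro square_integrable_mult_cnj square_integrable_tensor sq)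
  have "cinner (u \<otimes>\<^sub>2 v) (u' \<otimes>\<^sub>2 v') = (LINT p|(lborel \<Otimes>\<^sub>M lborel). ?h p)"
    by (simp only: eq tensor_abs_L2[OF sq(1,3)] tensor_abs_L2[OF sq(2,4)] lborel_prod
        cinner_abs_L2[OF square_integrable_tensor[OF sq(1,3)] square_integrable_tensor[OF sq(2,4)]])
  also have "\<dots> = (LINT x|lborel. LINT y|lborel. ?h (x, y))"
    by (rule lborel_pair.integral_fst'[OF int, symmetric])
  also have "\<dots> = (LINT x|lborel. LINT y|lborel. (f x * cnj (f' x)) * (g y * cnj (g' y)))"
    by (simp add: mult_ac)
  also have "\<dots> = (LINT x|lborel. f x * cnj (f' x)) * (LINT y|lborel. g y * cnj (g' y))"
    by simp
  finally show ?thesis by (simp add: eq cinner_abs_L2 sq)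
qed

lemma norm_tensor: "norm (u \<otimes>\<^sub>2 v) = norm u * norm v"
proof -
  have "complex_of_real ((norm (u \<otimes>\<^sub>2 v))\<^sup>2) = complex_of_real ((norm u * norm v)\<^sup>2)"
    by (simp only: cinner_self_norm[symmetric] cinner_tensor power_mult_distrib of_real_mult)
  hence "(norm (u \<otimes>\<^sub>2 v))\<^sup>2 = (norm u * norm v)\<^sup>2" by (simp only: of_real_eq_iff)
  thus ?thesis by (simp add: power2_eq_iff_nonneg)
qed

lemma tendsto_tensor_right:
  assumes "(g \<longlongrightarrow> v) F" shows "((\<lambda>x. u \<otimes>\<^sub>2 g x) \<longlongrightarrow> u \<otimes>\<^sub>2 v) F"
proof -
  have "((\<lambda>x. norm u * norm (g x - v)) \<longlongrightarrow> norm u * norm (v - v)) F"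
    by (intro tendsto_intros assms)
  hence "((\<lambda>x. norm (u \<otimes>\<^sub>2 g x - u \<otimes>\<^sub>2 v)) \<longlongrightarrow> 0) F"
    by (simp add: norm_tensor tensor_diff_right[symmetric])
  thus ?thesis by (metis LIM_zero_cancel tendsto_norm_zero_cancel)
qed

lemma abs_L2_eq_0_iff: "square_integrable f \<Longrightarrow> abs_L2 f = 0 \<longleftrightarrow> (AE x in lborel. f x = 0)"
  using abs_L2_eq_iff[of f "\<lambda>x. 0"] by (simp add: square_integrable_zero zero_L2_def)

lemma borel_measurable_cnj [measurable]:
  "f \<in> borel_measurable M \<Longrightarrow> (\<lambda>x. cnj (f x)) \<in> borel_measurable M"
  by (rule measurable_compose[of f M borel]) (auto intro!: borel_measurable_continuous_onI continuous_intros)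

text \<open>
  The functions \<open>y \<mapsto> \<langle>f(\<cdot>, y), e j\<rangle>\<close> are square-integrable and orthogonal to all \<open>d k\<close>, hence
  zero almost everywhere.  There are countably many \<open>j\<close>, so for almost every \<open>y\<close> the section
  \<open>f(\<cdot>, y)\<close> is orthogonal to all \<open>e j\<close> and vanishes.
\<close>

theorem tensor_complete:
  fixes e :: "nat \<Rightarrow> 'a::euclidean_space L2" and d :: "nat \<Rightarrow> 'b::euclidean_space L2"
  assumes e: "\<And>u. (\<And>j. cinner u (e j) = 0) \<Longrightarrow> u = 0"
    and d: "\<And>u. (\<And>k. cinner u (d k) = 0) \<Longrightarrow> u = 0"
    and w: "\<And>j k. cinner w (e j \<otimes>\<^sub>2 d k) = 0"
  shows "w = 0"
proof -
  obtain f where f: "square_integrable f" "w = abs_L2 f" by (rule L2_cases)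
  have "\<exists>g. square_integrable g \<and> e j = abs_L2 g" for j by (rule L2_cases[of "e j"]) blast
  then obtain g where g: "\<And>j. square_integrable (g j)" "\<And>j. e j = abs_L2 (g j)" by metis
  have "\<exists>q. square_integrable q \<and> d k = abs_L2 q" for k by (rule L2_cases[of "d k"]) blast
  then obtain q where q: "\<And>k. square_integrable (q k)" "\<And>k. d k = abs_L2 (q k)" by metis
  have [measurable]: "f \<in> borel_measurable (borel \<Otimes>\<^sub>M borel)"
    using square_integrable_measurable[OF f(1)] by (simp add: borel_prod)
  note [measurable] = square_integrable_measurable[OF g(1)] square_integrable_measurable[OF q(1)]
  have f2: "integrable (lborel \<Otimes>\<^sub>M lborel) (\<lambda>(x, y). (cmod (f (x, y)))\<^sup>2)"
    using f(1) by (simp add: square_integrable_def lborel_prod case_prod_beta')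
  define N where "N = (\<lambda>y. LINT x|lborel. (cmod (f (x, y)))\<^sup>2)"
  have N: "integrable lborel N" unfolding N_def by (rule lborel_pair.integrable_snd[OF f2])
  have AE_sec: "AE y in lborel. square_integrable (\<lambda>x. f (x, y))"
    using lborel_pair.AE_integrable_snd[OF f2] by eventually_elim (auto simp: square_integrable_def)
  define F where "F = (\<lambda>j y. LINT x|lborel. f (x, y) * cnj (g j x))"
  have [measurable]: "F j \<in> borel_measurable borel" for j
    unfolding F_def by measurable
  have F: "square_integrable (F j)" for j
    unfolding square_integrable_def
  proof
    show "integrable lborel (\<lambda>y. (cmod (F j y))\<^sup>2)"
    proof (rule Bochner_Integration.integrable_bound[OF integrable_mult_right[OF N, of "(norm (e j))\<^sup>2"]])
      show "AE y in lborel. norm ((cmod (F j y))\<^sup>2) \<le> norm ((norm (e j))\<^sup>2 * N y)"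
        using AE_sec
      proof eventually_elim
        case (elim y)
        have "F j y = cinner (abs_L2 (\<lambda>x. f (x, y))) (e j)"
          by (simp add: F_def g cinner_abs_L2 elim)
        hence "cmod (F j y) \<le> norm (abs_L2 (\<lambda>x. f (x, y))) * norm (e j)"
          by (simp add: cinner_cauchy_schwarz)
        hence "(cmod (F j y))\<^sup>2 \<le> (norm (abs_L2 (\<lambda>x. f (x, y))) * norm (e j))\<^sup>2"
          by (rule power_mono) simp
        also have "\<dots> = (norm (e j))\<^sup>2 * N y"
          by (simp add: power_mult_distrib norm_abs_L2 elim N_def)
        finally show ?case by simp
      qed
    qed measurable
  qed measurable
  have "abs_L2 (F j) = 0" for j
  proof (rule d)
    fix k
    let ?h = "\<lambda>x y. f (x, y) * cnj (g j x * q k y)"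
    have int: "integrable (lborel \<Otimes>\<^sub>M lborel) (\<lambda>(x, y). ?h x y)"
      using square_integrable_mult_cnj[OF f(1) square_integrable_tensor[OF g(1) q(1)], of j k]
      by (simp add: lborel_prod case_prod_beta')
    have "cinner (abs_L2 (F j)) (d k) = (LINT y|lborel. F j y * cnj (q k y))"
      by (simp add: q cinner_abs_L2 F)
    also have "\<dots> = (LINT y|lborel. LINT x|lborel. ?h x y)"
      unfolding F_def integral_mult_left_zero[symmetric] by (simp add: mult.assoc)
    also have "\<dots> = (LINT p|(lborel \<Otimes>\<^sub>M lborel). (case p of (x, y) \<Rightarrow> ?h x y))"
      by (rule lborel_pair.integral_snd[OF int])
    also have "\<dots> = cinner w (e j \<otimes>\<^sub>2 d k)"
      using f g q by (simp add: tensor_abs_L2 cinner_abs_L2 square_integrable_tensor lborel_prod case_prod_beta')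
    finally show "cinner (abs_L2 (F j)) (d k) = 0" using w by simp
  qed
  hence "AE y in lborel. \<forall>j. F j y = 0"
    by (simp add: abs_L2_eq_0_iff F AE_all_countable)
  hence "AE y in lborel. AE x in lborel. f (x, y) = 0"
    using AE_sec
  proof eventually_elim
    case (elim y)
    have "abs_L2 (\<lambda>x. f (x, y)) = 0"
      by (rule e) (use elim in \<open>simp add: g cinner_abs_L2 F_def\<close>)
    thus ?case using elim by (simp add: abs_L2_eq_0_iff)
  qed
  hence "AE x in lborel. AE y in lborel. f (x, y) = 0"
    by (subst lborel_pair.AE_commute) measurable
  hence "AE p in lborel \<Otimes>\<^sub>M lborel. f p = 0"
  proof (intro lborel_pair.AE_pair_measure)
    show "{p \<in> space (lborel \<Otimes>\<^sub>M lborel). f p = 0} \<in> sets (lborel \<Otimes>\<^sub>M lborel)"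
      by measurable
  qed
  hence "AE p in lborel. f p = 0" unfolding lborel_prod .
  thus ?thesis using f by (simp add: abs_L2_eq_0_iff)
qed

section \<open>The Hilbert space of the sphere\<close>

definition gauss2 :: "real \<Rightarrow> real poly \<Rightarrow> real poly \<Rightarrow> plane \<Rightarrow> complex"
  where "gauss2 h p q z = gauss h p (fst z) * gauss h q (snd z)"

lemma has_derivative_gauss2:
  assumes "h > 0"
  shows "(gauss2 h p q has_derivative (\<lambda>t. gauss h p (fst z) * (snd t *\<^sub>R gauss h (gauss_deriv h q) (snd z))
    + (fst t *\<^sub>R gauss h (gauss_deriv h p) (fst z)) * gauss h q (snd z))) (at z)"
  unfolding gauss2_def[abs_def]
  by (intro has_derivative_mult has_derivative_compose[OF _ has_derivative_gauss[OF assms]]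
      has_derivative_fst has_derivative_snd has_derivative_ident)

lemma partial_gauss2:
  assumes "h > 0"
  shows "partial e1 (gauss2 h p q) = gauss2 h (gauss_deriv h p) q"
    "partial e2 (gauss2 h p q) = gauss2 h p (gauss_deriv h q)"
  by (auto simp: partial_eqI[OF has_derivative_gauss2[OF assms]] gauss2_def fun_eq_iff)

lemma gauss_bounded_weight:
  assumes "h > 0"
  shows "\<exists>C. \<forall>u. (1 + \<bar>u\<bar>) ^ k * cmod (gauss h p u) \<le> C"
proof -
  obtain C where C: "\<And>m u. \<bar>u\<bar> ^ m * cmod (gauss h p u) \<le> C m"
    using gauss_bounded[OF assms, where p = p] by metis
  have "(1 + \<bar>u\<bar>) ^ k * cmod (gauss h p u) \<le> (\<Sum>i\<le>k. of_nat (k choose i) * C i)" for u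
  proof -
    have "(1 + \<bar>u\<bar>) ^ k = (\<Sum>i\<le>k. of_nat (k choose i) * \<bar>u\<bar> ^ i)"
      using binomial_ring[of "\<bar>u\<bar>" 1 k] by (simp add: add.commute)
    hence "(1 + \<bar>u\<bar>) ^ k * cmod (gauss h p u) = (\<Sum>i\<le>k. of_nat (k choose i) * (\<bar>u\<bar> ^ i * cmod (gauss h p u)))"
      by (simp add: sum_distrib_right mult.assoc)
    also have "\<dots> \<le> (\<Sum>i\<le>k. of_nat (k choose i) * C i)"
      by (intro sum_mono mult_left_mono C) simp
    finally show ?thesis .
  qed
  thus ?thesis by blast
qed

lemma schwartz_gauss2:
  assumes "h > 0" shows "schwartz (gauss2 h p q)"
proof -
  have "gauss2 h p q \<in> {gauss2 h p q | p q. True}" by blast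
  thus ?thesis
  proof (induct rule: schwartz_coinduct)
    case (differentiable f x)
    thus ?case using differentiableI[OF has_derivative_gauss2[OF assms]] by blast
  next
    case (bounded f k)
    then obtain p q where f: "f = gauss2 h p q" by blast
    obtain C D where CD: "\<And>u. (1 + \<bar>u\<bar>) ^ k * cmod (gauss h p u) \<le> C" "\<And>u. (1 + \<bar>u\<bar>) ^ k * cmod (gauss h q u) \<le> D"
      using gauss_bounded_weight[OF assms] by metis
    have "norm z ^ k * cmod (f z) \<le> C * D" for z
    proof -
      have "norm z \<le> \<bar>fst z\<bar> + \<bar>snd z\<bar>"
        unfolding norm_prod_def real_norm_def by (simp add: sqrt_sum_squares_le_sum_abs)
      also have "\<dots> \<le> (1 + \<bar>fst z\<bar>) * (1 + \<bar>snd z\<bar>)" by (simp add: algebra_simps)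
      finally have "norm z ^ k \<le> ((1 + \<bar>fst z\<bar>) * (1 + \<bar>snd z\<bar>)) ^ k" by (rule power_mono) simp
      hence "norm z ^ k * cmod (f z) \<le> ((1 + \<bar>fst z\<bar>) * (1 + \<bar>snd z\<bar>)) ^ k * cmod (f z)"
        by (rule mult_right_mono) simp
      also have "\<dots> = ((1 + \<bar>fst z\<bar>) ^ k * cmod (gauss h p (fst z))) * ((1 + \<bar>snd z\<bar>) ^ k * cmod (gauss h q (snd z)))"
        by (simp add: f gauss2_def norm_mult power_mult_distrib mult_ac)
      also have "\<dots> \<le> C * D"
        using CD(1)[of "fst z"] CD(2)[of "snd z"]
        by (intro mult_mono) (auto intro: order_trans[OF _ CD(1)[of "fst z"]])
      finally show ?thesis .
    qed
    thus ?case by blast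
  next
    case (partial f b)
    hence "b = e1 \<or> b = e2" by (auto simp: Basis_prod_def)
    with partial(1) partial_gauss2[OF assms] show ?case by force
  qed
qed

lemma coord_mult_gauss2:
  "coord_mult e1 (gauss2 h p q) = gauss2 h (pCons 0 p) q"
  "coord_mult e2 (gauss2 h p q) = gauss2 h p (pCons 0 q)"
  by (auto simp: coord_mult_def gauss2_def gauss_def inner_prod_def fun_eq_iff)

lemma ladder_poly:
  assumes "h > 0"
  shows "smult (h / sqrt (2 * h)) (gauss_deriv h p) + smult (1 / sqrt (2 * h)) (pCons 0 p) = lower h p"
    "smult (- h / sqrt (2 * h)) (gauss_deriv h p) + smult (1 / sqrt (2 * h)) (pCons 0 p) = raise h p"
proof -
  define s where "s = sqrt (h / 2)"
  have s: "s \<noteq> 0" "h = 2 * (s * s)" using sqrt_h_simps(2,3)[OF assms] by (auto simp: s_def)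
  note defs = lower_def raise_def gauss_deriv_def sqrt_h_simps(1)[OF assms] s_def[symmetric]
  show "smult (h / sqrt (2 * h)) (gauss_deriv h p) + smult (1 / sqrt (2 * h)) (pCons 0 p) = lower h p"
    unfolding defs by (rule poly_ext) (use s assms in \<open>simp add: field_simps\<close>)
  show "smult (- h / sqrt (2 * h)) (gauss_deriv h p) + smult (1 / sqrt (2 * h)) (pCons 0 p) = raise h p"
    unfolding defs by (rule poly_ext) (use s(1) assms in \<open>simp add: field_simps\<close>)
qed

lemma a_gauss2:
  assumes "h > 0"
  shows "a_op h e1 (gauss2 h p q) = gauss2 h (lower h p) q" "a_op h e2 (gauss2 h p q) = gauss2 h p (lower h q)"
    "a_adj h e1 (gauss2 h p q) = gauss2 h (raise h p) q" "a_adj h e2 (gauss2 h p q) = gauss2 h p (raise h q)"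
  unfolding a_op_altdef a_adj_altdef partial_gauss2[OF assms] coord_mult_gauss2
    ladder_poly(1)[OF assms, symmetric] ladder_poly(2)[OF assms, symmetric]
  by (simp_all only: fun_eq_iff gauss2_def gauss_add gauss_smult) (simp_all only: distrib_left distrib_right mult_ac, simp_all)

definition hvec2 :: "real \<Rightarrow> nat \<Rightarrow> nat \<Rightarrow> plane L2"
  where "hvec2 h j k = hvec h j \<otimes>\<^sub>2 hvec h k"

lemma abs_L2_gauss2:
  assumes "h > 0" shows "abs_L2 (gauss2 h p q) = abs_L2 (gauss h p) \<otimes>\<^sub>2 abs_L2 (gauss h q)"
  by (simp add: tensor_abs_L2 square_integrable_gauss assms gauss2_def[abs_def])

text \<open>
  For \<open>j = 0\<close> or \<open>k = 0\<close> the truncated index \<open>j - 1\<close> or \<open>k - 1\<close> is harmless, because the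
  coefficient is then zero.
\<close>

lemma abs_L2_a_hermite:
  fixes j k :: nat
  assumes "h > 0"
  defines "f \<equiv> gauss2 h (hermite h j) (hermite h k)"
  shows "abs_L2 (a_op h e1 (a_adj h e2 f)) = complex_of_real (sqrt (real j * real (Suc k))) *\<^sub>C hvec2 h (j - 1) (Suc k)"
    "abs_L2 (a_op h e2 (a_adj h e1 f)) = complex_of_real (sqrt (real k * real (Suc j))) *\<^sub>C hvec2 h (Suc j) (k - 1)"
    "abs_L2 (a_op h e1 (a_adj h e1 f)) = complex_of_real (real (Suc j)) *\<^sub>C hvec2 h j k"
    "abs_L2 (a_op h e2 (a_adj h e2 f)) = complex_of_real (real (Suc k)) *\<^sub>C hvec2 h j k"
  unfolding f_def a_gauss2[OF assms(1)] raise_hermite lower_hermite[OF assms(1)] lower_smult smult_smult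
    abs_L2_gauss2[OF assms(1)] abs_L2_gauss_smult[OF assms(1)] hvec_def[symmetric] hvec2_def
  by (simp_all add: tensor_simps real_sqrt_mult mult_ac del: of_nat_Suc of_real_mult
      flip: of_real_mult)

lemma hvec2_eq: "h > 0 \<Longrightarrow> hvec2 h j k = abs_L2 (gauss2 h (hermite h j) (hermite h k))"
  by (simp add: hvec2_def abs_L2_gauss2 hvec_def)

lemma x_diff_hvec2:
  assumes "h > 0"
  shows "(hvec2 h j k, complex_of_real (h / 2) *\<^sub>C (complex_of_real (sqrt (real j * real (Suc k))) *\<^sub>C hvec2 h (j - 1) (Suc k)
    + complex_of_real (sqrt (real k * real (Suc j))) *\<^sub>C hvec2 h (Suc j) (k - 1))) \<in> schwartz_op (x_diff h)"
proof -
  note s = schwartz_gauss2[OF assms, of "hermite h j" "hermite h k"]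
  have "(abs_L2 (gauss2 h (hermite h j) (hermite h k)), abs_L2 (x_diff h (gauss2 h (hermite h j) (hermite h k))))
      \<in> schwartz_op (x_diff h)"
    unfolding schwartz_op_def using s by blast
  thus ?thesis
    unfolding abs_L2_sphere_diff[OF s] abs_L2_a_hermite[OF assms] hvec2_eq[OF assms, symmetric]
    by (simp only: scaleC_add_right)
qed

lemma y_diff_hvec2:
  assumes "h > 0"
  shows "(hvec2 h j k, (complex_of_real h / (2 * \<i>)) *\<^sub>C (complex_of_real (sqrt (real j * real (Suc k))) *\<^sub>C hvec2 h (j - 1) (Suc k)
    - complex_of_real (sqrt (real k * real (Suc j))) *\<^sub>C hvec2 h (Suc j) (k - 1))) \<in> schwartz_op (y_diff h)"
proof -
  note s = schwartz_gauss2[OF assms, of "hermite h j" "hermite h k"]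
  have "(abs_L2 (gauss2 h (hermite h j) (hermite h k)), abs_L2 (y_diff h (gauss2 h (hermite h j) (hermite h k))))
      \<in> schwartz_op (y_diff h)"
    unfolding schwartz_op_def using s by blast
  thus ?thesis
    unfolding abs_L2_sphere_diff[OF s] abs_L2_a_hermite[OF assms] hvec2_eq[OF assms, symmetric]
    by (simp only: complex_vector.scale_right_diff_distrib minus_divide_left[symmetric]
        complex_vector.scale_minus_left add_uminus_conv_diff)
qed

lemma z_diff_hvec2:
  assumes "h > 0"
  shows "(hvec2 h j k, complex_of_real (h / 2 * (real j - real k)) *\<^sub>C hvec2 h j k) \<in> schwartz_op (z_diff h)"
proof -
  note s = schwartz_gauss2[OF assms, of "hermite h j" "hermite h k"]
  have "(abs_L2 (gauss2 h (hermite h j) (hermite h k)), abs_L2 (z_diff h (gauss2 h (hermite h j) (hermite h k))))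
      \<in> schwartz_op (z_diff h)"
    unfolding schwartz_op_def using s by blast
  moreover have "complex_of_real (h / 2) * complex_of_real (real (Suc j))
      + - complex_of_real (h / 2) * complex_of_real (real (Suc k)) = complex_of_real (h / 2 * (real j - real k))"
    by (simp add: field_simps)
  ultimately show ?thesis
    unfolding abs_L2_sphere_diff[OF s] abs_L2_a_hermite[OF assms] hvec2_eq[OF assms, symmetric]
    by (simp only: scaleC_scaleC scaleC_add_left[symmetric])
qed

lemma L_diff_hvec2:
  assumes "h > 0"
  shows "(hvec2 h j k, complex_of_real (h * (real j + real k + 1)) *\<^sub>C hvec2 h j k) \<in> schwartz_op (L_diff h)"
proof -
  let ?P = "hermite h j" and ?Q = "hermite h k"
  let ?O = "\<lambda>p. smult (- (h\<^sup>2 / 2)) (gauss_deriv h (gauss_deriv h p)) + smult (1 / 2) (pCons 0 (pCons 0 p))"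
  have "L_diff h (gauss2 h ?P ?Q) = (\<lambda>z. gauss2 h (?O ?P) ?Q z + gauss2 h ?P (?O ?Q) z)"
    unfolding L_diff_altdef partial_gauss2[OF assms] coord_mult_gauss2
    by (rule ext) (simp only: gauss2_def gauss_add gauss_smult, simp add: algebra_simps)
  also have "\<dots> = (\<lambda>z. complex_of_real (h * (real j + real k + 1)) * gauss2 h ?P ?Q z)"
    unfolding oscillator_hermite[OF assms]
    by (rule ext) (simp only: gauss2_def gauss_smult, simp add: algebra_simps)
  finally have "abs_L2 (L_diff h (gauss2 h ?P ?Q)) = complex_of_real (h * (real j + real k + 1)) *\<^sub>C hvec2 h j k"
    by (simp only: abs_L2_scaleC[symmetric] hvec2_eq[OF assms]
        schwartz_square_integrable_plane[OF schwartz_gauss2[OF assms]])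
  thus ?thesis
    unfolding schwartz_op_def hvec2_eq[OF assms] using schwartz_gauss2[OF assms] by force
qed

lemma csubspace_schwartz_op:
  assumes add: "\<And>f g. schwartz f \<Longrightarrow> schwartz g \<Longrightarrow> abs_L2 (D (\<lambda>x. f x + g x)) = abs_L2 (D f) + abs_L2 (D g)"
    and scale: "\<And>c f. schwartz f \<Longrightarrow> abs_L2 (D (\<lambda>x. c * f x)) = c *\<^sub>C abs_L2 (D f)"
    and sq: "\<And>f :: 'a \<Rightarrow> complex. schwartz f \<Longrightarrow> square_integrable f"
    and ne: "schwartz (f0 :: 'a::euclidean_space \<Rightarrow> complex)"
  shows "csubspace (schwartz_op D :: 'a operator)"
proof (rule complex_vector.subspaceI)
  have scl: "c *\<^sub>C p \<in> schwartz_op D" if p: "p \<in> schwartz_op D" for c and p :: "'a L2 \<times> 'a L2"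
  proof -
    obtain f where f: "schwartz f" "p = (abs_L2 f, abs_L2 (D f))" using p by (auto simp: schwartz_op_def)
    have "c *\<^sub>C p = (abs_L2 (\<lambda>x. c * f x), abs_L2 (D (\<lambda>x. c * f x)))"
      by (simp add: f scaleC_prod_def scale abs_L2_scaleC sq)
    thus ?thesis unfolding schwartz_op_def using schwartz_scale[OF f(1)] by blast
  qed
  show "c *\<^sub>C p \<in> schwartz_op D" if "p \<in> schwartz_op D" for c and p :: "'a L2 \<times> 'a L2"
    by (rule scl[OF that])
  have "0 *\<^sub>C (abs_L2 f0, abs_L2 (D f0)) \<in> schwartz_op D"
    by (rule scl) (use ne in \<open>auto simp: schwartz_op_def\<close>)
  thus "0 \<in> schwartz_op D" by simp
  fix p q :: "'a L2 \<times> 'a L2" assume pq: "p \<in> schwartz_op D" "q \<in> schwartz_op D"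
  obtain f where f: "schwartz f" "p = (abs_L2 f, abs_L2 (D f))" using pq by (auto simp: schwartz_op_def)
  obtain g where g: "schwartz g" "q = (abs_L2 g, abs_L2 (D g))" using pq by (auto simp: schwartz_op_def)
  have "p + q = (abs_L2 (\<lambda>x. f x + g x), abs_L2 (D (\<lambda>x. f x + g x)))"
    by (simp add: f g add abs_L2_add sq)
  thus "p + q \<in> schwartz_op D" unfolding schwartz_op_def using schwartz_add[OF f(1) g(1)] by blast
qed

lemma csubspace_schwartz_op_L_diff:
  shows "csubspace (schwartz_op (L_diff h))"
proof (rule csubspace_schwartz_op)
  have s: "schwartz (partial e1 f)" "schwartz (partial e2 f)" "schwartz (coord_mult c f)"
    if "schwartz f" for c and f :: "plane \<Rightarrow> complex"
    by (intro schwartz_partial schwartz_coord_mult that e_Basis)+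
  have sL: "schwartz (L_diff h f)" if "schwartz f" for f
    unfolding L_diff_altdef by (intro schwartz_lin_comb schwartz_add s that)
  have p_add: "partial b (\<lambda>x. f x + g x) = (\<lambda>x. partial b f x + partial b g x)"
    if "schwartz f" "schwartz g" for b :: plane and f g
    using that by (auto simp: partial_add schwartz_differentiable)
  have p_scale: "partial b (\<lambda>x. c * f x) = (\<lambda>x. c * partial b f x)"
    if "schwartz f" for b :: plane and c f
    using that by (auto simp: partial_scale schwartz_differentiable)
  fix f g :: "plane \<Rightarrow> complex" and c
  assume f: "schwartz f"
  have "L_diff h (\<lambda>x. c * f x) = (\<lambda>x. c * L_diff h f x)"
    by (simp add: L_diff_altdef coord_mult_def p_scale f s fun_eq_iff algebra_simps add_divide_distrib)
  thus "abs_L2 (L_diff h (\<lambda>x. c * f x)) = c *\<^sub>C abs_L2 (L_diff h f)"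
    by (simp add: abs_L2_scaleC schwartz_square_integrable_plane sL f)
  assume g: "schwartz g"
  have "L_diff h (\<lambda>x. f x + g x) = (\<lambda>x. L_diff h f x + L_diff h g x)"
    by (simp add: L_diff_altdef coord_mult_def p_add f g s fun_eq_iff algebra_simps add_divide_distrib)
  thus "abs_L2 (L_diff h (\<lambda>x. f x + g x)) = abs_L2 (L_diff h f) + abs_L2 (L_diff h g)"
    by (simp add: abs_L2_add schwartz_square_integrable_plane sL f g)
next
  show "schwartz (gauss2 1 0 0)" by (rule schwartz_gauss2) simp
qed (rule schwartz_square_integrable_plane)

lemma hvec2_complete:
  assumes "h > 0" "\<And>j k. cinner u (hvec2 h j k) = 0"
  shows "u = 0"
  using tensor_complete[of "hvec h" "hvec h" u] hvec_complete[OF assms(1)] assms(2)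
  by (auto simp: hvec2_def)

lemma cinner_hvec2:
  "h > 0 \<Longrightarrow> cinner (hvec2 h j k) (hvec2 h j' k') = (if j = j' \<and> k = k' then 1 else 0)"
  by (simp add: hvec2_def cinner_tensor cinner_hvec)

text \<open>
  The closure of \<open>L\<close> on the Schwartz functions is diagonal in the products of Hermite functions,
  with eigenvalue \<open>h (j + k + 1)\<close>, which equals 2 exactly for \<open>j + k = n\<close>.
\<close>

lemma sphere_space_hvec2:
  assumes h: "h > 0" and n: "2 = h * (real n + 1)"
  shows "sphere_space h = {v. \<forall>j k. j + k \<noteq> n \<longrightarrow> cinner v (hvec2 h j k) = 0}"
    "sphere_space h = cspan ((\<lambda>j. hvec2 h j (n - j)) ` {..n})"
proof -
  interpret orthonormal_family "\<lambda>(j, k). hvec2 h j k" UNIV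
    by standard (auto simp: cinner_hvec2 h split: if_splits)
  have K: "v \<in> K" for v
  proof -
    obtain w where w: "w \<in> K" "\<And>j k. cinner w (hvec2 h j k) = cinner v (hvec2 h j k)"
      using riesz_fischer[OF coeff_summable[of v]] by auto
    have "v - w = 0"
      by (rule hvec2_complete[OF h]) (simp add: cinner_diff_left w)
    with w show ?thesis by simp
  qed
  have cl: "closure (schwartz_op (L_diff h)) = diag_op (\<lambda>(j, k). h * (real j + real k + 1))"
  proof (rule closure_eq_diag_op)
    fix v w and i :: "nat \<times> nat"
    assume vw: "(v, w) \<in> schwartz_op (L_diff h)"
    obtain j k where i: "i = (j, k)" by fastforce
    show "cinner w (case i of (j, k) \<Rightarrow> hvec2 h j k)
        = complex_of_real (case i of (j, k) \<Rightarrow> h * (real j + real k + 1)) * cinner v (case i of (j, k) \<Rightarrow> hvec2 h j k)"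
      using symmetric_operatorD[OF symmetric_L_diff vw L_diff_hvec2[OF h]]
      unfolding i prod.case by (simp only: cinner_scaleC_right complex_cnj_complex_of_real)
  qed (use K L_diff_hvec2[OF h] csubspace_schwartz_op_L_diff in auto)
  have 2: "complex_of_real (h * (real j + real k + 1)) = 2 \<longleftrightarrow> j + k = n" for j k
  proof -
    have "complex_of_real (h * (real j + real k + 1)) = 2 \<longleftrightarrow> h * (real j + real k + 1) = h * (real n + 1)"
      unfolding n[symmetric] by (metis of_real_eq_iff of_real_numeral)
    thus ?thesis using h by auto
  qed
  show "sphere_space h = {v. \<forall>j k. j + k \<noteq> n \<longrightarrow> cinner v (hvec2 h j k) = 0}"
    unfolding sphere_space_def cl eigenspace_diag_op using K 2 by auto
  have I: "{i \<in> UNIV. complex_of_real (case i of (j, k) \<Rightarrow> h * (real j + real k + 1)) = 2} = (\<lambda>j. (j, n - j)) ` {..n}"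
    by (auto simp: 2 image_iff n[symmetric] simp del: of_real_mult of_real_add)
  show "sphere_space h = cspan ((\<lambda>j. hvec2 h j (n - j)) ` {..n})"
    unfolding sphere_space_def cl
    by (subst eigenspace_diag_op_finite) (simp_all only: I finite_imageI finite_atMost image_image prod.case)
qed

section \<open>Symmetric operators on tensor products\<close>

lemma symmetric_operator_cspan:
  assumes "symmetric_operator G" shows "symmetric_operator (cspan G)"
proof -
  have 1: "cinner (snd p) (fst q) = cinner (fst p) (snd q)" if q: "q \<in> G" and p: "p \<in> cspan G" for p q
    using p
  proof (induction rule: complex_vector.span_induct_alt)
    case (step c x y)
    have "cinner (snd x) (fst q) = cinner (fst x) (snd q)"
      using symmetric_operatorD[OF assms, of "fst x" "snd x" "fst q" "snd q"] step(1) q by simp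
    thus ?case using step by (simp add: scaleC_prod_def cinner_simps)
  qed simp
  have "cinner (snd p) (fst q) = cinner (fst p) (snd q)" if p: "p \<in> cspan G" and q: "q \<in> cspan G" for p q
    using q
  proof (induction rule: complex_vector.span_induct_alt)
    case (step c x y)
    have "cinner (snd p) (fst x) = cinner (fst p) (snd x)" by (rule 1[OF step(1) p])
    thus ?case using step by (simp add: scaleC_prod_def cinner_simps)
  qed simp
  thus ?thesis by (auto simp: symmetric_operator_def)
qed

lemma symmetric_op_tensor:
  assumes "symmetric_operator A" "symmetric_operator B"
  shows "symmetric_operator (op_tensor A B)"
  unfolding op_tensor_def
proof (rule symmetric_operator_cspan)
  show "symmetric_operator {(v \<otimes>\<^sub>2 u, w \<otimes>\<^sub>2 y) |v w u y. (v, w) \<in> A \<and> (u, y) \<in> B}"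
    unfolding symmetric_operator_def
    by (auto simp: cinner_tensor symmetric_operatorD[OF assms(1)] symmetric_operatorD[OF assms(2)])
qed

lemma symmetric_op_add:
  "symmetric_operator A \<Longrightarrow> symmetric_operator B \<Longrightarrow> symmetric_operator (op_add A B)"
  unfolding symmetric_operator_def op_add_def by (fastforce simp: cinner_simps)

lemma symmetric_op_scale:
  "symmetric_operator A \<Longrightarrow> cnj c = c \<Longrightarrow> symmetric_operator (op_scale c A)"
  unfolding symmetric_operator_def op_scale_def by (fastforce simp: cinner_simps)

lemma symmetric_op_restrict: "symmetric_operator A \<Longrightarrow> symmetric_operator (op_restrict S A)"
  unfolding symmetric_operator_def op_restrict_def by fast

lemma symmetric_Id_on: "symmetric_operator (Id_on S)"
  by (auto simp: symmetric_operator_def)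

lemma symmetric_schwartz_id: "symmetric_operator (schwartz_op id)"
  by (rule symmetric_schwartz_op) simp

lemma csubspace_op_tensor: "csubspace (op_tensor A B)"
  by (simp add: op_tensor_def)

lemma csubspace_op_add:
  assumes "csubspace A" "csubspace B" shows "csubspace (op_add A B)"
proof (rule complex_vector.subspaceI)
  have "(0 :: 'a L2 \<times> 'a L2) = (0, 0 + 0)" by (simp add: zero_prod_def)
  thus "0 \<in> op_add A B"
    using complex_vector.subspace_0[OF assms(1)] complex_vector.subspace_0[OF assms(2)]
    unfolding op_add_def zero_prod_def by blast
next
  fix p q assume "p \<in> op_add A B" "q \<in> op_add A B"
  then obtain v w w' u y y' where p: "p = (v, w + w')" "(v, w) \<in> A" "(v, w') \<in> B"
      and q: "q = (u, y + y')" "(u, y) \<in> A" "(u, y') \<in> B"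
    by (auto simp: op_add_def)
  have "(v + u, w + y) \<in> A" "(v + u, w' + y') \<in> B"
    using complex_vector.subspace_add[OF assms(1) p(2) q(2)] complex_vector.subspace_add[OF assms(2) p(3) q(3)]
    by simp_all
  moreover have "p + q = (v + u, (w + y) + (w' + y'))" by (simp add: p q)
  ultimately show "p + q \<in> op_add A B" unfolding op_add_def by blast
next
  fix c p assume "p \<in> op_add A B"
  then obtain v w w' where p: "p = (v, w + w')" "(v, w) \<in> A" "(v, w') \<in> B"
    by (auto simp: op_add_def)
  have "(c *\<^sub>C v, c *\<^sub>C w) \<in> A" "(c *\<^sub>C v, c *\<^sub>C w') \<in> B"
    using complex_vector.subspace_scale[OF assms(1) p(2)] complex_vector.subspace_scale[OF assms(2) p(3)]
    by (simp_all add: scaleC_prod_def)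
  moreover have "c *\<^sub>C p = (c *\<^sub>C v, c *\<^sub>C w + c *\<^sub>C w')" by (simp add: p scaleC_prod_def scaleC_add_right)
  ultimately show "c *\<^sub>C p \<in> op_add A B" unfolding op_add_def by blast
qed

lemma csubspace_op_scale:
  assumes "csubspace A" shows "csubspace (op_scale c A)"
proof (rule complex_vector.subspaceI)
  have "(0 :: 'a L2 \<times> 'a L2) = (0, c *\<^sub>C 0)" by (simp add: zero_prod_def)
  thus "0 \<in> op_scale c A"
    using complex_vector.subspace_0[OF assms] unfolding op_scale_def zero_prod_def by blast
next
  fix p q assume "p \<in> op_scale c A" "q \<in> op_scale c A"
  then obtain v w u y where p: "p = (v, c *\<^sub>C w)" "(v, w) \<in> A" and q: "q = (u, c *\<^sub>C y)" "(u, y) \<in> A"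
    by (auto simp: op_scale_def)
  have "(v + u, w + y) \<in> A" using complex_vector.subspace_add[OF assms p(2) q(2)] by simp
  moreover have "p + q = (v + u, c *\<^sub>C (w + y))" by (simp add: p q scaleC_add_right)
  ultimately show "p + q \<in> op_scale c A" unfolding op_scale_def by blast
next
  fix d p assume "p \<in> op_scale c A"
  then obtain v w where p: "p = (v, c *\<^sub>C w)" "(v, w) \<in> A" by (auto simp: op_scale_def)
  have "(d *\<^sub>C v, d *\<^sub>C w) \<in> A"
    using complex_vector.subspace_scale[OF assms p(2)] by (simp add: scaleC_prod_def)
  moreover have "d *\<^sub>C p = (d *\<^sub>C v, c *\<^sub>C d *\<^sub>C w)" by (simp add: p scaleC_prod_def mult.commute)
  ultimately show "d *\<^sub>C p \<in> op_scale c A" unfolding op_scale_def by blast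
qed

lemma op_tensor_intro:
  "(v, w) \<in> A \<Longrightarrow> (u, y) \<in> B \<Longrightarrow> (v \<otimes>\<^sub>2 u, w \<otimes>\<^sub>2 y) \<in> op_tensor A B"
  unfolding op_tensor_def by (rule complex_vector.span_base) blast

lemma csubspace_Times:
  assumes "csubspace V" "csubspace W" shows "csubspace (V \<times> W)"
proof (rule complex_vector.subspaceI)
  show "0 \<in> V \<times> W"
    using assms by (simp add: zero_prod_def complex_vector.subspace_0)
  show "x + y \<in> V \<times> W" if "x \<in> V \<times> W" "y \<in> V \<times> W" for x y
    using that assms by (auto simp: complex_vector.subspace_add mem_Times_iff)
  show "c *\<^sub>C x \<in> V \<times> W" if "x \<in> V \<times> W" for c x
    using that assms by (auto simp: complex_vector.subspace_scale scaleC_prod_def mem_Times_iff)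
qed

lemma op_tensor_subset:
  assumes V: "csubspace V" and A: "A \<subseteq> S \<times> S" and S: "\<And>v u. v \<in> S \<Longrightarrow> v \<otimes>\<^sub>2 u \<in> V"
  shows "op_tensor A B \<subseteq> V \<times> V"
  unfolding op_tensor_def
  by (rule complex_vector.span_minimal[OF _ csubspace_Times[OF V V]]) (use A S in auto)

lemma tensor_sum_right: "w \<otimes>\<^sub>2 (\<Sum>i\<in>F. f i) = (\<Sum>i\<in>F. w \<otimes>\<^sub>2 f i)"
  by (induction F rule: infinite_finite_induct) (auto simp: tensor_simps)

lemma hvec_expansion:
  assumes h: "h > 0"
  shows "((\<lambda>m. cinner u (hvec h m) *\<^sub>C hvec h m) has_sum u) UNIV"
proof -
  interpret orthonormal_family "hvec h" UNIV
    by standard (auto simp: cinner_hvec h split: if_splits)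
  obtain w where w: "w \<in> K" "\<And>j. cinner w (hvec h j) = cinner u (hvec h j)"
    using riesz_fischer[OF coeff_summable[of u]] by auto
  have "u - w = 0"
    by (rule hvec_complete[OF h]) (simp add: cinner_diff_left w)
  hence "u \<in> K" using w by simp
  thus ?thesis by (rule fourier_expansion)
qed

lemma (in orthonormal_family) orthonormal_independent:
  assumes "finite F" "F \<subseteq> I"
  shows "inj_on e F" "\<not> cdependent (e ` F)"
proof -
  show inj: "inj_on e F"
  proof (rule inj_onI)
    fix i j assume ij: "i \<in> F" "j \<in> F" "e i = e j"
    have I: "i \<in> I" "j \<in> I" using ij assms by auto
    have "cinner (e i) (e j) = 1" using ij ortho[OF I(1,1)] by simp
    thus "i = j" using ortho[OF I] by (metis zero_neq_one)
  qed
  show "\<not> cdependent (e ` F)"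
  proof
    assume "cdependent (e ` F)"
    then obtain c where c: "\<exists>v\<in>e ` F. c v \<noteq> 0" "(\<Sum>v\<in>e ` F. c v *\<^sub>C v) = 0"
      using assms by (subst (asm) complex_vector.dependent_finite) auto
    have z: "(\<Sum>i\<in>F. c (e i) *\<^sub>C e i) = 0"
      using c(2) by (subst (asm) sum.reindex[OF inj]) simp
    have "c (e i) = 0" if "i \<in> F" for i
      using cinner_lin_comb[OF assms, of i "\<lambda>i. c (e i)"] that assms z by auto
    with c(1) show False by auto
  qed
qed

section \<open>The spin-oscillator\<close>

locale spin_oscillator =
  fixes n :: nat and h :: real
  assumes h: "h > 0" and n: "2 = h * (real n + 1)"
begin

abbreviation S :: "plane L2 set" where "S \<equiv> sphere_space h"

abbreviation sph :: "nat \<Rightarrow> plane L2" where "sph j \<equiv> hvec2 h j (n - j)"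

definition evec :: "nat \<times> nat \<Rightarrow> (plane \<times> real) L2"
  where "evec = (\<lambda>(j, m). sph j \<otimes>\<^sub>2 hvec h m)"

definition index :: "(nat \<times> nat) set"
  where "index = {..n} \<times> UNIV"

sublocale orthonormal_family evec index
  by standard (auto simp: evec_def index_def cinner_tensor cinner_hvec cinner_hvec2 h split: if_splits)

lemma sph_in_S: "j \<le> n \<Longrightarrow> sph j \<in> S"
  unfolding sphere_space_hvec2(2)[OF h n] by (rule complex_vector.span_base) auto

text \<open>
  Expand \<open>u\<close> in Hermite functions; tensoring with a fixed vector is continuous.
\<close>

lemma tensor_in_K:
  assumes "v \<in> S" shows "v \<otimes>\<^sub>2 u \<in> K"
proof -
  have "sph j \<otimes>\<^sub>2 u \<in> K" if "j \<le> n" for j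
  proof (rule Lim_in_closed_set[OF closed_K])
    show "((\<lambda>F. sph j \<otimes>\<^sub>2 (\<Sum>m\<in>F. cinner u (hvec h m) *\<^sub>C hvec h m)) \<longlongrightarrow> sph j \<otimes>\<^sub>2 u) (finite_subsets_at_top UNIV)"
      using hvec_expansion[OF h, of u] unfolding has_sum_def by (rule tendsto_tensor_right)
    have "sph j \<otimes>\<^sub>2 hvec h m \<in> K" for m
      using e_in_K[of "(j, m)"] that by (auto simp: evec_def index_def)
    thus "\<forall>\<^sub>F F in finite_subsets_at_top UNIV. sph j \<otimes>\<^sub>2 (\<Sum>m\<in>F. cinner u (hvec h m) *\<^sub>C hvec h m) \<in> K"
      by (intro always_eventually allI) (auto simp: tensor_sum_right tensor_simps intro!: K_sum K_scale)
  qed simp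
  note gen = this
  from assms show ?thesis
    unfolding sphere_space_hvec2(2)[OF h n]
  proof (induction rule: complex_vector.span_induct_alt)
    case (step c x y)
    thus ?case using gen by (auto simp: tensor_simps intro!: K_add K_scale)
  qed (simp add: tensor_simps K_zero)
qed

lemma space_eq_K: "spin_oscillator_space h = K"
proof
  have "cspan {v \<otimes>\<^sub>2 u |v u. v \<in> S} \<subseteq> K"
    by (rule complex_vector.span_minimal[OF _ csubspace_K]) (auto simp: tensor_in_K)
  thus "spin_oscillator_space h \<subseteq> K"
    unfolding spin_oscillator_space_def by (rule closure_minimal) (rule closed_K)
  have "evec ` index \<subseteq> {v \<otimes>\<^sub>2 u |v u. v \<in> S}"
    using sph_in_S by (auto simp: evec_def index_def)
  thus "K \<subseteq> spin_oscillator_space h"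
    unfolding spin_oscillator_space_def K_def by (intro closure_mono complex_vector.span_mono)
qed

text \<open>
  An operator that preserves the total degree \<open>j + k\<close> of the products of Hermite functions preserves
  the sphere space.  By symmetry this need only be checked on those products, whereas the elements
  of the operator's domain are arbitrary Schwartz functions.
\<close>

lemma sphere_invariant:
  assumes sym: "symmetric_operator (schwartz_op D)"
    and D: "\<And>j k. \<exists>c. (hvec2 h j k, c) \<in> schwartz_op D \<and>
      c \<in> cspan {hvec2 h j' k' |j' k'. j' + k' = j + k}"
  shows "op_restrict S (schwartz_op D) \<subseteq> S \<times> S"
proof -
  have "w \<in> S" if v: "v \<in> S" and vw: "(v, w) \<in> schwartz_op D" for v w
    unfolding sphere_space_hvec2(1)[OF h n]
  proof (intro CollectI allI impI)
    fix j k assume jk: "j + k \<noteq> n"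
    obtain c where c: "(hvec2 h j k, c) \<in> schwartz_op D" "c \<in> cspan {hvec2 h j' k' |j' k'. j' + k' = j + k}"
      using D by blast
    have "cinner v c = 0"
      using c(2)
    proof (induction rule: complex_vector.span_induct_alt)
      case (step a x y)
      have "cinner v x = 0"
        using step(1) v jk unfolding sphere_space_hvec2(1)[OF h n] by auto
      thus ?case using step by (simp add: cinner_simps)
    qed simp
    thus "cinner w (hvec2 h j k) = 0" using symmetric_operatorD[OF sym vw c(1)] by simp
  qed
  thus ?thesis unfolding op_restrict_def by auto
qed

lemma ladder_in_span:
  "complex_of_real (sqrt (real j * real (Suc k))) *\<^sub>C hvec2 h (j - 1) (Suc k)
    \<in> cspan {hvec2 h j' k' |j' k'. j' + k' = j + k}"
  "complex_of_real (sqrt (real k * real (Suc j))) *\<^sub>C hvec2 h (Suc j) (k - 1)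
    \<in> cspan {hvec2 h j' k' |j' k'. j' + k' = j + k}"
proof -
  show "complex_of_real (sqrt (real j * real (Suc k))) *\<^sub>C hvec2 h (j - 1) (Suc k)
    \<in> cspan {hvec2 h j' k' |j' k'. j' + k' = j + k}"
  proof (cases j)
    case (Suc i)
    hence "j - 1 + Suc k = j + k" by simp
    thus ?thesis by (intro complex_vector.span_scale complex_vector.span_base) blast
  qed (simp add: complex_vector.span_zero)
  show "complex_of_real (sqrt (real k * real (Suc j))) *\<^sub>C hvec2 h (Suc j) (k - 1)
    \<in> cspan {hvec2 h j' k' |j' k'. j' + k' = j + k}"
  proof (cases k)
    case (Suc i)
    hence "Suc j + (k - 1) = j + k" by simp
    thus ?thesis by (intro complex_vector.span_scale complex_vector.span_base) blast
  qed (simp add: complex_vector.span_zero)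
qed

lemma hat_subset: "x_hat h \<subseteq> S \<times> S" "y_hat h \<subseteq> S \<times> S" "z_hat h \<subseteq> S \<times> S"
proof -
  show "x_hat h \<subseteq> S \<times> S"
    unfolding x_hat_def
    by (rule sphere_invariant[OF symmetric_x_diff], rule exI, rule conjI, rule x_diff_hvec2[OF h])
      (intro complex_vector.span_scale complex_vector.span_add ladder_in_span)
  show "y_hat h \<subseteq> S \<times> S"
    unfolding y_hat_def
    by (rule sphere_invariant[OF symmetric_y_diff], rule exI, rule conjI, rule y_diff_hvec2[OF h])
      (intro complex_vector.span_scale[of "_ - _"] complex_vector.span_diff ladder_in_span)
  show "z_hat h \<subseteq> S \<times> S"
    unfolding z_hat_def
    by (rule sphere_invariant[OF symmetric_z_diff], rule exI, rule conjI, rule z_diff_hvec2[OF h])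
      (intro complex_vector.span_scale complex_vector.span_base, blast)
qed

definition J_core :: "(plane \<times> real) operator"
  where "J_core = op_add (op_tensor (Id_on S) (schwartz_op (oscillator_diff h))) (op_tensor (z_hat h) (schwartz_op id))"

definition H_core :: "(plane \<times> real) operator"
  where "H_core = op_scale (1 / 2) (op_add (op_tensor (x_hat h) (schwartz_op position_diff))
    (op_tensor (y_hat h) (schwartz_op (momentum_diff h))))"

lemma J_hat_eq: "J_hat h = closure J_core" and H_hat_eq: "H_hat h = closure H_core"
  by (simp_all add: J_hat_def J_core_def H_hat_def H_core_def)

lemma J_core_props: "J_core \<subseteq> K \<times> K" "csubspace J_core" "symmetric_operator J_core"
proof -
  have "op_tensor (Id_on S) (schwartz_op (oscillator_diff h)) \<subseteq> K \<times> K"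
      "op_tensor (z_hat h) (schwartz_op id) \<subseteq> K \<times> K"
    by (rule op_tensor_subset[where S = S, OF csubspace_K _ tensor_in_K]; use hat_subset(3) in blast)+
  thus "J_core \<subseteq> K \<times> K" unfolding J_core_def op_add_def by (auto intro!: K_add)
  show "csubspace J_core" unfolding J_core_def by (intro csubspace_op_add csubspace_op_tensor)
  show "symmetric_operator J_core"
    unfolding J_core_def z_hat_def
    by (intro symmetric_op_add symmetric_op_tensor symmetric_op_restrict symmetric_Id_on
        symmetric_oscillator symmetric_z_diff symmetric_schwartz_id)
qed

lemma H_core_props: "H_core \<subseteq> K \<times> K" "csubspace H_core" "symmetric_operator H_core"
proof -
  have "op_tensor (x_hat h) (schwartz_op position_diff) \<subseteq> K \<times> K"
      "op_tensor (y_hat h) (schwartz_op (momentum_diff h)) \<subseteq> K \<times> K"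
    by (rule op_tensor_subset[where S = S, OF csubspace_K _ tensor_in_K]; use hat_subset(1,2) in blast)+
  thus "H_core \<subseteq> K \<times> K" unfolding H_core_def op_add_def op_scale_def by (auto intro!: K_add K_scale)
  show "csubspace H_core" unfolding H_core_def by (intro csubspace_op_scale csubspace_op_add csubspace_op_tensor)
  show "symmetric_operator H_core"
    unfolding H_core_def x_hat_def y_hat_def
    by (intro symmetric_op_scale symmetric_op_add symmetric_op_tensor symmetric_op_restrict
        symmetric_x_diff symmetric_y_diff symmetric_position symmetric_momentum) simp
qed

definition level :: "nat \<times> nat \<Rightarrow> real"
  where "level = (\<lambda>(j, m). h * ((1 - real n) / 2 + real (j + m)))"

lemma level_eq_iff: "level (j, m) = level (j', m') \<longleftrightarrow> j + m = j' + m'"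
proof -
  have "level (j, m) = level (j', m') \<longleftrightarrow> real (j + m) = real (j' + m')"
    using h by (simp add: level_def del: of_nat_add)
  thus ?thesis by (simp only: of_nat_eq_iff)
qed

lemma J_core_evec:
  assumes "i \<in> index" shows "(evec i, complex_of_real (level i) *\<^sub>C evec i) \<in> J_core"
proof -
  obtain j m where i: "i = (j, m)" "j \<le> n" using assms by (auto simp: index_def)
  have 1: "(sph j \<otimes>\<^sub>2 hvec h m, sph j \<otimes>\<^sub>2 (complex_of_real (h * (real m + 1 / 2)) *\<^sub>C hvec h m))
      \<in> op_tensor (Id_on S) (schwartz_op (oscillator_diff h))"
    by (intro op_tensor_intro oscillator_hvec h) (use sph_in_S i in auto)
  have 2: "(sph j \<otimes>\<^sub>2 hvec h m, (complex_of_real (h / 2 * (real j - real (n - j))) *\<^sub>C sph j) \<otimes>\<^sub>2 hvec h m)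
      \<in> op_tensor (z_hat h) (schwartz_op id)"
  proof (intro op_tensor_intro)
    show "(sph j, complex_of_real (h / 2 * (real j - real (n - j))) *\<^sub>C sph j) \<in> z_hat h"
      unfolding z_hat_def op_restrict_def using z_diff_hvec2[OF h] sph_in_S i by blast
    show "(hvec h m, hvec h m) \<in> schwartz_op id"
      unfolding schwartz_op_def hvec_def using schwartz_gauss[OF h] by auto
  qed
  have "(sph j \<otimes>\<^sub>2 hvec h m, sph j \<otimes>\<^sub>2 (complex_of_real (h * (real m + 1 / 2)) *\<^sub>C hvec h m)
      + (complex_of_real (h / 2 * (real j - real (n - j))) *\<^sub>C sph j) \<otimes>\<^sub>2 hvec h m) \<in> J_core"
    unfolding J_core_def op_add_def using 1 2 by blast
  moreover have "h * (real m + 1 / 2) + h / 2 * (real j - real (n - j)) = level i"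
    using i by (simp add: level_def of_nat_diff field_simps)
  ultimately show ?thesis
    unfolding i(1) evec_def prod.case
    by (simp only: tensor_simps scaleC_add_left[symmetric] of_real_add[symmetric])
qed

definition Hcoef :: "nat \<Rightarrow> nat \<Rightarrow> complex"
  where "Hcoef l k = complex_of_real ((h / 2) powr (3 / 2) * beta n l k)"

text \<open>
  The image of \<open>evec (j, m)\<close> under the Hamiltonian, by \<open>H_core_evec\<close>.  Where an index \<open>j - 1\<close> or
  \<open>m - 1\<close> is truncated, or \<open>Suc j\<close> exceeds \<open>n\<close>, the coefficient vanishes.
\<close>

definition Hvec :: "nat \<times> nat \<Rightarrow> (plane \<times> real) L2"
  where "Hvec = (\<lambda>(j, m). Hcoef (j + m) j *\<^sub>C evec (j - 1, Suc m) + Hcoef (j + m) (Suc j) *\<^sub>C evec (Suc j, m - 1))"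

text \<open>
  With \<open>x = t (X + Y)\<close> and \<open>y = (t / i) (X - Y)\<close>, and likewise \<open>u = s (U + V)\<close> and
  \<open>p = (s / i) (U - V)\<close>, the mixed terms add up and the others cancel:
  \<open>(x \<otimes> u + y \<otimes> p) / 2 = t s (X \<otimes> V + Y \<otimes> U)\<close>.  This is the rotating-wave form of the coupling,
  which conserves \<open>j + m\<close>.
\<close>

lemma ladder_combination:
  fixes A B :: "plane L2" and C D :: "real L2" and s a c b d :: complex and t :: real
  shows "(1 / 2) *\<^sub>C ((complex_of_real t *\<^sub>C (a *\<^sub>C A + b *\<^sub>C B)) \<otimes>\<^sub>2 (s *\<^sub>C (c *\<^sub>C C + d *\<^sub>C D))
    + ((complex_of_real t / \<i>) *\<^sub>C (a *\<^sub>C A - b *\<^sub>C B)) \<otimes>\<^sub>2 ((s / \<i>) *\<^sub>C (c *\<^sub>C C - d *\<^sub>C D)))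
    = (complex_of_real t * s * (a * d)) *\<^sub>C (A \<otimes>\<^sub>2 D) + (complex_of_real t * s * (b * c)) *\<^sub>C (B \<otimes>\<^sub>2 C)"
proof -
  define x y where "x = complex_of_real t * s * (a * d)" and "y = complex_of_real t * s * (b * c)"
  have "(1 / 2) *\<^sub>C ((complex_of_real t *\<^sub>C (a *\<^sub>C A + b *\<^sub>C B)) \<otimes>\<^sub>2 (s *\<^sub>C (c *\<^sub>C C + d *\<^sub>C D))
    + ((complex_of_real t / \<i>) *\<^sub>C (a *\<^sub>C A - b *\<^sub>C B)) \<otimes>\<^sub>2 ((s / \<i>) *\<^sub>C (c *\<^sub>C C - d *\<^sub>C D)))
    = (y / 2) *\<^sub>C (B \<otimes>\<^sub>2 C) + (x / 2) *\<^sub>C (A \<otimes>\<^sub>2 D) + ((x / 2) *\<^sub>C (A \<otimes>\<^sub>2 D) + (y / 2) *\<^sub>C (B \<otimes>\<^sub>2 C))"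
    by (simp add: tensor_simps scaleC_add_right complex_vector.scale_right_diff_distrib mult_ac x_def y_def)
  also have "\<dots> = ((x / 2) *\<^sub>C (A \<otimes>\<^sub>2 D) + (x / 2) *\<^sub>C (A \<otimes>\<^sub>2 D))
      + ((y / 2) *\<^sub>C (B \<otimes>\<^sub>2 C) + (y / 2) *\<^sub>C (B \<otimes>\<^sub>2 C))"
    by (simp only: add_ac)
  also have "\<dots> = x *\<^sub>C (A \<otimes>\<^sub>2 D) + y *\<^sub>C (B \<otimes>\<^sub>2 C)"
    unfolding scaleC_add_left[symmetric] by simp
  finally show ?thesis by (simp only: x_def y_def)
qed

text \<open>
  With \<open>k = n - j\<close> the coefficients are \<open>sqrt (j (k+1)) sqrt (m+1)\<close> and \<open>sqrt (k (j+1)) sqrt m\<close>,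
  which are the numbers \<open>beta\<close> at \<open>j\<close> and \<open>j + 1\<close> for \<open>l = j + m\<close>.
\<close>

lemma H_core_evec:
  assumes "i \<in> index" shows "(evec i, Hvec i) \<in> H_core"
proof -
  obtain j m where i: "i = (j, m)" "j \<le> n" using assms by (auto simp: index_def)
  define k where "k = n - j"
  define a b c d where "a = complex_of_real (sqrt (real j * real (Suc k)))"
    and "b = complex_of_real (sqrt (real k * real (Suc j)))"
    and "c = complex_of_real (sqrt (real m))" and "d = complex_of_real (sqrt (real (Suc m)))"
  define A B C D where "A = hvec2 h (j - 1) (Suc k)" and "B = hvec2 h (Suc j) (k - 1)"
    and "C = hvec h (m - 1)" and "D = hvec h (Suc m)"
  define s where "s = complex_of_real (sqrt (h / 2))"
  note defs = a_def b_def c_def d_def A_def B_def C_def D_def s_def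
  have S: "hvec2 h j k \<in> S" using sph_in_S[OF i(2)] by (simp add: k_def)
  have x: "(hvec2 h j k, complex_of_real (h / 2) *\<^sub>C (a *\<^sub>C A + b *\<^sub>C B)) \<in> x_hat h"
    unfolding x_hat_def op_restrict_def defs using x_diff_hvec2[OF h] S by blast
  have h2: "complex_of_real h / (2 * \<i>) = complex_of_real (h / 2) / \<i>" by simp
  have y: "(hvec2 h j k, (complex_of_real (h / 2) / \<i>) *\<^sub>C (a *\<^sub>C A - b *\<^sub>C B)) \<in> y_hat h"
    unfolding y_hat_def op_restrict_def defs h2[symmetric] using y_diff_hvec2[OF h] S by blast
  have u: "(hvec h m, s *\<^sub>C (c *\<^sub>C C + d *\<^sub>C D)) \<in> schwartz_op position_diff"
    unfolding defs by (rule position_hvec[OF h])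
  have p: "(hvec h m, (s / \<i>) *\<^sub>C (c *\<^sub>C C - d *\<^sub>C D)) \<in> schwartz_op (momentum_diff h)"
    unfolding defs by (rule momentum_hvec[OF h])
  have "(hvec2 h j k \<otimes>\<^sub>2 hvec h m, (1 / 2) *\<^sub>C
      ((complex_of_real (h / 2) *\<^sub>C (a *\<^sub>C A + b *\<^sub>C B)) \<otimes>\<^sub>2 (s *\<^sub>C (c *\<^sub>C C + d *\<^sub>C D))
      + ((complex_of_real (h / 2) / \<i>) *\<^sub>C (a *\<^sub>C A - b *\<^sub>C B)) \<otimes>\<^sub>2 ((s / \<i>) *\<^sub>C (c *\<^sub>C C - d *\<^sub>C D)))) \<in> H_core"
    unfolding H_core_def op_scale_def op_add_def
    using op_tensor_intro[OF x u] op_tensor_intro[OF y p] by blast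
  hence H_core: "(evec i, (complex_of_real (h / 2) * s * (a * d)) *\<^sub>C (A \<otimes>\<^sub>2 D)
      + (complex_of_real (h / 2) * s * (b * c)) *\<^sub>C (B \<otimes>\<^sub>2 C)) \<in> H_core"
    unfolding ladder_combination i(1) evec_def prod.case k_def .
  have r: "(h / 2) powr (3 / 2) = h / 2 * sqrt (h / 2)"
  proof -
    have "(h / 2) powr (3 / 2) = (h / 2) powr (1 + 1 / 2)" by simp
    also have "\<dots> = (h / 2) powr 1 * (h / 2) powr (1 / 2)" by (rule powr_add)
    finally show ?thesis using h by (simp add: powr_half_sqrt)
  qed
  have kn: "real k = real n - real j" using i(2) by (simp add: k_def of_nat_diff)
  have t1: "complex_of_real (h / 2) * s * (a * d) = Hcoef (j + m) j"
  proof -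
    have "sqrt (real j * real (Suc k)) * sqrt (real (Suc m)) = beta n (j + m) j"
      unfolding beta_def real_sqrt_mult[symmetric] by (simp add: kn algebra_simps)
    thus ?thesis unfolding Hcoef_def r defs by (metis of_real_mult)
  qed
  have t2: "complex_of_real (h / 2) * s * (b * c) = Hcoef (j + m) (Suc j)"
  proof -
    have "sqrt (real k * real (Suc j)) * sqrt (real m) = beta n (j + m) (Suc j)"
      unfolding beta_def real_sqrt_mult[symmetric] by (simp add: kn algebra_simps)
    thus ?thesis unfolding Hcoef_def r defs by (metis of_real_mult)
  qed
  have e1': "Hcoef (j + m) j *\<^sub>C (A \<otimes>\<^sub>2 D) = Hcoef (j + m) j *\<^sub>C evec (j - 1, Suc m)"
    using i(2) by (cases j) (auto simp: Hcoef_def beta_def defs evec_def k_def Suc_diff_Suc)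
  have e2': "B \<otimes>\<^sub>2 C = evec (Suc j, m - 1)"
    by (simp add: defs evec_def k_def)
  show ?thesis
    using H_core unfolding t1 t2 e1' e2' by (simp add: Hvec_def i)
qed

lemma Hvec_in_level:
  assumes "i \<in> index" shows "Hvec i \<in> cspan (evec ` {i' \<in> index. level i' = level i})"
proof -
  obtain j m where i: "i = (j, m)" "j \<le> n" using assms by (auto simp: index_def)
  have "Hcoef (j + m) j *\<^sub>C evec (j - 1, Suc m) \<in> cspan (evec ` {i' \<in> index. level i' = level i})"
  proof (cases j)
    case 0
    thus ?thesis by (simp add: Hcoef_def beta_def complex_vector.span_zero)
  next
    case (Suc j')
    thus ?thesis using i
      by (intro complex_vector.span_scale complex_vector.span_base imageI) (auto simp: level_eq_iff index_def)
  qed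
  moreover have "Hcoef (j + m) (Suc j) *\<^sub>C evec (Suc j, m - 1) \<in> cspan (evec ` {i' \<in> index. level i' = level i})"
  proof (cases "m = 0 \<or> j = n")
    case True
    hence "Hcoef (j + m) (Suc j) = 0" by (auto simp: Hcoef_def beta_def)
    thus ?thesis by (simp add: complex_vector.span_zero)
  next
    case False
    thus ?thesis using i
      by (intro complex_vector.span_scale complex_vector.span_base imageI) (auto simp: level_eq_iff index_def)
  qed
  ultimately show ?thesis unfolding i(1) Hvec_def prod.case by (intro complex_vector.span_add)
qed

text \<open>
  The pairs \<open>(k, l - k)\<close> with \<open>k \<le> n\<close> and \<open>k \<le> l\<close>: this is where \<open>min l n\<close> comes from.
\<close>

lemma level_set: "{i \<in> index. level i = h * ((1 - real n) / 2 + real l)} = (\<lambda>k. (k, l - k)) ` {..min l n}"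
  using h by (auto simp: index_def level_def image_iff simp del: of_nat_add)

lemma level_set_finite: "finite {i \<in> index. level i = x}"
proof (cases "\<exists>l. x = h * ((1 - real n) / 2 + real l)")
  case True
  thus ?thesis using level_set by force
next
  case False
  hence "{i \<in> index. level i = x} = {}" by (auto simp: level_def simp del: of_nat_add)
  thus ?thesis by (simp only: finite.emptyI)
qed

lemma J_hat_diag: "J_hat h = diag_op level"
  and H_hat_self_adjoint: "self_adjoint K (H_hat h)"
  and J_H_commute: "operators_commute K (J_hat h) (H_hat h)"
  unfolding J_hat_eq H_hat_eq
  by (rule simultaneous_diagonalization[OF J_core_props H_core_props J_core_evec H_core_evec Hvec_in_level level_set_finite]; assumption)+

lemma level_image: "level ` index = range (\<lambda>k. h * ((1 - real n) / 2 + real k))"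
proof (intro set_eqI iffI)
  fix x assume "x \<in> range (\<lambda>k. h * ((1 - real n) / 2 + real k))"
  then obtain k where "x = level (0, k)" by (auto simp: level_def)
  thus "x \<in> level ` index" by (auto simp: index_def)
qed (auto simp: level_def simp del: of_nat_add)

lemma spectrum_J_set:
  "complex_of_real ` level ` index = {complex_of_real (h * ((1 - real n) / 2 + real k)) |k::nat. True}"
  unfolding level_image image_image by blast

lemma uniform_discrete_levels: "uniform_discrete (complex_of_real ` level ` index)"
  unfolding uniform_discrete_def
proof (intro exI[of _ h] conjI ballI impI h)
  fix x y assume xy: "x \<in> complex_of_real ` level ` index" "y \<in> complex_of_real ` level ` index" "dist x y < h"
  obtain k k' :: nat where k: "x = complex_of_real (h * ((1 - real n) / 2 + real k))"
      "y = complex_of_real (h * ((1 - real n) / 2 + real k'))"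
    using xy(1,2) unfolding spectrum_J_set by blast
  have "dist x y = \<bar>h * ((1 - real n) / 2 + real k) - h * ((1 - real n) / 2 + real k')\<bar>"
    unfolding k dist_of_real dist_real_def ..
  also have "h * ((1 - real n) / 2 + real k) - h * ((1 - real n) / 2 + real k') = h * (real k - real k')"
    by (simp add: algebra_simps)
  finally have "\<bar>real k - real k'\<bar> < 1" using xy(3) h by (simp add: abs_mult)
  hence "k = k'" by linarith
  thus "x = y" by (simp add: k)
qed

lemma spectrum_J: "spectrum K (J_hat h) = complex_of_real ` level ` index"
  unfolding J_hat_diag by (intro spectrum_diag_op uniform_discrete_imp_closed uniform_discrete_levels)

lemma eigenspace_J:
  fixes l :: nat
  defines "b \<equiv> \<lambda>k. evec (k, l - k)" and "mu \<equiv> min l n"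
    and "lam \<equiv> complex_of_real (h * ((1 - real n) / 2 + real l))"
  shows "is_basis (eigenspace (J_hat h) lam) mu b"
    "cdim (eigenspace (J_hat h) lam) = mu + 1"
    "has_matrix (H_hat h) mu b (\<lambda>i j. complex_of_real ((h / 2) powr (3 / 2) * tridiagonal (beta n l) i j))"
proof -
  let ?c = "\<lambda>k. (k, l - k)"
  have set: "{i \<in> index. complex_of_real (level i) = lam} = ?c ` {..mu}"
    using level_set[of l] unfolding lam_def of_real_eq_iff mu_def .
  have b: "b ` {..mu} = evec ` ?c ` {..mu}" by (auto simp: b_def)
  have eig: "eigenspace (J_hat h) lam = cspan (b ` {..mu})"
    unfolding J_hat_diag b by (subst eigenspace_diag_op_finite) (simp_all only: set finite_imageI finite_atMost)
  have "?c ` {..mu} \<subseteq> index" using set by blast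
  note ind = orthonormal_independent[OF _ this]
  have inj: "inj_on b {..mu}"
  proof -
    have "inj_on (evec \<circ> ?c) {..mu}"
      by (rule comp_inj_on) (use ind(1) in \<open>auto simp: inj_on_def\<close>)
    thus ?thesis by (simp add: b_def o_def)
  qed
  have indep: "\<not> cdependent (b ` {..mu})" unfolding b by (rule ind(2)) simp
  show "is_basis (eigenspace (J_hat h) lam) mu b"
    using inj indep eig by (simp add: is_basis_def)
  show "cdim (eigenspace (J_hat h) lam) = mu + 1"
    unfolding eig complex_vector.dim_span_eq_card_independent[OF indep] by (simp add: card_image inj)
  show "has_matrix (H_hat h) mu b (\<lambda>i j. complex_of_real ((h / 2) powr (3 / 2) * tridiagonal (beta n l) i j))"
    unfolding has_matrix_def
  proof (intro allI impI)
    fix k assume k: "k \<le> mu"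
    let ?M = "\<lambda>i. complex_of_real ((h / 2) powr (3 / 2) * tridiagonal (beta n l) i k)"
    have "(b k, Hvec (k, l - k)) \<in> H_hat h"
      unfolding H_hat_eq b_def using k closure_subset H_core_evec[of "(k, l - k)"] by (auto simp: index_def mu_def)
    moreover have "Hvec (k, l - k) = (\<Sum>i\<le>mu. ?M i *\<^sub>C b i)"
    proof -
      have "(\<Sum>i\<le>mu. ?M i *\<^sub>C b i) = (\<Sum>i\<le>mu. (if i + 1 = k then Hcoef l k *\<^sub>C b (k - 1) else 0)
          + (if i = Suc k then Hcoef l (Suc k) *\<^sub>C b (Suc k) else 0))"
        by (rule sum.cong) (auto simp: tridiagonal_def Hcoef_def)
      also have "\<dots> = (\<Sum>i\<le>mu. (if i + 1 = k then Hcoef l k *\<^sub>C b (k - 1) else 0))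
          + (\<Sum>i\<le>mu. if i = Suc k then Hcoef l (Suc k) *\<^sub>C b (Suc k) else 0)"
        by (rule sum.distrib)
      \<comment> \<open>At the first column the entry above the diagonal is absent, and \<open>beta n l 0 = 0\<close>.\<close>
      also have "(\<Sum>i\<le>mu. (if i + 1 = k then Hcoef l k *\<^sub>C b (k - 1) else 0)) = Hcoef l k *\<^sub>C b (k - 1)"
      proof (cases k)
        case 0
        thus ?thesis by (simp add: Hcoef_def beta_def)
      next
        case (Suc k')
        thus ?thesis using k by simp
      qed
      \<comment> \<open>At the last column \<open>beta n l (mu + 1) = 0\<close>, since \<open>mu\<close> is \<open>l\<close> or \<open>n\<close>.\<close>
      also have "(\<Sum>i\<le>mu. if i = Suc k then Hcoef l (Suc k) *\<^sub>C b (Suc k) else 0) = Hcoef l (Suc k) *\<^sub>C b (Suc k)"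
      proof (cases "k = mu")
        case True
        have "Hcoef l (Suc k) = 0" unfolding True mu_def by (auto simp: Hcoef_def beta_def min_def)
        thus ?thesis using True by simp
      qed (use k in simp)
      also have "Hcoef l k *\<^sub>C b (k - 1) + Hcoef l (Suc k) *\<^sub>C b (Suc k) = Hvec (k, l - k)"
      proof -
        have kl: "k + (l - k) = l" using k by (simp add: mu_def)
        have "Hcoef l k *\<^sub>C b (k - 1) = Hcoef l k *\<^sub>C evec (k - 1, Suc (l - k))"
          using k by (cases k) (auto simp: b_def Hcoef_def beta_def mu_def Suc_diff_Suc)
        moreover have "b (Suc k) = evec (Suc k, l - k - 1)" by (simp add: b_def)
        ultimately show ?thesis by (simp only: Hvec_def prod.case kl)
      qed
      finally show ?thesis by simp
    qed
    ultimately show "(b k, \<Sum>i\<le>mu. ?M i *\<^sub>C b i) \<in> H_hat h" by simp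
  qed
qed

end

theorem theorem1p2:
  fixes n :: nat and h :: real
  assumes "h > 0" and "2 = h * (real n + 1)"
  shows "self_adjoint (spin_oscillator_space h) (J_hat h) \<and>
    self_adjoint (spin_oscillator_space h) (H_hat h) \<and>
    operators_commute (spin_oscillator_space h) (J_hat h) (H_hat h) \<and>
    discrete (spectrum (spin_oscillator_space h) (J_hat h)) \<and>
    (\<forall>z\<in>spectrum (spin_oscillator_space h) (J_hat h). eigenvalue (J_hat h) z) \<and>
    spectrum (spin_oscillator_space h) (J_hat h) =
      {complex_of_real (h * ((1 - real n) / 2 + real k)) |k::nat. True} \<and>
    (\<forall>lambda::real. eigenvalue (J_hat h) (complex_of_real lambda) \<longrightarrow>
      (\<exists>l0 mu :: nat.
        real l0 = lambda / h + (real n - 1) / 2 \<and>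
        mu = min l0 n \<and>
        cdim (eigenspace (J_hat h) (complex_of_real lambda)) = mu + 1 \<and>
        (\<exists>b. is_basis (eigenspace (J_hat h) (complex_of_real lambda)) mu b \<and>
          has_matrix (H_hat h) mu b
            (\<lambda>i j. complex_of_real ((h / 2) powr (3 / 2) * tridiagonal (beta n l0) i j)))))"
proof -
  interpret spin_oscillator n h
    by standard (use assms in auto)
  have eig: "eigenvalue (J_hat h) z \<longleftrightarrow> z \<in> complex_of_real ` level ` index" for z
    unfolding J_hat_diag by (rule eigenvalue_diag_op_iff)
  show ?thesis
    unfolding space_eq_K
  proof (intro conjI allI impI)
    show "self_adjoint K (J_hat h)" unfolding J_hat_diag by (rule self_adjoint_diag_op)
    show "self_adjoint K (H_hat h)" by (rule H_hat_self_adjoint)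
    show "operators_commute K (J_hat h) (H_hat h)" by (rule J_H_commute)
    show "discrete (spectrum K (J_hat h))"
      unfolding spectrum_J by (rule uniform_discrete_imp_discrete[OF uniform_discrete_levels])
    show "\<forall>z\<in>spectrum K (J_hat h). eigenvalue (J_hat h) z"
      unfolding spectrum_J eig by blast
    show "spectrum K (J_hat h) = {complex_of_real (h * ((1 - real n) / 2 + real k)) |k::nat. True}"
      unfolding spectrum_J by (rule spectrum_J_set)
    fix lambda :: real
    assume "eigenvalue (J_hat h) (complex_of_real lambda)"
    then obtain l :: nat where l: "lambda = h * ((1 - real n) / 2 + real l)"
      unfolding eig spectrum_J_set by (auto simp del: of_real_mult of_real_add)
    show "\<exists>l0 mu. real l0 = lambda / h + (real n - 1) / 2 \<and> mu = min l0 n \<and>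
        cdim (eigenspace (J_hat h) (complex_of_real lambda)) = mu + 1 \<and>
        (\<exists>b. is_basis (eigenspace (J_hat h) (complex_of_real lambda)) mu b \<and>
          has_matrix (H_hat h) mu b
            (\<lambda>i j. complex_of_real ((h / 2) powr (3 / 2) * tridiagonal (beta n l0) i j)))"
      by (rule exI[of _ l], rule exI[of _ "min l n"])
        (use h eigenspace_J[of l] in \<open>auto simp: l field_simps simp del: of_real_mult of_real_add\<close>)
  qed
qed

end
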